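(* For a given $0<\theta<\pi/2$ let $M=M_\theta\subset\mathbb{C}$ be the set $$M=\Bigl\{s\in\mathbb{C}:\ |s|>2\pi e^2,\ -\pi+\theta<\arg s<-\tfrac{\pi}{2}+\arctan\tfrac{\pi}{2\log|\xi|}\Bigr\}.$$ On this set we have $$\mathcal{R}(s)=\frac{(-1)^\ell}{2i}\,\xi^{-s}e^{\pi i\xi^2}\,G(q)\bigl(1+O(|\xi|^{-1})\bigr),$$ where the implied constant may depend on $\theta$, and $\xi,\ell,q,G$ are as in the context.
   Context: Riemann's auxiliary function is the entire function $$\mathcal{R}(s)=\int_{0\swarrow1}\frac{x^{-s}e^{\pi i x^2}}{e^{\pi i x}-e^{-\pi i x}}\,dx,$$ where the path is a straight line of direction $e^{-3\pi i/4}$ (running from the upper right to the lower left) crossing the real axis at a point strictly between $0$ and $1$, and $x^{-s}=\exp(-s\log x)$ with the principal logarithm. Throughout $\arg s$ is the principal argument. For $-\pi<\arg s<\pi$ put $\xi=\sqrt{s/(2\pi i)}$ with $-\frac{3\pi}{4}<\arg\xi<\frac{\pi}{4}$ (so $|\xi|=\sqrt{|s|/2\pi}$), $\xi_1=\operatorname{Re}\xi$, $\xi_2=\operatorname{Im}\xi$, $\ell=\lfloor\xi_1-\xi_2\rfloor$, and $q=-2(\ell+\tfrac12-\xi)$. The power $\xi^{-s}=\exp(-s\log\xi)$ uses $\log\xi=\log|\xi|+i\arg\xi$. $G$ is the entire function $$G(q)=\frac{e^{\frac{\pi i}{2}q^2}-\sqrt2\,e^{\frac{\pi i}{8}}\cos\frac{\pi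 q}{2}}{\cos\pi q}$$ (with removable singularities removed). *)

theory Defs
  imports "HOL-Complex_Analysis.Complex_Analysis"
begin

(* The line is c + t * cis (- 3 * pi / 4) with t running over the reals in increasing order, i.e.
   from the upper right to the lower left.  For 0 < c < 1 the integral does not depend on c; the
   crossing point is kept as a parameter since the function is defined with an arbitrary one. *)
definition riemann_aux :: "real \<Rightarrow> complex \<Rightarrow> complex" where
  "riemann_aux c s =
     (LINT t|lborel.
        (let x = of_real c + of_real t * cis (- 3 * pi / 4) in
           x powr (- s) * exp (of_real pi * \<i> * x ^ 2)
             / (exp (of_real pi * \<i> * x) - exp (- (of_real pi * \<i> * x)))
             * cis (- 3 * pi / 4)))"

(* This is not csqrt: the branch is cut along negative real s.  There is exactly one such z if
   s is not a real number \<le> 0, see xi_eq. *)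
definition xi :: "complex \<Rightarrow> complex" where
  "xi s = (THE z. z ^ 2 = s / (2 * of_real pi * \<i>) \<and> - 3 * pi / 4 < Arg z \<and> Arg z < pi / 4)"

definition ell :: "complex \<Rightarrow> int" where
  "ell s = \<lfloor>Re (xi s) - Im (xi s)\<rfloor>"

definition qpar :: "complex \<Rightarrow> complex" where
  "qpar s = - 2 * (of_int (ell s) + 1 / 2 - xi s)"

definition G :: "complex \<Rightarrow> complex" where
  "G = remove_sings (\<lambda>q.
     (exp (of_real pi * \<i> / 2 * q ^ 2)
        - of_real (sqrt 2) * exp (of_real pi * \<i> / 8) * cos (of_real pi * q / 2))
     / cos (of_real pi * q))"

definition M :: "real \<Rightarrow> complex set" where
  "M \<theta> = {s. norm s > 2 * pi * exp 1 ^ 2 \<and> - pi + \<theta> < Arg s \<and>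
             Arg s < - pi / 2 + arctan (pi / (2 * ln (norm (xi s))))}"

lemma xi_eq:
  assumes "s \<noteq> 0" "Arg s < pi"
  shows "xi s = rcis (sqrt (norm s / (2 * pi))) (Arg s / 2 - pi / 4)"
    and "Arg (xi s) = Arg s / 2 - pi / 4"
    and "xi s ^ 2 = s / (2 * of_real pi * \<i>)"
    and "norm (xi s) = sqrt (norm s / (2 * pi))"
proof -
  define w where "w = rcis (sqrt (norm s / (2 * pi))) (Arg s / 2 - pi / 4)"
  have r: "sqrt (norm s / (2 * pi)) > 0" using assms by simp
  have A: "- pi < Arg s" by (rule mpi_less_Arg)
  have Arg_w: "Arg w = Arg s / 2 - pi / 4"
    unfolding w_def by (rule Arg_rcis[OF _ r]) (use A assms(2) in auto)
  have "w ^ 2 = rcis (norm s / (2 * pi)) (Arg s - pi / 2)"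
    by (simp add: w_def DeMoivre2 algebra_simps)
  also have "\<dots> = rcis (norm s) (Arg s) / rcis (2 * pi) (pi / 2)"
    by (simp add: rcis_divide)
  also have "rcis (norm s) (Arg s) = s" by (rule rcis_cmod_Arg)
  also have "rcis (2 * pi) (pi / 2) = 2 * of_real pi * \<i>"
    by (simp add: rcis_def)
  finally have w2: "w ^ 2 = s / (2 * of_real pi * \<i>)" .
  have w0: "w \<noteq> 0" using r assms by (simp add: w_def rcis_def)
  have "xi s = w" unfolding xi_def
  proof (rule the_equality)
    show "w ^ 2 = s / (2 * of_real pi * \<i>) \<and> - 3 * pi / 4 < Arg w \<and> Arg w < pi / 4"
      using w2 Arg_w A assms by auto
  next
    fix z assume z: "z ^ 2 = s / (2 * of_real pi * \<i>) \<and> - 3 * pi / 4 < Arg z \<and> Arg z < pi / 4"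
    then have "z ^ 2 = w ^ 2" using w2 by simp
    then have "z = w \<or> z = - w" by (simp only: power2_eq_iff)
    moreover have "z \<noteq> - w"
    proof
      assume "z = - w"
      then have "Arg z = (if Arg w \<le> 0 then Arg w + pi else Arg w - pi)"
        using w0 by (simp add: Arg_minus)
      then show False using z Arg_w A assms by (auto split: if_splits)
    qed
    ultimately show "z = w" by blast
  qed
  then show "xi s = rcis (sqrt (norm s / (2 * pi))) (Arg s / 2 - pi / 4)"
    and "Arg (xi s) = Arg s / 2 - pi / 4"
    and "xi s ^ 2 = s / (2 * of_real pi * \<i>)"
    and "norm (xi s) = sqrt (norm s / (2 * pi))"
    using Arg_w w2 by (simp_all add: w_def)
qed

end

theory Submission
  imports Defs "HOL-Probability.Characteristic_Functions" "HOL-Real_Asymp.Real_Asymp"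
begin

text \<open>
  For \<open>s \<in> M\<close> the saddle \<open>\<xi>\<close> of \<open>x\<^sup>-\<^sup>s e\<^sup>\<pi>\<^sup>i\<^sup>x\<^sup>2\<close> lies deep in the lower half-plane. There
  \<open>1 / (e\<^sup>\<pi>\<^sup>i\<^sup>x - e\<^sup>-\<^sup>\<pi>\<^sup>i\<^sup>x)\<close> is \<open>e\<^sup>-\<^sup>\<pi>\<^sup>i\<^sup>x\<close> up to an exponentially small relative error, and for the same
  reason \<open>G(q)\<close> is \<open>- sqrt 2 e\<^sup>\<pi>\<^sup>i\<^sup>/\<^sup>8 e\<^sup>-\<^sup>\<pi>\<^sup>i\<^sup>q\<^sup>/\<^sup>2\<close>. So \<open>\<ell>\<close> drops out, and the claim becomes
  \<open>R(s) = - (1 / sqrt 2) e\<^sup>\<pi>\<^sup>i\<^sup>/\<^sup>8 \<xi>\<^sup>-\<^sup>s exp (\<pi> i \<xi>\<^sup>2 - \<pi> i \<xi>) (1 + O(1 / |\<xi>|))\<close>, a Gaussian integral over the line of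
  slope 1 through \<open>\<xi>\<close>.

  No residues are needed: the contour follows a line of slope 1 from the upper right down to a point \<open>P\<close>
  below the interval \<open>(0,1)\<close>, a segment in the lower half-plane to a point \<open>A\<close> of the line through \<open>\<xi>\<close>, and then
  that line. If \<open>Re s \<le> 0\<close>, the segment runs along the ray of argument \<open>- \<pi> / 4\<close>; otherwise it runs just below
  the real axis, starting at distance of order \<open>1 / |s|\<close> from the pole 1. The first two pieces are negligible: the
  upper bound for \<open>arg s\<close> in the definition of \<open>M\<close> ensures that the main term is at least
  \<open>exp (c |\<xi>|\<^sup>2 / (ln |\<xi>|)\<^sup>3 - \<pi> |\<xi>|)\<close> in the second case.
\<close>

subsection \<open>Integrals along parallel rays\<close>

text \<open>Write \<open>\<xi> = rcis N (- pi / 2 - \<beta>)\<close>, so that \<open>\<beta>\<close>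
  and \<open>Re s\<close> have opposite signs. The obstacle is the edge of \<open>M\<close> with
  \<open>\<beta> < 0\<close>. With \<open>b = - 2 * \<beta>\<close> and \<open>L = ln N\<close>, the
  main term has exponent \<open>2 * pi * N ^ 2\<close> times
  \<open>(cos b * pi / 2 - sin b * L) + (sin b - b * cos b) / 2\<close>, up to \<open>O(N)\<close>.
  At the edge the first bracket vanishes; the second is about \<open>b ^ 3 / 6\<close> with
  \<open>b\<close> about \<open>pi / (2 * L)\<close>. This is the origin of the cube of the
  logarithm, and it forbids any loss \<open>exp (c * N ^ 2)\<close> elsewhere on the contour. For
  \<open>Re s > 0\<close> the factor \<open>norm x powr (- Re s)\<close> grows towards 0, and
  \<open>exp (Im s * Arg x)\<close> grows below the real axis because \<open>Im s < 0\<close>. Both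
  remain bounded if \<open>norm x\<close> is at least \<open>1 - O(1 / norm s)\<close> and
  \<open>Arg x\<close> at least \<open>- O(1 / norm s)\<close>; passing so close to the pole 1 costs
  only a power of \<open>N\<close>. For \<open>Re s \<le> 0\<close> the power is harmless near 0,
  and the ray of argument \<open>- pi / 4\<close> meets the line through \<open>\<xi>\<close> at its
  point closest to 0. The role of \<open>\<theta>\<close> is to keep this point at distance of order
  \<open>N\<close> from 0.\<close>

definition ray_integral :: "(complex \<Rightarrow> complex) \<Rightarrow> complex \<Rightarrow> complex \<Rightarrow> complex" where
  "ray_integral f z u = (LINT t:{0..}|lborel. f (z + of_real t * u) * u)"

text \<open>Cauchy's theorem for a half-infinite strip. With a primitive \<open>F\<close> on
  \<open>S\<close>, the truncated rays differ by the increments of \<open>F\<close> over the near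
  and the far side; the far side has constant length, and \<open>B\<close> sends its integral to
  0.\<close>

lemma ray_integral_diff:
  assumes S: "convex S" "open S" "f holomorphic_on S"
    and inS: "\<And>z t. z \<in> closed_segment a b \<Longrightarrow> 0 \<le> t \<Longrightarrow> z + of_real t * u \<in> S"
    and int: "set_integrable lborel {0..} (\<lambda>t. f (a + of_real t * u) * u)"
             "set_integrable lborel {0..} (\<lambda>t. f (b + of_real t * u) * u)"
    and lim: "(B \<longlongrightarrow> 0) at_top"
    and bound: "\<And>z t. z \<in> closed_segment a b \<Longrightarrow> 0 \<le> t \<Longrightarrow> norm (f (z + of_real t * u)) \<le> B t"
  shows "ray_integral f a u - ray_integral f b u = contour_integral (linepath a b) f"
proof -
  obtain F where "\<And>x. x \<in> S \<Longrightarrow> (F has_field_derivative f x) (at x within S)"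
    using holomorphic_convex_primitive'[OF S] by blast
  then have F: "\<And>x. x \<in> S \<Longrightarrow> (F has_field_derivative f x) (at x)"
    using S(2) by (metis at_within_open)
  have contour: "contour_integral (linepath x y) f = F y - F x"
    if "closed_segment x y \<subseteq> S" for x y
  proof (rule contour_integral_unique)
    show "(f has_contour_integral F y - F x) (linepath x y)"
      using contour_integral_primitive[OF has_field_derivative_at_within[OF F], of S "linepath x y"] that
      by auto
  qed
  have contf: "continuous_on S f" using S(3) by (rule holomorphic_on_imp_continuous_on)
  have ray: "((\<lambda>T. F (z + of_real T * u) - F z) \<longlongrightarrow> ray_integral f z u) at_top"
    if z: "z \<in> closed_segment a b"
      and int: "set_integrable lborel {0..} (\<lambda>t. f (z + of_real t * u) * u)" for z
  proof -
    have "((\<lambda>T. LINT t:{0..T}|lborel. f (z + of_real t * u) * u) \<longlongrightarrow> ray_integral f z u) at_top"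
      unfolding ray_integral_def
      by (rule tendsto_set_lebesgue_integral_at_top[OF _ int]) auto
    moreover have "\<forall>\<^sub>F T in at_top. (LINT t:{0..T}|lborel. f (z + of_real t * u) * u)
                     = F (z + of_real T * u) - F z"
      using eventually_ge_at_top[of "0::real"]
    proof eventually_elim
      case (elim T)
      have "((\<lambda>t. f (z + of_real t * u) * u) has_integral
              F (z + of_real T * u) - F (z + of_real 0 * u)) {0..T}"
      proof (rule fundamental_theorem_of_calculus[OF elim])
        fix t :: real assume "t \<in> {0..T}"
        then have "z + of_real t * u \<in> S" using inS[OF z] by auto
        then have "((F \<circ> (\<lambda>t. z + of_real t * u)) has_vector_derivative u * f (z + of_real t * u))
                    (at t within {0..T})"
          by (intro field_vector_diff_chain_within)
             (auto intro!: derivative_eq_intros has_field_derivative_at_within[OF F])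
        then show "((\<lambda>t. F (z + of_real t * u)) has_vector_derivative f (z + of_real t * u) * u)
                    (at t within {0..T})"
          by (simp add: o_def mult.commute)
      qed
      then have FTC: "((\<lambda>t. f (z + of_real t * u) * u) has_integral F (z + of_real T * u) - F z) {0..T}"
        by simp
      have "set_integrable lborel {0..T} (\<lambda>t. f (z + of_real t * u) * u)"
        by (rule set_integrable_subset[OF int]) auto
      then show ?case
        by (rule trans[OF set_borel_integral_eq_integral(2) integral_unique[OF FTC]])
    qed
    ultimately show ?thesis
      by (rule Lim_transform_eventually)
  qed
  have ends: "a \<in> closed_segment a b" "b \<in> closed_segment a b" by auto
  have seg0: "closed_segment a b \<subseteq> S" using inS[where t=0] by auto
  have "((\<lambda>T. (F (a + of_real T * u) - F a) - (F (b + of_real T * u) - F b))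
          \<longlongrightarrow> ray_integral f a u - ray_integral f b u) at_top"
    using ray[OF ends(1) int(1)] ray[OF ends(2) int(2)] by (rule tendsto_diff)
  moreover have "((\<lambda>T. (F (a + of_real T * u) - F a) - (F (b + of_real T * u) - F b))
          \<longlongrightarrow> F b - F a) at_top"
  proof -
    have "((\<lambda>T. F (b + of_real T * u) - F (a + of_real T * u)) \<longlongrightarrow> 0) at_top"
    proof (rule Lim_null_comparison)
      show "((\<lambda>t. B t * norm (b - a)) \<longlongrightarrow> 0) at_top"
        using tendsto_mult_left_zero[OF lim] by simp
      show "\<forall>\<^sub>F T in at_top. norm (F (b + of_real T * u) - F (a + of_real T * u)) \<le> B T * norm (b - a)"
        using eventually_ge_at_top[of "0::real"]
      proof eventually_elim
        case (elim T)
        have sg: "closed_segment (a + of_real T * u) (b + of_real T * u)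
                    = (\<lambda>z. z + of_real T * u) ` closed_segment a b"
          using closed_segment_translation[of "of_real T * u" a b] by (simp add: add.commute)
        have sub: "closed_segment (a + of_real T * u) (b + of_real T * u) \<subseteq> S"
          using inS elim unfolding sg by auto
        have "norm (contour_integral (linepath (a + of_real T * u) (b + of_real T * u)) f)
               \<le> B T * norm ((b + of_real T * u) - (a + of_real T * u))"
        proof (rule contour_integral_bound_linepath)
          show "f contour_integrable_on linepath (a + of_real T * u) (b + of_real T * u)"
            by (rule contour_integrable_continuous_linepath)
               (rule continuous_on_subset[OF contf sub])
          show "0 \<le> B T" using bound[OF ends(1) elim] norm_ge_zero order_trans by blast
          show "norm (f x) \<le> B T" if "x \<in> closed_segment (a + of_real T * u) (b + of_real T * u)" for x
            using that bound elim unfolding sg by auto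
        qed
        then show ?case using contour[OF sub] by simp
      qed
    qed
    from tendsto_diff[OF tendsto_const[of "F b - F a"] this]
    show ?thesis by (simp add: algebra_simps)
  qed
  ultimately have "ray_integral f a u - ray_integral f b u = F b - F a"
    by (rule tendsto_unique[OF trivial_limit_at_top_linorder])
  then show ?thesis using contour[OF seg0] by simp
qed

lemma integrable_shifted_gaussian:
  assumes "\<kappa> > 0"
  shows "integrable lborel (\<lambda>t::real. exp (- \<kappa> * (t - m)^2))"
proof -
  have "integrable lborel (normal_density m (sqrt (1 / (2 * \<kappa>))))"
    using assms by (intro integrable_normal_density) auto
  then have "integrable lborel (\<lambda>t. sqrt (pi / \<kappa>) * normal_density m (sqrt (1 / (2 * \<kappa>))) t)"
    by (rule integrable_mult_right)
  also have "(\<lambda>t. sqrt (pi / \<kappa>) * normal_density m (sqrt (1 / (2 * \<kappa>))) t) =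
             (\<lambda>t::real. exp (- \<kappa> * (t - m)^2))"
  proof
    fix t :: real
    have "2 * pi * (sqrt (1 / (2 * \<kappa>)))\<^sup>2 = pi / \<kappa>"
      and "- (t - m)\<^sup>2 / (2 * (sqrt (1 / (2 * \<kappa>)))\<^sup>2) = - \<kappa> * (t - m)^2"
      using assms by (simp_all add: field_simps)
    then show "sqrt (pi / \<kappa>) * normal_density m (sqrt (1 / (2 * \<kappa>))) t = exp (- \<kappa> * (t - m)^2)"
      using assms unfolding normal_density_def by simp
  qed
  finally show ?thesis .
qed

subsection \<open>The integrand and the deformation of the contour\<close>

lemma sin_ge_mult_cos:
  fixes u :: real
  assumes "0 \<le> u" "u \<le> pi"
  shows "u * cos u \<le> sin u"
proof -
  have "(\<lambda>v. sin v - v * cos v) 0 \<le> (\<lambda>v. sin v - v * cos v) u"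
  proof (rule DERIV_nonneg_imp_nondecreasing[OF assms(1)])
    fix v assume v: "0 \<le> v" "v \<le> u"
    have "((\<lambda>v. sin v - v * cos v) has_real_derivative v * sin v) (at v)"
      by (auto intro!: derivative_eq_intros)
    moreover have "0 \<le> v * sin v"
      using v assms by (auto intro!: mult_nonneg_nonneg sin_ge_zero)
    ultimately show "\<exists>y. ((\<lambda>v. sin v - v * cos v) has_real_derivative y) (at v) \<and> 0 \<le> y"
      by blast
  qed
  then show ?thesis by simp
qed

text \<open>By the double-angle formula \<open>sin u\<close> is at least
  \<open>u * cos (u / 2) ^ 2\<close>, and the squared cosine is at least 1/2 on this range.\<close>

lemma sin_ge_half:
  fixes u :: real
  assumes "0 \<le> u" "u \<le> pi / 2"
  shows "u / 2 \<le> sin u"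
proof -
  have c: "1 / 2 \<le> cos (u / 2) ^ 2"
    using cos_ge_zero[of u] assms cos_double_cos[of "u / 2"] by simp
  have c0: "0 \<le> cos (u / 2)" using assms by (intro cos_ge_zero) auto
  have "u / 2 * cos (u / 2) \<le> sin (u / 2)" using assms by (intro sin_ge_mult_cos) auto
  then have "2 * (u / 2 * cos (u / 2)) * cos (u / 2) \<le> 2 * sin (u / 2) * cos (u / 2)"
    using c0 by (intro mult_right_mono) auto
  also have "2 * sin (u / 2) * cos (u / 2) = sin u" using sin_double[of "u / 2"] by simp
  finally have "u * cos (u / 2) ^ 2 \<le> sin u" by (simp add: power2_eq_square mult.assoc)
  moreover have "u * (1 / 2) \<le> u * cos (u / 2) ^ 2" using c assms(1) by (rule mult_left_mono)
  ultimately show ?thesis by simp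
qed

text \<open>The derivative of the difference is \<open>v * (sin v - v / 2)\<close>. At the edge of
  \<open>M\<close> this cubic term is all that is left of the exponent of the main term.\<close>

lemma sin_minus_mult_cos_ge_cube:
  fixes u :: real
  assumes "0 \<le> u" "u \<le> pi / 2"
  shows "u ^ 3 / 6 \<le> sin u - u * cos u"
proof -
  have "(\<lambda>v. sin v - v * cos v - v ^ 3 / 6) 0 \<le> (\<lambda>v. sin v - v * cos v - v ^ 3 / 6) u"
  proof (rule DERIV_nonneg_imp_nondecreasing[OF assms(1)])
    fix v assume v: "0 \<le> v" "v \<le> u"
    have "((\<lambda>v. sin v - v * cos v - v ^ 3 / 6) has_real_derivative v * (sin v - v / 2)) (at v)"
      by (auto intro!: derivative_eq_intros simp: algebra_simps power2_eq_square)
    moreover have "0 \<le> v * (sin v - v / 2)"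
      using v assms sin_ge_half[of v] by (intro mult_nonneg_nonneg) auto
    ultimately show "\<exists>y. ((\<lambda>v. sin v - v * cos v - v ^ 3 / 6) has_real_derivative y) (at v) \<and> 0 \<le> y"
      by blast
  qed
  then show ?thesis by simp
qed

section \<open>The kernel: denominator, size and holomorphy\<close>

text \<open>This is \<open>2 * \<i> * sin (of_real pi * x)\<close>, so its zeros are the
  integers.\<close>

definition sin_denom :: "complex \<Rightarrow> complex" where
  "sin_denom x = exp (of_real pi * \<i> * x) - exp (- (of_real pi * \<i> * x))"

definition aux_kernel :: "complex \<Rightarrow> complex \<Rightarrow> complex" where
  "aux_kernel s x = x powr (- s) * exp (of_real pi * \<i> * x ^ 2) / sin_denom x"

text \<open>The two exponentials have moduli \<open>exp (- pi * Im x)\<close> and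
  \<open>exp (pi * Im x)\<close>; the difference of these is a hyperbolic sine, which dominates its
  argument.\<close>

lemma norm_sin_denom_ge_Im: "2 * pi * \<bar>Im x\<bar> \<le> norm (sin_denom x)"
proof -
  have "2 * (pi * \<bar>Im x\<bar>) \<le> \<bar>exp (- pi * Im x) - exp (pi * Im x)\<bar>"
    using real_le_abs_sinh[of "pi * Im x"] by (simp add: abs_minus_commute abs_mult exp_minus)
  also have "\<dots> = \<bar>norm (exp (of_real pi * \<i> * x)) - norm (exp (- (of_real pi * \<i> * x)))\<bar>"
    by simp
  also have "\<dots> \<le> norm (sin_denom x)"
    unfolding sin_denom_def by (rule norm_triangle_ineq3)
  finally show ?thesis by simp
qed

lemma sin_denom_nonzero: "Im x \<noteq> 0 \<Longrightarrow> sin_denom x \<noteq> 0"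
proof
  assume "Im x \<noteq> 0" "sin_denom x = 0"
  then have "2 * (pi * \<bar>Im x\<bar>) \<le> 0" using norm_sin_denom_ge_Im[of x] by simp
  moreover have "0 < pi * \<bar>Im x\<bar>" using \<open>Im x \<noteq> 0\<close> by (intro mult_pos_pos) auto
  ultimately show False by linarith
qed

lemma norm_sin_denom_ge_sin: "2 * \<bar>sin (pi * Re x)\<bar> \<le> norm (sin_denom x)"
proof -
  have "Im (sin_denom x) = (exp (- pi * Im x) + exp (pi * Im x)) * sin (pi * Re x)"
    by (simp add: sin_denom_def Im_exp algebra_simps)
  moreover have "2 \<le> exp (- pi * Im x) + exp (pi * Im x)"
    using cosh_real_ge_1[of "pi * Im x"] by (simp add: cosh_def)
  ultimately have "2 * \<bar>sin (pi * Re x)\<bar> \<le> \<bar>Im (sin_denom x)\<bar>"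
    by (simp add: abs_mult mult_right_mono)
  then show ?thesis using abs_Im_le_cmod order_trans by blast
qed

text \<open>\<open>x\<close> lies between the lines of slope 1 through the zeros 0 and 1. Away from
  the real axis the imaginary part suffices; close to it the strip keeps \<open>Re x\<close> away
  from 0 and 1.\<close>

lemma norm_sin_denom_ge_strip:
  assumes "0 < m" "m \<le> Re x - Im x" "Re x - Im x \<le> 1 - m"
  shows "m \<le> norm (sin_denom x)"
proof (cases "\<bar>Im x\<bar> \<ge> m / 2")
  case True
  have "m \<le> 2 * 2 * (m / 2)" using assms by simp
  also have "\<dots> \<le> 2 * pi * \<bar>Im x\<bar>" using True assms pi_ge_two by (intro mult_mono) auto
  finally show ?thesis using norm_sin_denom_ge_Im[of x] by linarith
next
  case False
  define a where "a = Re x"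
  have a: "m / 2 \<le> a" "a \<le> 1 - m / 2" using False assms by (auto simp: a_def)
  \<comment> \<open>By the symmetry of the sine, only the distance to the nearer of the zeros 0 and
    1 matters.\<close>
  define b where "b = min a (1 - a)"
  have b: "m / 2 \<le> b" "b \<le> 1 / 2" using a unfolding b_def by linarith+
  have "sin (pi * a) = sin (pi * b)"
    using sin_pi_minus[of "pi * a"] by (simp add: b_def min_def algebra_simps)
  moreover have "pi * b / 2 \<le> sin (pi * b)"
    using b assms by (intro sin_ge_half) (auto simp: mult_le_cancel_left_pos)
  moreover have "m / 2 * 2 \<le> b * pi" using b assms pi_ge_two by (intro mult_mono) auto
  ultimately have "m \<le> 2 * sin (pi * a)" by (simp add: mult.commute)
  then show ?thesis using norm_sin_denom_ge_sin[of x] unfolding a_def by linarith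
qed

lemma two_Re_Im: "2 * Re x * Im x = norm x ^ 2 - (Re x - Im x) ^ 2"
  unfolding cmod_power2 by (simp add: power2_eq_square algebra_simps)

lemma norm_aux_kernel:
  "norm (aux_kernel s x) =
     norm x powr (- Re s) * exp (Im s * Arg x) * exp (- 2 * pi * Re x * Im x) / norm (sin_denom x)"
proof -
  have "norm (exp (of_real pi * \<i> * x ^ 2)) = exp (- 2 * pi * Re x * Im x)"
    by (simp add: power2_eq_square algebra_simps)
  then show ?thesis
    by (simp add: aux_kernel_def norm_mult norm_divide norm_powr_complex)
qed

text \<open>On a line of slope 1, \<open>Re x - Im x\<close> is constant, so this form displays the
  Gaussian decay in \<open>norm x\<close>.\<close>

lemma norm_aux_kernel':
  "norm (aux_kernel s x) =
     norm x powr (- Re s) * exp (Im s * Arg x) * exp (pi * (Re x - Im x) ^ 2 - pi * norm x ^ 2)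
       / norm (sin_denom x)"
proof -
  have "- 2 * pi * Re x * Im x = pi * (Re x - Im x) ^ 2 - pi * norm x ^ 2"
    using arg_cong[OF two_Re_Im[of x], of "\<lambda>y. - pi * y"] by (simp add: algebra_simps)
  then show ?thesis unfolding norm_aux_kernel by simp
qed

lemma powr_le_exp_square:
  assumes "m > (0::real)"
  shows "\<exists>C. \<forall>u\<ge>m. u powr a \<le> C * exp (u ^ 2)"
proof (intro exI allI impI)
  fix u assume u: "m \<le> u"
  show "u powr a \<le> max (m powr a) (exp (a ^ 2 / 4)) * exp (u ^ 2)"
  proof (cases "a \<le> 0")
    case True
    have "u powr a \<le> m powr a * 1" using True u assms by (simp add: powr_mono2')
    also have "\<dots> \<le> max (m powr a) (exp (a ^ 2 / 4)) * exp (u ^ 2)"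
      by (intro mult_mono) (auto simp: le_max_iff_disj)
    finally show ?thesis .
  next
    case False
    have "ln u \<le> u" using ln_less_self u assms by (simp add: less_imp_le)
    then have "a * ln u \<le> a * u" using False by simp
    also have "\<dots> \<le> a ^ 2 / 4 + u ^ 2"
      using zero_le_power2[of "a / 2 - u"] by (simp add: power2_eq_square algebra_simps)
    finally have "u powr a \<le> exp (a ^ 2 / 4) * exp (u ^ 2)"
      using u assms by (simp add: powr_def exp_add[symmetric])
    also have "\<dots> \<le> max (m powr a) (exp (a ^ 2 / 4)) * exp (u ^ 2)"
      by (intro mult_mono) (auto simp: le_max_iff_disj)
    finally show ?thesis .
  qed
qed

text \<open>Since \<open>pi > 2\<close>, one \<open>exp (- (norm x ^ 2))\<close> can be spent on the
  power of \<open>norm x\<close> and another one remains.\<close>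

lemma aux_kernel_decay:
  assumes "m > 0"
  obtains C where "C \<ge> 0"
    "\<And>x. m \<le> norm x \<Longrightarrow> \<bar>Re x - Im x\<bar> \<le> K \<Longrightarrow> m \<le> norm (sin_denom x) \<Longrightarrow>
       norm (aux_kernel s x) \<le> C * exp (- (norm x ^ 2))"
proof -
  obtain C1 where C1: "\<And>u. m \<le> u \<Longrightarrow> u powr (- Re s) \<le> C1 * exp (u ^ 2)"
    using powr_le_exp_square[OF assms] by blast
  have C1_0: "0 \<le> C1"
    using C1[of m] powr_ge_zero[of m "- Re s"] by (smt (verit) exp_gt_zero mult_nonneg_nonpos2 mult_less_0_iff)
  define C where "C = C1 * exp (\<bar>Im s\<bar> * pi) * exp (pi * K ^ 2) / m"
  show ?thesis
  proof (rule that[of C])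
    show "0 \<le> C" using C1_0 assms by (simp add: C_def)
    fix x assume x: "m \<le> norm x" "\<bar>Re x - Im x\<bar> \<le> K" "m \<le> norm (sin_denom x)"
    have "\<bar>Arg x\<bar> \<le> pi" using Arg_bounded[of x] by auto
    then have "\<bar>Im s * Arg x\<bar> \<le> \<bar>Im s\<bar> * pi" by (simp add: abs_mult mult_left_mono)
    then have e1: "exp (Im s * Arg x) \<le> exp (\<bar>Im s\<bar> * pi)" by simp
    have "(Re x - Im x) ^ 2 \<le> K ^ 2" using x(2) by (simp add: abs_le_square_iff[symmetric])
    moreover have "2 * norm x ^ 2 \<le> pi * norm x ^ 2" using pi_ge_two by (intro mult_right_mono) auto
    ultimately have "pi * (Re x - Im x) ^ 2 - pi * norm x ^ 2 \<le> pi * K ^ 2 - 2 * norm x ^ 2"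
      by (smt (verit) mult_left_mono pi_ge_zero)
    then have e2: "exp (pi * (Re x - Im x) ^ 2 - pi * norm x ^ 2) \<le> exp (pi * K ^ 2) * exp (- 2 * norm x ^ 2)"
      by (simp add: exp_add[symmetric])
    have "norm (aux_kernel s x)
           \<le> C1 * exp (norm x ^ 2) * exp (\<bar>Im s\<bar> * pi) * (exp (pi * K ^ 2) * exp (- 2 * norm x ^ 2)) / m"
      unfolding norm_aux_kernel'
      using C1[OF x(1)] C1_0 e1 e2 x(3) assms by (intro frac_le mult_mono) auto
    also have "\<dots> = C * (exp (norm x ^ 2) * exp (- 2 * norm x ^ 2))"
      by (simp add: C_def)
    also have "exp (norm x ^ 2) * exp (- 2 * norm x ^ 2) = exp (- (norm x ^ 2))"
      by (simp add: exp_add[symmetric])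
    finally show "norm (aux_kernel s x) \<le> C * exp (- (norm x ^ 2))" .
  qed
qed

lemma aux_kernel_holomorphic:
  assumes "S \<inter> \<real>\<^sub>\<le>\<^sub>0 = {}" "\<And>x. x \<in> S \<Longrightarrow> sin_denom x \<noteq> 0"
  shows "aux_kernel s holomorphic_on S"
proof -
  have "(\<lambda>x. x powr (- s) * exp (of_real pi * \<i> * x ^ 2) / sin_denom x) holomorphic_on S"
    using assms by (auto intro!: holomorphic_intros simp: sin_denom_def)
  then show ?thesis by (simp add: aux_kernel_def[abs_def])
qed

section \<open>Sliding half-lines of slope 1\<close>

text \<open>\<open>Re x - Im x\<close> is constant along each ray and bounded over the segment of
  starting points, so \<open>aux_kernel_decay\<close> gives one integrable majorant for all the
  parallel rays.\<close>

lemma aux_kernel_ray: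
  assumes u: "u = cis (pi / 4) \<or> u = - cis (pi / 4)"
    and S: "convex S" "open S" "aux_kernel s holomorphic_on S" and m: "m > 0"
    and inS: "\<And>z t. z \<in> closed_segment a b \<Longrightarrow> 0 \<le> t \<Longrightarrow>
       z + of_real t * u \<in> S \<and> m \<le> norm (z + of_real t * u) \<and> m \<le> norm (sin_denom (z + of_real t * u))"
  shows "set_integrable lborel {0..} (\<lambda>t. aux_kernel s (a + of_real t * u) * u)"
    and "ray_integral (aux_kernel s) a u - ray_integral (aux_kernel s) b u
           = contour_integral (linepath a b) (aux_kernel s)"
proof -
  have nu: "norm u = 1" and ReIm: "Re u = Im u" using u by (auto simp: cos_45 sin_45)
  have "bounded (closed_segment a b)" by (rule bounded_closed_segment)
  then obtain R where R: "\<And>z. z \<in> closed_segment a b \<Longrightarrow> norm z \<le> R" unfolding bounded_iff by blast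
  have R0: "0 \<le> R" using R[of a] norm_ge_zero[of a] by (meson ends_in_segment order_trans)
  obtain C where C: "C \<ge> 0"
    "\<And>x. m \<le> norm x \<Longrightarrow> \<bar>Re x - Im x\<bar> \<le> 2 * R \<Longrightarrow> m \<le> norm (sin_denom x) \<Longrightarrow>
       norm (aux_kernel s x) \<le> C * exp (- (norm x ^ 2))"
    using aux_kernel_decay[OF m] by blast
  \<comment> \<open>The exponent comes from
    \<open>(t - norm z) ^ 2 \<ge> t ^ 2 / 2 - norm z ^ 2\<close> and \<open>norm z \<le> R\<close>;
    halving the quadratic term makes the bound uniform in \<open>z\<close>.\<close>
  define B where "B t = C * exp (R ^ 2) * exp (- (1 / 2) * (t - 0) ^ 2)" for t :: real
  have bound: "norm (aux_kernel s (z + of_real t * u)) \<le> B t"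
    if z: "z \<in> closed_segment a b" and t: "0 \<le> t" for z t
  proof -
    have "Re (z + of_real t * u) - Im (z + of_real t * u) = Re z - Im z" by (simp add: ReIm)
    moreover have "\<bar>Re z - Im z\<bar> \<le> 2 * R"
      using R[OF z] abs_Re_le_cmod[of z] abs_Im_le_cmod[of z] by linarith
    ultimately have le: "norm (aux_kernel s (z + of_real t * u)) \<le> C * exp (- (norm (z + of_real t * u) ^ 2))"
      using inS[OF that] by (intro C(2)) auto
    have "\<bar>t - norm z\<bar> \<le> norm (z + of_real t * u)"
      using norm_triangle_ineq3[of "of_real t * u" "- z"] t nu by (simp add: norm_mult add.commute)
    then have "(t - norm z) ^ 2 \<le> norm (z + of_real t * u) ^ 2"
      by (metis abs_ge_zero power2_abs power_mono)
    moreover have "t ^ 2 / 2 - norm z ^ 2 \<le> (t - norm z) ^ 2"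
      using zero_le_power2[of "t - 2 * norm z"] by (simp add: power2_eq_square algebra_simps)
    moreover have "norm z ^ 2 \<le> R ^ 2" using R[OF z] by (intro power_mono) auto
    ultimately have "- (norm (z + of_real t * u) ^ 2) \<le> R ^ 2 + - (1 / 2) * (t - 0) ^ 2" by simp
    then have "exp (- (norm (z + of_real t * u) ^ 2)) \<le> exp (R ^ 2) * exp (- (1 / 2) * (t - 0) ^ 2)"
      by (simp only: exp_add[symmetric] exp_le_cancel_iff)
    then show ?thesis using le mult_left_mono[OF _ C(1)] unfolding B_def mult.assoc by (meson order_trans)
  qed
  have contf: "continuous_on S (aux_kernel s)" using S(3) by (rule holomorphic_on_imp_continuous_on)
  have int: "set_integrable lborel {0..} (\<lambda>t. aux_kernel s (z + of_real t * u) * u)"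
    if z: "z \<in> closed_segment a b" for z
    unfolding set_integrable_def
  proof (rule Bochner_Integration.integrable_bound)
    show "integrable lborel B"
      unfolding B_def by (intro integrable_mult_right integrable_shifted_gaussian) auto
    have "continuous_on {0..} (\<lambda>t. aux_kernel s (z + of_real t * u) * u)"
      using inS[OF z] by (intro continuous_intros continuous_on_compose2[OF contf]) auto
    from borel_measurable_continuous_on_indicator[OF _ this] show "(\<lambda>t. indicat_real {0..} t *\<^sub>R (aux_kernel s (z + of_real t * u) * u)) \<in> borel_measurable lborel"
      by simp
    have B0: "0 \<le> B t" for t using C(1) by (simp add: B_def)
    show "AE t in lborel. norm (indicat_real {0..} t *\<^sub>R (aux_kernel s (z + of_real t * u) * u)) \<le> norm (B t)"
      using bound[OF z] B0 nu by (auto simp: indicator_def norm_mult)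
  qed
  then show "set_integrable lborel {0..} (\<lambda>t. aux_kernel s (a + of_real t * u) * u)" by simp
  have "((\<lambda>t::real. exp (- (1 / 2) * (t - 0) ^ 2)) \<longlongrightarrow> 0) at_top" by real_asymp
  then have lim: "(B \<longlongrightarrow> 0) at_top"
    unfolding B_def using tendsto_mult_right_zero by blast
  show "ray_integral (aux_kernel s) a u - ray_integral (aux_kernel s) b u
           = contour_integral (linepath a b) (aux_kernel s)"
    using inS by (intro ray_integral_diff[OF S _ int int lim bound]) auto
qed

lemma norm_ge_Re_minus_Im: "\<bar>Re x - Im x\<bar> \<le> 2 * norm x"
  using abs_Re_le_cmod[of x] abs_Im_le_cmod[of x] by linarith

text \<open>The singularities are the integers and the cut along the negative reals. The strip
  \<open>S\<close> avoids them, so both half-lines slide from \<open>c\<close> to \<open>P\<close>;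
  the two connecting segments cancel, and \<open>c\<close> disappears. The lower half-plane
  \<open>H\<close> avoids them too, and there the descending half-line alone slides on to
  \<open>A\<close>.\<close>

lemma riemann_aux_decomposition:
  fixes P A :: complex
  assumes c: "0 < c" "c < 1" and P: "0 < Re P - Im P" "Re P - Im P < 1" "Im P < 0" and A: "Im A < 0"
  shows "riemann_aux c s =
           ray_integral (aux_kernel s) A (- cis (pi / 4)) + contour_integral (linepath P A) (aux_kernel s)
             - ray_integral (aux_kernel s) P (cis (pi / 4))"
proof -
  define e where "e = cis (pi / 4)"
  have Re_e: "Re e = sqrt 2 / 2" and Im_e: "Im e = sqrt 2 / 2" by (simp_all add: e_def cos_45 sin_45)
  define S where "S = {x. 0 < Re x - Im x} \<inter> {x. Re x - Im x < 1}"
  have S_half: "{x. 0 < Re x - Im x} = {x. (1 - \<i>) \<bullet> x > 0}" "{x. Re x - Im x < 1} = {x. (1 - \<i>) \<bullet> x < 1}"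
    by (auto simp: inner_complex_def)
  have S1: "convex S" "open S"
    unfolding S_def S_half
    by (intro convex_Int convex_halfspace_lt convex_halfspace_gt open_Int open_halfspace_lt open_halfspace_gt)+
  have denom_S: "sin_denom x \<noteq> 0" if "x \<in> S" for x
  proof -
    define m where "m = min (Re x - Im x) (1 - (Re x - Im x))"
    have "0 < m" "m \<le> Re x - Im x" "Re x - Im x \<le> 1 - m" using that by (auto simp: S_def m_def)
    then have "m \<le> norm (sin_denom x)" by (rule norm_sin_denom_ge_strip)
    with \<open>0 < m\<close> show ?thesis by auto
  qed
  have S2: "aux_kernel s holomorphic_on S"
    by (rule aux_kernel_holomorphic) (auto simp: S_def denom_S complex_nonpos_Reals_iff)
  define p where "p = Re P - Im P"
  define m where "m = min (min c (1 - c)) (min p (1 - p)) / 2"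
  have m: "m > 0" "m \<le> c" "m \<le> 1 - c" "m \<le> p" "m \<le> 1 - p" using c P by (auto simp: m_def p_def)
  have seg: "m \<le> Re z - Im z \<and> Re z - Im z \<le> 1 - m" if "z \<in> closed_segment (of_real c) P" for z
  proof -
    from that obtain v where v: "0 \<le> v" "v \<le> 1" "z = (1 - v) *\<^sub>R of_real c + v *\<^sub>R P"
      by (auto simp: closed_segment_def)
    have z: "Re z - Im z = (1 - v) * c + v * p" by (simp add: v p_def algebra_simps)
    have "(1 - v) * m + v * m \<le> (1 - v) * c + v * p" "(1 - v) * c + v * p \<le> (1 - v) * (1 - m) + v * (1 - m)"
      using v m by (auto intro!: add_mono mult_left_mono)
    then show ?thesis unfolding z by (simp add: algebra_simps)
  qed
  have inS: "z + of_real t * u \<in> S \<and> m / 2 \<le> norm (z + of_real t * u) \<and>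
       m / 2 \<le> norm (sin_denom (z + of_real t * u))"
    if z: "z \<in> closed_segment (of_real c) P" and "u = e \<or> u = - e" for z u and t :: real
  proof -
    define x where "x = z + of_real t * u"
    have "Re x - Im x = Re z - Im z" using that(2) Re_e Im_e by (auto simp: x_def)
    then have x: "m \<le> Re x - Im x" "Re x - Im x \<le> 1 - m" using seg[OF z] by auto
    have "m / 2 \<le> norm x" using x norm_ge_Re_minus_Im[of x] by linarith
    moreover have "m / 2 \<le> norm (sin_denom x)"
      using norm_sin_denom_ge_strip[OF m(1) x] m(1) by linarith
    ultimately show ?thesis using x m(1) by (auto simp: S_def x_def[symmetric])
  qed
  have ray1: "set_integrable lborel {0..} (\<lambda>t. aux_kernel s (of_real c + of_real t * u) * u)"
    "ray_integral (aux_kernel s) (of_real c) u - ray_integral (aux_kernel s) P u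
           = contour_integral (linepath (of_real c) P) (aux_kernel s)" if "u = e \<or> u = - e" for u
    using aux_kernel_ray[of u S s "m / 2" "of_real c" P] inS that S1 S2 m(1) unfolding e_def by auto
  define q where "q = max (Im P) (Im A)"
  have q: "q < 0" using P A by (simp add: q_def)
  define H where "H = {x. Im x < 0}"
  have H: "convex H" "open H" unfolding H_def by (rule convex_halfspace_Im_lt open_halfspace_Im_lt)+
  have H2: "aux_kernel s holomorphic_on H"
  proof (rule aux_kernel_holomorphic)
    show "sin_denom x \<noteq> 0" if "x \<in> H" for x
      using that by (intro sin_denom_nonzero) (auto simp: H_def)
  qed (auto simp: H_def complex_nonpos_Reals_iff)
  have ray2: "ray_integral (aux_kernel s) P (- e) - ray_integral (aux_kernel s) A (- e)
           = contour_integral (linepath P A) (aux_kernel s)"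
  proof (rule aux_kernel_ray(2)[OF _ H H2])
    show "- q > 0" using q by simp
    fix z t assume z: "z \<in> closed_segment P A" and t: "(0::real) \<le> t"
    have "closed_segment P A \<subseteq> {x. Im x \<le> q}"
      by (rule closed_segment_subset) (auto simp: q_def convex_halfspace_Im_le)
    then have "Im z \<le> q" using z by auto
    moreover define x where "x = z + of_real t * - e"
    moreover have "0 \<le> t * Im e" using t unfolding Im_e by simp
    ultimately have x: "Im x \<le> q" by (simp add: x_def)
    have "- q \<le> \<bar>Im x\<bar>" using x q by auto
    then have "- q \<le> norm x" using abs_Im_le_cmod[of x] by linarith
    moreover have "- q \<le> norm (sin_denom x)"
      using norm_sin_denom_ge_Im[of x] \<open>- q \<le> \<bar>Im x\<bar>\<close> pi_ge_two
      by (smt (verit, ccfv_SIG) mult_right_mono mult_cancel_right1)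
    ultimately show "z + of_real t * - e \<in> H \<and> - q \<le> norm (z + of_real t * - e)
      \<and> - q \<le> norm (sin_denom (z + of_real t * - e))"
      using x q unfolding x_def[symmetric] by (simp add: H_def)
  qed (simp add: e_def)
  have cis34: "cis (- 3 * pi / 4) = - e"
  proof -
    have "cis (- 3 * pi / 4) = cis (pi / 4 + - pi)" by (rule arg_cong[where f = cis]) simp
    also have "\<dots> = e * cis (- pi)" by (simp only: cis_mult e_def)
    finally show ?thesis by (simp add: complex_eq_iff)
  qed
  have "riemann_aux c s = (LINT t|lborel. aux_kernel s (of_real c + of_real t * - e) * - e)"
    unfolding riemann_aux_def Let_def aux_kernel_def sin_denom_def cis34 by simp
  also have "\<dots> = ray_integral (aux_kernel s) (of_real c) (- e) - ray_integral (aux_kernel s) (of_real c) e"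
  proof -
    let ?f = "\<lambda>t. aux_kernel s (of_real c + of_real t * - e) * - e"
    have i1: "set_integrable lborel {0..} ?f" using ray1(1)[of "- e"] by simp
    have i2': "integrable lborel (\<lambda>t. - (indicator {0..} t *\<^sub>R (aux_kernel s (of_real c + of_real t * e) * e)))"
      using ray1(1)[of e] unfolding set_integrable_def by simp
    \<comment> \<open>The reflection of \<open>t\<close> turns the ascending ray into the part
      \<open>t \<le> 0\<close> of the line, traversed towards \<open>c\<close>; hence its minus
      sign.\<close>
    have eq: "- (indicator {0..} (0 + (- 1) * t) *\<^sub>R (aux_kernel s (of_real c + of_real (0 + (- 1) * t) * e) * e))
               = indicator {..0} t *\<^sub>R ?f t" for t :: real
      by (auto simp: indicator_def)
    have i2: "set_integrable lborel {..0} ?f"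
      unfolding set_integrable_def eq[symmetric] by (rule lborel_integrable_real_affine[OF i2']) simp
    have "- ray_integral (aux_kernel s) (of_real c) e =
          (LINT t|lborel. - (indicator {0..} t *\<^sub>R (aux_kernel s (of_real c + of_real t * e) * e)))"
      unfolding ray_integral_def set_lebesgue_integral_def by simp
    also have "\<dots> = (LINT t:{..0}|lborel. ?f t)"
      unfolding set_lebesgue_integral_def eq[symmetric]
      by (subst lborel_integral_real_affine[where c = "- 1" and t = 0]) simp_all
    finally have r2: "(LINT t:{..0}|lborel. ?f t) = - ray_integral (aux_kernel s) (of_real c) e" by simp
    have i2'': "set_integrable lborel {..<0} ?f" by (rule set_integrable_subset[OF i2]) auto
    \<comment> \<open>The closed half-lines share the null set \<open>{0}\<close>, which is removed
      to make the union disjoint.\<close>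
    have "(LINT t:{..0}|lborel. ?f t) = (LINT t:{..<0}|lborel. ?f t)"
      unfolding set_lebesgue_integral_def
    proof (rule integral_cong_AE)
      show "(\<lambda>t. indicat_real {..0} t *\<^sub>R ?f t) \<in> borel_measurable lborel"
        "(\<lambda>t. indicat_real {..<0} t *\<^sub>R ?f t) \<in> borel_measurable lborel"
        using i2 i2'' unfolding set_integrable_def by auto
      show "AE t in lborel. indicat_real {..0} t *\<^sub>R ?f t = indicat_real {..<0} t *\<^sub>R ?f t"
        using AE_lborel_singleton[of "0::real"] by eventually_elim (auto simp: indicator_def)
    qed
    moreover have "(LINT t:({..<0} \<union> {0..})|lborel. ?f t) = (LINT t:{..<0}|lborel. ?f t) + (LINT t:{0..}|lborel. ?f t)"
      by (rule set_integral_Un[OF _ i2'' i1]) auto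
    moreover have "{..<0} \<union> {0..} = (UNIV :: real set)" by auto
    ultimately show ?thesis
      using r2 by (simp add: set_lebesgue_integral_def ray_integral_def)
  qed
  also have "\<dots> = ray_integral (aux_kernel s) P (- e) - ray_integral (aux_kernel s) P e"
    using ray1(2)[of e] ray1(2)[of "- e"] by (simp add: algebra_simps)
  also have "\<dots> = ray_integral (aux_kernel s) A (- e) + contour_integral (linepath P A) (aux_kernel s)
             - ray_integral (aux_kernel s) P e"
    using ray2 by (simp add: algebra_simps)
  finally show ?thesis by (simp add: e_def)
qed

subsection \<open>The contribution of the saddle\<close>

text \<open>The real part of the linear coefficient is removed by recentering at
  \<open>sqrt 2 / 8\<close>. After scaling to unit variance the imaginary part is a frequency
  \<open>\<tau>\<close>, so the integral is a value of the characteristic function of the standard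
  normal law.\<close>

lemma gaussian_fourier_integral:
  "(LINT r|lborel. exp (- (2 * of_real pi * of_real r ^ 2) - of_real pi * \<i> * of_real r * cis (pi / 4)))
     = exp (- (\<i> * of_real pi / 8)) / of_real (sqrt 2)"
proof -
  define F where "F r = exp (- (2 * of_real pi * of_real r ^ 2) - of_real pi * \<i> * of_real r * cis (pi / 4))" for r :: real
  define p where "p = sqrt pi"
  have p: "p > 0" "p ^ 2 = pi" by (simp_all add: p_def)
  define \<tau> where "\<tau> = - (p * sqrt 2 / 4)"
  have expo: "- (2 * of_real pi * of_real r ^ 2) - of_real pi * \<i> * of_real r * cis (pi / 4)
      = of_real (pi / 16) - \<i> * of_real pi / 8 + of_real (- (x ^ 2) / 2) + \<i> * of_real (\<tau> * x)"
    if r: "r = sqrt 2 / 8 + 1 / (2 * p) * x" for r x :: real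
  proof -
    have "- (2 * pi * r ^ 2) + pi * r * (sqrt 2 / 2) = pi / 16 - x ^ 2 / 2"
      using p(1) unfolding r p(2)[symmetric] by (simp add: field_simps power2_eq_square)
    moreover have "- (pi * r * (sqrt 2 / 2)) = - pi / 8 + \<tau> * x"
      using p(1) unfolding r p(2)[symmetric] \<tau>_def by (simp add: field_simps power2_eq_square)
    ultimately show ?thesis
      by (simp add: complex_eq_iff cos_45 sin_45 power2_eq_square)
  qed
  have std: "std_normal_density x *\<^sub>R iexp (\<tau> * x)
      = exp (of_real (- (x ^ 2) / 2)) * exp (\<i> * of_real (\<tau> * x)) / of_real (sqrt (2 * pi))" for x
    by (simp add: std_normal_density_def scaleR_conv_of_real flip: exp_of_real)
  have F_eq: "F (sqrt 2 / 8 + 1 / (2 * p) * x)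
      = (exp (of_real (pi / 16) - \<i> * of_real pi / 8) * of_real (sqrt (2 * pi)))
         * (std_normal_density x *\<^sub>R iexp (\<tau> * x))" for x
    unfolding F_def expo[OF refl] exp_add std by simp
  have "(LINT r|lborel. F r) = \<bar>1 / (2 * p)\<bar> *\<^sub>R (LINT x|lborel. F (sqrt 2 / 8 + 1 / (2 * p) * x))"
    by (rule lborel_integral_real_affine) (use p in simp)
  also have "\<dots> = of_real (1 / (2 * p)) * (exp (of_real (pi / 16) - \<i> * of_real pi / 8) * of_real (sqrt (2 * pi)))
       * (LINT x|lborel. std_normal_density x *\<^sub>R iexp (\<tau> * x))"
    unfolding F_eq using p by (simp add: scaleR_conv_of_real)
  also have "(LINT x|lborel. std_normal_density x *\<^sub>R iexp (\<tau> * x)) = char std_normal_distribution \<tau>"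
    unfolding char_def by (subst integral_density) (auto simp: normal_density_nonneg)
  also have "\<dots> = exp (of_real (- (\<tau> ^ 2) / 2))"
    unfolding char_std_normal_distribution by (simp flip: exp_of_real)
  \<comment> \<open>This cancels the \<open>pi / 16\<close> left over from the recentering, so that
    only a phase survives.\<close>
  also have "- (\<tau> ^ 2) / 2 = - (pi / 16)"
    by (simp add: \<tau>_def power_divide power_mult_distrib p)
  also have "of_real (1 / (2 * p)) * (exp (of_real (pi / 16) - \<i> * of_real pi / 8) * of_real (sqrt (2 * pi)))
       * exp (of_real (- (pi / 16)))
      = of_real (sqrt (2 * pi) / (2 * p)) * exp (- (\<i> * of_real pi / 8))"
  proof -
    have "exp (of_real (pi / 16) - \<i> * of_real pi / 8) * exp (of_real (- (pi / 16))) = exp (- (\<i> * of_real pi / 8))"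
      by (simp add: exp_add[symmetric])
    then show ?thesis by (simp add: mult_ac)
  qed
  also have "sqrt (2 * pi) / (2 * p) = 1 / sqrt 2"
    using p(1) by (simp add: p_def real_sqrt_mult field_simps)
  finally show ?thesis by (simp add: F_def)
qed

section \<open>The phase on the line of slope 1 through the saddle\<close>

text \<open>Mean value inequality on a half-plane, where the derivative of \<open>exp\<close> has
  modulus at most \<open>exp m\<close>.\<close>

lemma norm_exp_diff_le:
  fixes a b :: complex
  assumes "Re a \<le> m" "Re b \<le> m"
  shows "norm (exp a - exp b) \<le> exp m * norm (a - b)"
proof (rule field_differentiable_bound)
  show "convex {z. Re z \<le> m}" by (rule convex_halfspace_Re_le)
  show "(exp has_field_derivative exp z) (at z within {z. Re z \<le> m})" for z :: complex
    by (auto intro!: derivative_eq_intros)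
qed (use assms in auto)

text \<open>Its critical point is \<open>\<xi>\<close>, where it vanishes, because \<open>s = 2 \<pi> i \<xi>\<^sup>2\<close>.\<close>
definition saddle_phase :: "complex \<Rightarrow> complex \<Rightarrow> complex" where
  "saddle_phase \<xi> x = - (2 * of_real pi * \<i> * \<xi> ^ 2) * (Ln x - Ln \<xi>) + of_real pi * \<i> * (x ^ 2 - \<xi> ^ 2)"

lemma aux_kernel_eq_saddle_phase:
  assumes "x \<noteq> 0" "\<xi> \<noteq> 0" "s = 2 * of_real pi * \<i> * \<xi> ^ 2"
  shows "aux_kernel s x = \<xi> powr (- s) * exp (of_real pi * \<i> * \<xi> ^ 2) * exp (saddle_phase \<xi> x) / sin_denom x"
proof -
  have "x powr (- s) * exp (of_real pi * \<i> * x ^ 2)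
      = \<xi> powr (- s) * exp (of_real pi * \<i> * \<xi> ^ 2) * exp (saddle_phase \<xi> x)"
    using assms(1,2) unfolding powr_def saddle_phase_def assms(3)
    by (simp add: exp_add[symmetric] algebra_simps)
  then show ?thesis by (simp add: aux_kernel_def)
qed

lemma saddle_phase_derivative:
  assumes "x \<notin> \<real>\<^sub>\<le>\<^sub>0"
  shows "(saddle_phase \<xi> has_field_derivative 2 * of_real pi * \<i> * (x - \<xi>) * (1 + \<xi> / x)) (at x within S)"
proof -
  have "x \<noteq> 0" using assms by auto
  then show ?thesis using assms unfolding saddle_phase_def[abs_def]
    by (auto intro!: derivative_eq_intros simp: field_simps power2_eq_square)
qed

lemma cis_45_square: "cis (pi / 4) ^ 2 = \<i>"
  by (simp add: power2_eq_square cis_mult)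

lemma cis_45: "cis (pi / 4) = Complex (sqrt 2 / 2) (sqrt 2 / 2)"
  by (simp add: complex_eq_iff cos_45 sin_45)

text \<open>At \<open>\<xi> + \<tau> * r * cis (pi / 4)\<close> the phase has
  \<open>\<tau>\<close>-derivative \<open>- 2 * pi * \<tau> * r ^ 2 * (1 + \<xi> / x)\<close>. The
  bound therefore follows once \<open>Re (\<xi> / x) \<ge> 0\<close>, that is, as long as
  \<open>\<xi>\<close> and \<open>x\<close> are seen from 0 under at most a right angle. This gives
  half of the decay rate at the saddle, but it is valid far out on the line.\<close>

lemma Re_saddle_phase_le:
  assumes "Im \<xi> < 0" "Im (\<xi> + of_real r * cis (pi / 4)) < 0"
    and r: "- (sqrt 2) * norm \<xi> ^ 2 \<le> r * (Re \<xi> + Im \<xi>)"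
  shows "Re (saddle_phase \<xi> (\<xi> + of_real r * cis (pi / 4))) \<le> - (pi * r ^ 2)"
proof -
  define x where "x \<tau> = \<xi> + of_real (\<tau> * r) * cis (pi / 4)" for \<tau> :: real
  define \<psi> where "\<psi> \<tau> = Re (saddle_phase \<xi> (x \<tau>)) + pi * (\<tau> * r) ^ 2" for \<tau>
  have "\<psi> 1 \<le> \<psi> 0"
  proof (rule DERIV_nonpos_imp_nonincreasing[of 0 1 \<psi>])
    fix \<tau> :: real assume \<tau>: "0 \<le> \<tau>" "\<tau> \<le> 1"
    have "Im (x \<tau>) = (1 - \<tau>) * Im \<xi> + \<tau> * Im (\<xi> + of_real r * cis (pi / 4))"
      by (simp add: x_def algebra_simps)
    also have "\<dots> < 0"
    proof (cases "\<tau> = 0")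
      case False
      then have "\<tau> * Im (\<xi> + of_real r * cis (pi / 4)) < 0"
        using \<tau> assms(2) by (intro mult_pos_neg) auto
      moreover have "(1 - \<tau>) * Im \<xi> \<le> 0" using \<tau> assms(1) by (intro mult_nonneg_nonpos) auto
      ultimately show ?thesis by linarith
    qed (use assms in auto)
    finally have im: "Im (x \<tau>) < 0" .
    then have x0: "x \<tau> \<noteq> 0" "x \<tau> \<notin> \<real>\<^sub>\<le>\<^sub>0" by (auto simp: complex_nonpos_Reals_iff)
    have \<xi>0: "\<xi> \<noteq> 0" using assms(1) by auto
    define D where "D = 2 * of_real pi * \<i> * (x \<tau> - \<xi>) * (1 + \<xi> / x \<tau>)"
    have dx: "(x has_vector_derivative of_real r * cis (pi / 4)) (at \<tau>)"
      unfolding x_def by (auto intro!: derivative_eq_intros)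
    have "((saddle_phase \<xi> \<circ> x) has_vector_derivative of_real r * cis (pi / 4) * D) (at \<tau>)"
      by (rule field_vector_diff_chain_at[OF dx])
         (use saddle_phase_derivative[OF x0(2)] in \<open>simp add: D_def\<close>)
    also have "of_real r * cis (pi / 4) * D = - of_real (2 * pi * \<tau> * r ^ 2) * (1 + \<xi> / x \<tau>)"
    proof -
      have "of_real r * cis (pi / 4) * D
          = 2 * of_real pi * \<i> * of_real \<tau> * of_real r ^ 2 * (cis (pi / 4) ^ 2) * (1 + \<xi> / x \<tau>)"
        by (simp add: D_def x_def power2_eq_square mult_ac)
      also have "\<dots> = - of_real (2 * pi * \<tau> * r ^ 2) * (1 + \<xi> / x \<tau>)"
        unfolding cis_45_square by (simp add: mult_ac)
      finally show ?thesis .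
    qed
    finally have dE: "((\<lambda>\<tau>. saddle_phase \<xi> (x \<tau>)) has_vector_derivative
        - of_real (2 * pi * \<tau> * r ^ 2) * (1 + \<xi> / x \<tau>)) (at \<tau>)" by (simp add: o_def)
    have "((\<lambda>\<tau>. Re (saddle_phase \<xi> (x \<tau>))) has_real_derivative
        Re (- of_real (2 * pi * \<tau> * r ^ 2) * (1 + \<xi> / x \<tau>))) (at \<tau>)"
      using bounded_linear.has_vector_derivative[OF bounded_linear_Re dE]
      by (simp add: has_real_derivative_iff_has_vector_derivative)
    moreover have "((\<lambda>\<tau>. pi * (\<tau> * r) ^ 2) has_real_derivative 2 * pi * \<tau> * r ^ 2) (at \<tau>)"
      by (auto intro!: derivative_eq_intros simp: power2_eq_square)
    ultimately have "(\<psi> has_real_derivative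
        Re (- of_real (2 * pi * \<tau> * r ^ 2) * (1 + \<xi> / x \<tau>)) + 2 * pi * \<tau> * r ^ 2) (at \<tau>)"
      unfolding \<psi>_def by (rule DERIV_add)
    moreover have "Re (- of_real a * (1 + w)) + a = - a * Re w" for a w
      by (simp add: algebra_simps)
    \<comment> \<open>\<open>Re (\<xi> * cnj (x \<tau>))\<close> is affine in \<open>\<tau>\<close>
      and positive at 0, so the condition \<open>r\<close> at the far end controls it
      throughout.\<close>
    moreover have "0 \<le> Re (\<xi> / x \<tau>)"
    proof -
      have "Re (\<xi> / x \<tau>) = Re (\<xi> * cnj (x \<tau>)) / norm (x \<tau>) ^ 2"
        by (subst complex_div_cnj) (simp add: Re_divide_of_real del: complex_cnj_mult)
      moreover have "Re (\<xi> * cnj (x \<tau>)) = norm \<xi> ^ 2 + \<tau> * (r * (Re \<xi> + Im \<xi>)) * (sqrt 2 / 2)"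
        unfolding cmod_power2 by (simp add: x_def cis_45 power2_eq_square algebra_simps)
      moreover have "- (norm \<xi> ^ 2) \<le> \<tau> * (r * (Re \<xi> + Im \<xi>)) * (sqrt 2 / 2)"
      proof -
        have "\<tau> * (- (sqrt 2) * norm \<xi> ^ 2) \<le> \<tau> * (r * (Re \<xi> + Im \<xi>))"
          using r \<tau> by (intro mult_left_mono) auto
        then have "\<tau> * (- (sqrt 2) * norm \<xi> ^ 2) * (sqrt 2 / 2) \<le> \<tau> * (r * (Re \<xi> + Im \<xi>)) * (sqrt 2 / 2)"
          by (intro mult_right_mono) auto
        moreover have "\<tau> * (- (sqrt 2) * norm \<xi> ^ 2) * (sqrt 2 / 2) = - \<tau> * norm \<xi> ^ 2" by simp
        moreover have "\<tau> * norm \<xi> ^ 2 \<le> 1 * norm \<xi> ^ 2" using \<tau> by (intro mult_right_mono) auto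
        ultimately show ?thesis by linarith
      qed
      ultimately show ?thesis by simp
    qed
    moreover note \<tau>
    ultimately show "\<exists>y. (\<psi> has_real_derivative y) (at \<tau>) \<and> y \<le> 0"
      by (intro exI[of _ "- (2 * pi * \<tau> * r ^ 2) * Re (\<xi> / x \<tau>)"]) (metis mult_nonneg_nonneg mult_nonpos_nonneg neg_le_0_iff_le pi_ge_zero zero_le_numeral zero_le_power2)
  qed simp
  then show ?thesis by (simp add: \<psi>_def x_def saddle_phase_def)
qed

text \<open>Subtracting the quadratic model leaves a function with derivative
  \<open>- 2 * pi * \<i> * (y - \<xi>) ^ 2 / y\<close>, and the constancy of
  \<open>Re y - Im y\<close> on the line gives \<open>norm y \<ge> k / 2\<close>. With
  \<open>k\<close> of order \<open>norm \<xi>\<close> this is the source of the relative error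
  \<open>1 / norm \<xi>\<close>.\<close>

lemma saddle_phase_approx:
  assumes "Im \<xi> < 0" "Im (\<xi> + of_real r * cis (pi / 4)) < 0" "0 < k" "k \<le> Re \<xi> - Im \<xi>"
  shows "norm (saddle_phase \<xi> (\<xi> + of_real r * cis (pi / 4)) + of_real (2 * pi * r ^ 2)) \<le> 4 * pi * \<bar>r\<bar> ^ 3 / k"
proof -
  define e where "e = cis (pi / 4)"
  define x where "x = \<xi> + of_real r * e"
  define h where "h y = saddle_phase \<xi> y - 2 * of_real pi * \<i> * (y - \<xi>) ^ 2" for y
  have e2: "e ^ 2 = \<i>" by (simp add: e_def cis_45_square)
  have "norm (h x - h \<xi>) \<le> (4 * pi * r ^ 2 / k) * norm (x - \<xi>)"
  proof (rule field_differentiable_bound)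
    show "convex (closed_segment \<xi> x)" by (rule convex_closed_segment)
    fix y assume "y \<in> closed_segment \<xi> x"
    then obtain v where v: "0 \<le> v" "v \<le> 1" "y = (1 - v) *\<^sub>R \<xi> + v *\<^sub>R x"
      by (auto simp: closed_segment_def)
    have y: "y - \<xi> = of_real (v * r) * e" by (simp add: v x_def scaleR_conv_of_real algebra_simps)
    have "closed_segment \<xi> x \<subseteq> {z. Im z < 0}"
      by (rule closed_segment_subset) (use assms in \<open>auto simp: x_def e_def convex_halfspace_Im_lt\<close>)
    then have "Im y < 0" using \<open>y \<in> _\<close> by auto
    then have y0: "y \<noteq> 0" "y \<notin> \<real>\<^sub>\<le>\<^sub>0" by (auto simp: complex_nonpos_Reals_iff)
    show "(h has_field_derivative - (2 * of_real pi * \<i> * (y - \<xi>) ^ 2 / y)) (at y within closed_segment \<xi> x)"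
      unfolding h_def using y0
      by (auto intro!: derivative_eq_intros saddle_phase_derivative simp: field_simps power2_eq_square)
    have "Re y - Im y = Re \<xi> - Im \<xi>"
      using y by (simp add: complex_eq_iff e_def cos_45 sin_45 algebra_simps)
    then have ny: "k / 2 \<le> norm y" using assms norm_ge_Re_minus_Im[of y] by linarith
    have "norm (- (2 * of_real pi * \<i> * (y - \<xi>) ^ 2 / y)) = 2 * pi * (v * r) ^ 2 / norm y"
      by (simp add: y norm_mult norm_divide norm_power e_def power_mult_distrib)
    also have "\<dots> \<le> 2 * pi * r ^ 2 / (k / 2)"
    proof (rule frac_le)
      have "v ^ 2 * r ^ 2 \<le> 1 * r ^ 2" using v by (intro mult_right_mono) (auto simp: power_le_one)
      then show "2 * pi * (v * r) ^ 2 \<le> 2 * pi * r ^ 2" by (simp add: power_mult_distrib)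
    qed (use ny assms in auto)
    finally show "norm (- (2 * of_real pi * \<i> * (y - \<xi>) ^ 2 / y)) \<le> 4 * pi * r ^ 2 / k"
      by simp
  qed auto
  moreover have "norm (x - \<xi>) = \<bar>r\<bar>" by (simp add: x_def e_def norm_mult)
  moreover have "h x - h \<xi> = saddle_phase \<xi> x + of_real (2 * pi * r ^ 2)"
    by (simp add: h_def x_def power_mult_distrib e2 saddle_phase_def mult_ac)
  moreover have "r ^ 2 * \<bar>r\<bar> = \<bar>r\<bar> ^ 3" by (simp add: power3_eq_cube power2_eq_square abs_mult)
  ultimately show ?thesis by (simp add: x_def e_def mult.assoc)
qed

lemma abs_power3_le_exp: "\<bar>r::real\<bar> ^ 3 \<le> 27 * exp \<bar>r\<bar>"
proof -
  have "(\<bar>r\<bar> / 3) ^ 3 \<le> (1 + \<bar>r\<bar> / 3) ^ 3" by (intro power_mono) auto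
  also have "\<dots> \<le> exp \<bar>r\<bar>" using exp_ge_one_plus_x_over_n_power_n[of 3 "\<bar>r\<bar>"] by simp
  finally show ?thesis by (simp add: power_divide)
qed

text \<open>As \<open>pi > 3\<close>, a surplus of \<open>2 * r ^ 2\<close> absorbs the linear term.
  The rate 8 is the sum of the rates 3 and 5 that arise in
  \<open>saddle_integrand_bound\<close>.\<close>

lemma exp_linear_minus_square_le:
  "exp (8 * \<bar>r\<bar> - pi * r ^ 2) \<le> exp 8 * exp (- ((r::real) ^ 2))"
proof -
  have "0 \<le> (\<bar>r\<bar> - 2) ^ 2" "\<bar>r\<bar> ^ 2 = r ^ 2" by simp_all
  then have "8 * \<bar>r\<bar> - 3 * r ^ 2 \<le> 8 + - (r ^ 2)" by (simp add: power2_diff)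
  moreover have "3 * r ^ 2 \<le> pi * r ^ 2" using pi_gt3 by (intro mult_right_mono) auto
  ultimately show ?thesis by (simp add: exp_add[symmetric])
qed

text \<open>The constant is \<open>- cis (pi / 4)\<close>, the descending direction of the contour,
  times the value in \<open>gaussian_fourier_integral\<close>.\<close>

definition main_term :: "complex \<Rightarrow> complex \<Rightarrow> complex" where
  "main_term s \<xi> = - (exp (of_real pi * \<i> / 8) / of_real (sqrt 2))
     * (\<xi> powr (- s) * exp (of_real pi * \<i> * \<xi> ^ 2 - of_real pi * \<i> * \<xi>))"

text \<open>Two errors add up: the quadratic approximation of the phase, and the omission of
  \<open>y = exp (- 2 * pi * \<i> * x)\<close> from the denominator. Near \<open>\<xi>\<close> the
  latter is exponentially small. Near the real axis \<open>1 / (1 - y)\<close> may be of order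
  \<open>norm \<xi> ^ 2\<close>, but \<open>\<bar>r\<bar>\<close> is then of order
  \<open>norm \<xi>\<close> and the Gaussian outweighs it.\<close>

lemma saddle_integrand_bound:
  assumes pos: "0 < d" "0 < \<eta>" and N: "1 \<le> norm \<xi>" and im: "Im \<xi> \<le> - norm \<xi> / 2"
    and X: "d * norm \<xi> \<le> Re \<xi> - Im \<xi>"
    and r: "- (sqrt 2) * norm \<xi> ^ 2 \<le> r * (Re \<xi> + Im \<xi>)"
    and x: "x = \<xi> + of_real r * cis (pi / 4)" "Im x \<le> - \<eta> / norm \<xi> ^ 2"
  shows "norm (exp (saddle_phase \<xi> x - of_real pi * \<i> * of_real r * cis (pi / 4)) / (1 - exp (- (2 * of_real pi * \<i> * x)))
            - exp (- (2 * of_real pi * of_real r ^ 2) - of_real pi * \<i> * of_real r * cis (pi / 4)))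
          \<le> (27 * (1 + 1 / \<eta>) + 108 * pi / d) * exp 8 / norm \<xi> * exp (- (r ^ 2))"
proof -
  define N where "N = norm \<xi>"
  define E where "E = saddle_phase \<xi> x"
  define y where "y = exp (- (2 * of_real pi * \<i> * x))"
  define l where "l = of_real pi * \<i> * of_real r * cis (pi / 4)"
  define b where "b = - (2 * of_real pi * of_real r ^ 2 :: complex)"
  have N1: "1 \<le> N" using N by (simp add: N_def)
  have im\<xi>: "Im \<xi> < 0" using im N by simp
  have "0 < \<eta> / N ^ 2" using pos N1 by simp
  then have imx: "Im x < 0" using x(2) by (simp add: N_def)
  have ReE: "Re E \<le> - (pi * r ^ 2)"
    unfolding E_def x(1) by (rule Re_saddle_phase_le[OF im\<xi> _ r]) (use imx x(1) in simp)
  have nl: "norm (exp (- l)) = exp (pi * r * (sqrt 2 / 2))"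
    by (simp add: l_def sin_45)
  have nl': "norm (exp (- l)) \<le> exp (3 * \<bar>r\<bar>)"
  proof -
    have "pi * r * (sqrt 2 / 2) \<le> pi * \<bar>r\<bar> * (sqrt 2 / 2)" by (intro mult_left_mono mult_right_mono) auto
    also have "\<dots> = (pi * (sqrt 2 / 2)) * \<bar>r\<bar>" by simp
    also have "\<dots> \<le> 3 * \<bar>r\<bar>"
    proof (rule mult_right_mono)
      have "sqrt 2 \<le> 3 / 2" by (rule real_le_lsqrt) (simp_all add: power2_eq_square)
      then have "pi * (sqrt 2 / 2) \<le> 4 * (3 / 4)" using pi_less_4 by (intro mult_mono) auto
      then show "pi * (sqrt 2 / 2) \<le> 3" by simp
    qed auto
    finally show ?thesis unfolding nl by simp
  qed
  define v where "v = - (2 * pi * Im x)"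
  have ny: "norm y = exp (- v)" by (simp add: y_def v_def)
  have v0: "v > 0" using imx by (simp add: v_def mult_pos_neg)
  have y1: "norm y < 1" using v0 by (simp add: ny)
  then have y_ne: "1 - y \<noteq> 0" by auto
  have yy: "norm (y / (1 - y)) \<le> 27 * (1 + 1 / \<eta>) / N * exp (5 * \<bar>r\<bar>)"
  proof -
    have "exp (- v) \<le> 1 / (1 + v)"
      using exp_ge_add_one_self[of v] v0 by (simp add: exp_minus field_simps)
    then have "v / (1 + v) \<le> 1 - exp (- v)" using v0 by (simp add: field_simps)
    also have "\<dots> \<le> norm (1 - y)" using norm_triangle_ineq2[of 1 y] by (simp add: ny)
    finally have "norm (y / (1 - y)) \<le> exp (- v) / (v / (1 + v))"
      unfolding norm_divide ny using v0 y_ne by (intro divide_left_mono mult_pos_pos) auto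
    also have "\<dots> = exp (- v) * (1 + 1 / v)" using v0 by (simp add: field_simps)
    also have "\<dots> \<le> exp (- v) * ((1 + 1 / \<eta>) * N ^ 2)"
    proof (rule mult_left_mono)
      have "\<eta> / N ^ 2 \<le> - Im x" using x(2) by (simp add: N_def)
      also have "1 * (- Im x) \<le> (2 * pi) * (- Im x)" using imx pi_ge_two by (intro mult_right_mono) auto
      finally have "\<eta> / N ^ 2 \<le> v" by (simp add: v_def)
      then have "1 / v \<le> 1 / (\<eta> / N ^ 2)" using pos N1 by (intro divide_left_mono) (auto intro!: divide_pos_pos mult_pos_pos simp: v0)
      moreover have "1 \<le> N ^ 2" using N1 by simp
      ultimately show "1 + 1 / v \<le> (1 + 1 / \<eta>) * N ^ 2" by (simp add: algebra_simps)
    qed auto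
    also have "\<dots> = (1 + 1 / \<eta>) * (exp (- v) * N ^ 2)" by simp
    \<comment> \<open>The inequality \<open>- v \<le> - N + 5 * \<bar>r\<bar>\<close> treats both
      regimes at once: \<open>exp (- N)\<close> beats \<open>N ^ 3\<close>, and the price
      \<open>exp (5 * \<bar>r\<bar>)\<close> is left to the Gaussian.\<close>
    also have "exp (- v) * N ^ 2 \<le> 27 / N * exp (5 * \<bar>r\<bar>)"
    proof -
      have "- v = 2 * pi * Im \<xi> + pi * sqrt 2 * r" by (simp add: v_def x(1) sin_45 algebra_simps)
      also have "\<dots> \<le> - N + 5 * \<bar>r\<bar>"
      proof (rule add_mono)
        have "2 * pi * Im \<xi> \<le> 2 * pi * (- N / 2)" using im by (intro mult_left_mono) (auto simp: N_def)
        also have "\<dots> \<le> - N" using N1 pi_ge_two by simp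
        finally show "2 * pi * Im \<xi> \<le> - N" .
        have "pi * sqrt 2 * r \<le> pi * sqrt 2 * \<bar>r\<bar>" by (intro mult_left_mono) auto
        also have "\<dots> \<le> 5 * \<bar>r\<bar>"
        proof (rule mult_right_mono)
          have "sqrt 2 \<le> 3 / 2" by (rule real_le_lsqrt) (simp_all add: power2_eq_square)
          then have "pi * sqrt 2 \<le> (10 / 3) * (3 / 2)"
            using pi_approx by (intro mult_mono) auto
          then show "pi * sqrt 2 \<le> 5" by simp
        qed auto
        finally show "pi * sqrt 2 * r \<le> 5 * \<bar>r\<bar>" .
      qed
      finally have "exp (- v) \<le> exp (- N) * exp (5 * \<bar>r\<bar>)" by (simp add: exp_add[symmetric])
      then have "exp (- v) * N ^ 2 \<le> exp (- N) * exp (5 * \<bar>r\<bar>) * N ^ 2" by (rule mult_right_mono) auto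
      also have "\<dots> = (N ^ 3 / exp N) / N * exp (5 * \<bar>r\<bar>)"
        using N1 by (simp add: exp_minus field_simps power3_eq_cube power2_eq_square)
      also have "\<dots> \<le> 27 / N * exp (5 * \<bar>r\<bar>)"
        using abs_power3_le_exp[of N] N1 by (intro mult_right_mono divide_right_mono) (auto simp: field_simps)
      finally show ?thesis .
    qed
    finally have "norm (y / (1 - y)) \<le> (1 + 1 / \<eta>) * (27 / N * exp (5 * \<bar>r\<bar>))"
      using pos by (simp add: mult_left_mono)
    also have "\<dots> = 27 * (1 + 1 / \<eta>) / N * exp (5 * \<bar>r\<bar>)" by simp
    finally show ?thesis .
  qed
  have Eb: "norm (exp E - exp b) \<le> 108 * pi / d / N * exp \<bar>r\<bar> * exp (- (pi * r ^ 2))"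
  proof -
    have "norm (exp E - exp b) \<le> exp (- (pi * r ^ 2)) * norm (E - b)"
      by (rule norm_exp_diff_le[OF ReE]) (simp add: b_def)
    also have "norm (E - b) = norm (saddle_phase \<xi> (\<xi> + of_real r * cis (pi / 4)) + of_real (2 * pi * r ^ 2))"
      by (simp add: E_def b_def x)
    also have "\<dots> \<le> 4 * pi * \<bar>r\<bar> ^ 3 / (d * N)"
    proof (rule saddle_phase_approx[OF im\<xi>])
      show "0 < d * N" using pos N1 by (intro mult_pos_pos) auto
    qed (use imx x(1) X in \<open>auto simp: N_def\<close>)
    also have "\<dots> \<le> 4 * pi * (27 * exp \<bar>r\<bar>) / (d * N)"
      using pos N1 abs_power3_le_exp[of r] by (intro divide_right_mono mult_left_mono) auto
    finally show ?thesis by (simp add: field_simps)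
  qed
  have nE: "norm (exp E) \<le> exp (- (pi * r ^ 2))" using ReE by simp
  \<comment> \<open>From \<open>1 / (1 - y) = 1 + y / (1 - y)\<close>, which separates the two
    errors.\<close>
  have "exp (E - l) / (1 - y) - exp (b - l) = exp (- l) * (exp E * (y / (1 - y)) + (exp E - exp b))"
    using y_ne by (simp add: exp_diff exp_minus field_simps)
  then have "norm (exp (E - l) / (1 - y) - exp (b - l))
      = norm (exp (- l)) * norm (exp E * (y / (1 - y)) + (exp E - exp b))"
    by (simp add: norm_mult)
  also have "\<dots> \<le> exp (3 * \<bar>r\<bar>) * (exp (- (pi * r ^ 2)) * (27 * (1 + 1 / \<eta>) / N * exp (5 * \<bar>r\<bar>))
       + 108 * pi / d / N * exp \<bar>r\<bar> * exp (- (pi * r ^ 2)))"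
  proof (rule mult_mono[OF nl'])
    show "norm (exp E * (y / (1 - y)) + (exp E - exp b)) \<le>
       exp (- (pi * r ^ 2)) * (27 * (1 + 1 / \<eta>) / N * exp (5 * \<bar>r\<bar>))
       + 108 * pi / d / N * exp \<bar>r\<bar> * exp (- (pi * r ^ 2))"
    proof (intro norm_triangle_le add_mono Eb)
      show "norm (exp E * (y / (1 - y))) \<le> exp (- (pi * r ^ 2)) * (27 * (1 + 1 / \<eta>) / N * exp (5 * \<bar>r\<bar>))"
        unfolding norm_mult by (rule mult_mono[OF nE yy]) auto
    qed
  qed auto
  also have "\<dots> \<le> exp (3 * \<bar>r\<bar>) * (exp (- (pi * r ^ 2)) * (27 * (1 + 1 / \<eta>) / N * exp (5 * \<bar>r\<bar>))
       + 108 * pi / d / N * exp (5 * \<bar>r\<bar>) * exp (- (pi * r ^ 2)))"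
    using pos N1 by (intro mult_left_mono add_left_mono mult_right_mono) auto
  also have "\<dots> = (27 * (1 + 1 / \<eta>) + 108 * pi / d) / N * (exp (3 * \<bar>r\<bar>) * exp (5 * \<bar>r\<bar>) * exp (- (pi * r ^ 2)))"
    by (simp add: algebra_simps add_divide_distrib)
  also have "exp (3 * \<bar>r\<bar>) * exp (5 * \<bar>r\<bar>) * exp (- (pi * r ^ 2)) = exp (8 * \<bar>r\<bar> - pi * r ^ 2)"
    by (simp add: exp_add[symmetric])
  also have "(27 * (1 + 1 / \<eta>) + 108 * pi / d) / N * exp (8 * \<bar>r\<bar> - pi * r ^ 2)
      \<le> (27 * (1 + 1 / \<eta>) + 108 * pi / d) / N * (exp 8 * exp (- (r ^ 2)))"
    using pos N1 by (intro mult_left_mono exp_linear_minus_square_le) auto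
  finally show ?thesis by (simp add: E_def y_def l_def b_def N_def)
qed

lemma norm_gaussian_fourier_integrand_le:
  "norm (exp (- (2 * of_real pi * of_real r ^ 2) - of_real pi * \<i> * of_real r * cis (pi / 4)))
     \<le> exp (7 * \<bar>r\<bar> - pi * r ^ 2)"
proof -
  define Q where "Q = pi * r ^ 2"
  have Q: "0 \<le> Q" by (simp add: Q_def)
  have "sqrt 2 \<le> 3 / 2" by (rule real_le_lsqrt) (simp_all add: power2_eq_square)
  then have "pi * (sqrt 2 / 2) \<le> 4 * (3 / 4)" using pi_less_4 by (intro mult_mono) auto
  then have "pi * (sqrt 2 / 2) * \<bar>r\<bar> \<le> 7 * \<bar>r\<bar>" by (intro mult_right_mono) auto
  moreover have "pi * (sqrt 2 / 2) * r \<le> pi * (sqrt 2 / 2) * \<bar>r\<bar>" by (intro mult_left_mono) auto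
  ultimately have "- 2 * Q + pi * (sqrt 2 / 2) * r \<le> 7 * \<bar>r\<bar> - Q" using Q by linarith
  moreover have "Re (- (2 * of_real pi * of_real r ^ 2) - of_real pi * \<i> * of_real r * cis (pi / 4))
      = - 2 * Q + pi * (sqrt 2 / 2) * r"
    by (simp add: cis_45 power2_eq_square Q_def)
  ultimately show ?thesis unfolding norm_exp_eq_Re Q_def by (simp only: exp_le_cancel_iff)
qed

text \<open>Accounts for the part of the model integral beyond the end of the contour. The factor
  \<open>1 / N\<close> is bought with one spare \<open>exp r\<close>.\<close>

lemma gaussian_tail_bound:
  assumes "1 \<le> N" "N / 2 \<le> r"
  shows "norm (exp (- (2 * of_real pi * of_real r ^ 2) - of_real pi * \<i> * of_real r * cis (pi / 4)))
           \<le> 2 * exp 8 / N * exp (- (r ^ 2))"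
proof -
  have r0: "0 \<le> r" using assms by simp
  have "norm (exp (- (2 * of_real pi * of_real r ^ 2) - of_real pi * \<i> * of_real r * cis (pi / 4)))
      \<le> exp (7 * r - pi * r ^ 2)"
    using norm_gaussian_fourier_integrand_le[of r] r0 by simp
  also have "1 * exp (7 * r - pi * r ^ 2) \<le> (2 / N * exp r) * exp (7 * r - pi * r ^ 2)"
  proof (rule mult_right_mono)
    have "N / 2 \<le> exp r" using assms exp_ge_add_one_self[of r] by linarith
    then show "1 \<le> 2 / N * exp r" using assms by (simp add: field_simps)
  qed auto
  also have "\<dots> = 2 / N * exp (8 * \<bar>r\<bar> - pi * r ^ 2)" using r0 by (simp add: exp_add[symmetric])
  also have "\<dots> \<le> 2 / N * (exp 8 * exp (- (r ^ 2)))"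
    using assms by (intro mult_left_mono exp_linear_minus_square_le) auto
  finally show ?thesis by simp
qed

text \<open>Divided by its size at the saddle and extended by 0 beyond \<open>\<rho>\<close>, the
  integrand differs from the model by at most \<open>K / norm \<xi> * exp (- (r ^ 2))\<close>
  pointwise, and this is integrated. The two conditions at the end point \<open>\<rho>\<close> pass
  to all \<open>r \<le> \<rho>\<close>, because \<open>Re \<xi> + Im \<xi> \<le> 0\<close> and the
  imaginary part increases with \<open>r\<close>.\<close>

lemma saddle_ray_asymptotics:
  assumes pos: "0 < d" "0 < \<eta>"
  shows "\<exists>C\<ge>0. \<forall>\<xi> s \<rho>. 1 \<le> norm \<xi> \<longrightarrow> s = 2 * of_real pi * \<i> * \<xi> ^ 2 \<longrightarrow>
    Im \<xi> \<le> - norm \<xi> / 2 \<longrightarrow> Re \<xi> + Im \<xi> \<le> 0 \<longrightarrow> d * norm \<xi> \<le> Re \<xi> - Im \<xi> \<longrightarrow>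
    norm \<xi> / 2 \<le> \<rho> \<longrightarrow> - (sqrt 2) * norm \<xi> ^ 2 \<le> \<rho> * (Re \<xi> + Im \<xi>) \<longrightarrow>
    Im (\<xi> + of_real \<rho> * cis (pi / 4)) \<le> - \<eta> / norm \<xi> ^ 2 \<longrightarrow>
    norm (ray_integral (aux_kernel s) (\<xi> + of_real \<rho> * cis (pi / 4)) (- cis (pi / 4)) - main_term s \<xi>)
      \<le> C / norm \<xi> * norm (main_term s \<xi>)"
proof -
  define K where "K = ((27 * (1 + 1 / \<eta>) + 108 * pi / d) + 2) * exp 8"
  have K0: "0 \<le> K" using pos by (simp add: K_def)
  define I where "I = (LINT r|lborel. exp (- ((r::real) ^ 2)))"
  have int_e: "integrable lborel (\<lambda>r::real. exp (- (r ^ 2)))"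
    using integrable_shifted_gaussian[of 1 0] by simp
  have I0: "0 \<le> I" unfolding I_def by (rule integral_nonneg_AE) auto
  define e where "e = cis (pi / 4)"
  define g0 where "g0 r = exp (- (2 * of_real pi * of_real r ^ 2) - of_real pi * \<i> * of_real r * e)" for r :: real
  have int_g0: "integrable lborel g0"
  proof (rule Bochner_Integration.integrable_bound)
    show "integrable lborel (\<lambda>r::real. exp 8 * exp (- (r ^ 2)))" using int_e by simp
    show "g0 \<in> borel_measurable lborel"
    proof -
      have "continuous_on UNIV g0" unfolding g0_def by (intro continuous_intros)
      then show ?thesis by (simp add: borel_measurable_continuous_onI)
    qed
    show "AE r in lborel. norm (g0 r) \<le> norm (exp 8 * exp (- (r ^ 2)))"
    proof (rule AE_I2)
      fix r :: real
      have "norm (g0 r) \<le> exp (7 * \<bar>r\<bar> - pi * r ^ 2)"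
        unfolding g0_def e_def by (rule norm_gaussian_fourier_integrand_le)
      also have "\<dots> \<le> exp (8 * \<bar>r\<bar> - pi * r ^ 2)" by simp
      also have "\<dots> \<le> exp 8 * exp (- (r ^ 2))" by (rule exp_linear_minus_square_le)
      finally show "norm (g0 r) \<le> norm (exp 8 * exp (- (r ^ 2)))" by simp
    qed
  qed
  have "norm (ray_integral (aux_kernel s) (\<xi> + of_real \<rho> * e) (- e) - main_term s \<xi>)
      \<le> (2 * K * I) / norm \<xi> * norm (main_term s \<xi>)"
    if N: "1 \<le> norm \<xi>" and s: "s = 2 * of_real pi * \<i> * \<xi> ^ 2" and im: "Im \<xi> \<le> - norm \<xi> / 2"
      and ReIm: "Re \<xi> + Im \<xi> \<le> 0" and X: "d * norm \<xi> \<le> Re \<xi> - Im \<xi>" and \<rho>: "norm \<xi> / 2 \<le> \<rho>"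
      "- (sqrt 2) * norm \<xi> ^ 2 \<le> \<rho> * (Re \<xi> + Im \<xi>)"
      "Im (\<xi> + of_real \<rho> * e) \<le> - \<eta> / norm \<xi> ^ 2" for \<xi> s \<rho>
  proof -
    define T where "T = \<xi> powr (- s) * exp (of_real pi * \<i> * \<xi> ^ 2 - of_real pi * \<i> * \<xi>)"
    have \<xi>0: "\<xi> \<noteq> 0" using N by auto
    have T0: "T \<noteq> 0" using \<xi>0 by (simp add: T_def powr_def)
    have im_ray: "Im (\<xi> + of_real r * e) \<le> - \<eta> / norm \<xi> ^ 2" if "r \<le> \<rho>" for r
    proof -
      have "r * (sqrt 2 / 2) \<le> \<rho> * (sqrt 2 / 2)" using that by (intro mult_right_mono) auto
      moreover have "Im (\<xi> + of_real t * e) = Im \<xi> + t * (sqrt 2 / 2)" for t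
        by (simp add: e_def sin_45)
      from this[of r] this[of \<rho>] show ?thesis using \<rho>(3) calculation by linarith
    qed
    have im_neg: "Im (\<xi> + of_real r * e) < 0" if "r \<le> \<rho>" for r
    proof -
      have "0 < \<eta> / norm \<xi> ^ 2" using pos \<xi>0 by simp
      then show ?thesis using im_ray[OF that] by simp
    qed
    define h where "h r = indicator {..\<rho>} r *\<^sub>R (aux_kernel s (\<xi> + of_real r * e) / T)" for r :: real
    have meas_h: "h \<in> borel_measurable lborel"
    proof -
      have "continuous_on {x. Im x < 0} (aux_kernel s)"
      proof (intro holomorphic_on_imp_continuous_on aux_kernel_holomorphic)
        show "sin_denom x \<noteq> 0" if "x \<in> {x. Im x < 0}" for x
          using that by (intro sin_denom_nonzero) auto
      qed (auto simp: complex_nonpos_Reals_iff)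
      then have "continuous_on {..\<rho>} (\<lambda>r. aux_kernel s (\<xi> + of_real r * e))"
        by (rule continuous_on_compose2) (use im_neg in \<open>auto intro!: continuous_intros\<close>)
      then have "continuous_on {..\<rho>} (\<lambda>r. aux_kernel s (\<xi> + of_real r * e) / T)"
        by (rule continuous_on_divide) (use T0 in auto)
      from borel_measurable_continuous_on_indicator[OF _ this] show ?thesis
        unfolding h_def by simp
    qed
    have h_le: "norm (h r - g0 r) \<le> K / norm \<xi> * exp (- (r ^ 2))" for r
    proof (cases "r \<le> \<rho>")
      case True
      define x where "x = \<xi> + of_real r * e"
      have "Im x < 0" using im_neg[OF True] unfolding x_def .
      then have x0: "x \<noteq> 0" by auto
      have "sin_denom x = exp (of_real pi * \<i> * x) * (1 - exp (- (2 * of_real pi * \<i> * x)))"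
        by (simp add: sin_denom_def right_diff_distrib exp_add[symmetric] mult_ac)
      moreover have "exp (of_real pi * \<i> * x) = exp (of_real pi * \<i> * \<xi>) * exp (of_real pi * \<i> * of_real r * e)"
        by (simp add: x_def exp_add[symmetric] algebra_simps)
      ultimately have denom: "sin_denom x = exp (of_real pi * \<i> * \<xi>) * exp (of_real pi * \<i> * of_real r * e)
          * (1 - exp (- (2 * of_real pi * \<i> * x)))" by simp
      have "aux_kernel s x / T =
          exp (saddle_phase \<xi> x - of_real pi * \<i> * of_real r * e) / (1 - exp (- (2 * of_real pi * \<i> * x)))"
      proof -
        have cancel: "a * b * p / (f * g * y) / (a * (b / f)) = p / g / y"
          if "a \<noteq> 0" "b \<noteq> 0" "f \<noteq> 0" for a b p f g y :: complex
          using that by simp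
        have "\<xi> powr (- s) \<noteq> 0" using \<xi>0 by simp
        then show ?thesis
          unfolding aux_kernel_eq_saddle_phase[OF x0 \<xi>0 s] T_def exp_diff denom
          by (rule cancel) simp_all
      qed
      then have h: "h r = exp (saddle_phase \<xi> x - of_real pi * \<i> * of_real r * e) / (1 - exp (- (2 * of_real pi * \<i> * x)))"
        using True by (simp add: h_def x_def)
      have "- (sqrt 2) * norm \<xi> ^ 2 \<le> r * (Re \<xi> + Im \<xi>)"
        using mult_right_mono_neg[OF True ReIm] \<rho>(2) by linarith
      then have "norm (h r - g0 r) \<le> (27 * (1 + 1 / \<eta>) + 108 * pi / d) * exp 8 / norm \<xi> * exp (- (r ^ 2))"
        unfolding h g0_def e_def
        by (rule saddle_integrand_bound[OF pos N im X]) (use im_ray[OF True] in \<open>simp_all add: x_def e_def\<close>)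
      also have "\<dots> \<le> K / norm \<xi> * exp (- (r ^ 2))"
        unfolding K_def by (intro mult_right_mono divide_right_mono) auto
      finally show ?thesis .
    next
      case False
      then have "h r = 0" by (simp add: h_def)
      then have "norm (h r - g0 r) = norm (g0 r)" by simp
      also have "\<dots> \<le> 2 * exp 8 / norm \<xi> * exp (- (r ^ 2))"
        unfolding g0_def e_def by (rule gaussian_tail_bound[OF N]) (use False \<rho> in auto)
      also have "\<dots> \<le> K / norm \<xi> * exp (- (r ^ 2))"
        unfolding K_def using pos by (intro mult_right_mono divide_right_mono) auto
      finally show ?thesis .
    qed
    have int_diff: "integrable lborel (\<lambda>r. h r - g0 r)"
    proof (rule Bochner_Integration.integrable_bound)
      show "integrable lborel (\<lambda>r. K / norm \<xi> * exp (- (r ^ 2)))" using int_e by simp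
      show "AE r in lborel. norm (h r - g0 r) \<le> norm (K / norm \<xi> * exp (- (r ^ 2)))"
        using h_le K0 by auto
      show "(\<lambda>r. h r - g0 r) \<in> borel_measurable lborel"
        using meas_h int_g0 by auto
    qed
    have int_h: "integrable lborel h"
      using Bochner_Integration.integrable_add[OF int_diff int_g0] by simp
    have "norm ((LINT r|lborel. h r) - (LINT r|lborel. g0 r)) = norm (LINT r|lborel. h r - g0 r)"
      using int_h int_g0 by simp
    also have "\<dots> \<le> (LINT r|lborel. K / norm \<xi> * exp (- (r ^ 2)))"
      using int_diff int_e h_le
      by (intro order_trans[OF integral_norm_bound] Bochner_Integration.integral_mono) auto
    also have "\<dots> = K * I / norm \<xi>" by (simp add: I_def)
    finally have diff: "norm ((LINT r|lborel. h r) - (LINT r|lborel. g0 r)) \<le> K * I / norm \<xi>" .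
    have "ray_integral (aux_kernel s) (\<xi> + of_real \<rho> * e) (- e)
        = (LINT t|lborel. indicator {0..} t *\<^sub>R (aux_kernel s (\<xi> + of_real \<rho> * e + of_real t * - e) * - e))"
      by (simp add: ray_integral_def set_lebesgue_integral_def)
    \<comment> \<open>Substitution \<open>t = \<rho> - r\<close>: \<open>t\<close> runs downwards
      from the upper end, \<open>r\<close> is the signed distance from the saddle.\<close>
    also have "\<dots> = \<bar>- 1\<bar> *\<^sub>R (LINT r|lborel. indicator {0..} (\<rho> + (- 1) * r) *\<^sub>R
        (aux_kernel s (\<xi> + of_real \<rho> * e + of_real (\<rho> + (- 1) * r) * - e) * - e))"
      by (rule lborel_integral_real_affine) simp
    also have "\<dots> = (LINT r|lborel. h r * (- e * T))"
      using T0 by (auto intro!: Bochner_Integration.integral_cong simp: h_def indicator_def algebra_simps)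
    also have "\<dots> = - e * T * (LINT r|lborel. h r)" by simp
    finally have ray: "ray_integral (aux_kernel s) (\<xi> + of_real \<rho> * e) (- e) = - e * T * (LINT r|lborel. h r)" .
    have "e * exp (- (\<i> * of_real pi / 8)) = exp (of_real pi * \<i> / 8)"
      by (simp add: e_def cis_conv_exp exp_add[symmetric] mult_ac)
    then have main: "main_term s \<xi> = - e * T * (LINT r|lborel. g0 r)"
      unfolding g0_def e_def gaussian_fourier_integral main_term_def T_def by (simp add: mult_ac)
    have "norm (ray_integral (aux_kernel s) (\<xi> + of_real \<rho> * e) (- e) - main_term s \<xi>)
        = norm (e * T) * norm ((LINT r|lborel. h r) - (LINT r|lborel. g0 r))"
      unfolding ray main by (simp add: norm_mult[symmetric] norm_minus_commute algebra_simps)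
    also have "\<dots> \<le> norm T * (K * I / norm \<xi>)"
      using mult_left_mono[OF diff, of "norm T"] by (simp add: norm_mult e_def)
    also have "norm T = sqrt 2 * norm (main_term s \<xi>)"
      by (simp add: main_term_def T_def norm_mult norm_divide)
    also have "sqrt 2 * norm (main_term s \<xi>) * (K * I / norm \<xi>) \<le> 2 * norm (main_term s \<xi>) * (K * I / norm \<xi>)"
      using K0 I0 by (intro mult_right_mono) (auto intro!: real_le_lsqrt)
    finally show ?thesis by (simp add: mult_ac)
  qed
  then show ?thesis
    using K0 I0 unfolding e_def by (intro exI[of _ "2 * K * I"] conjI allI impI) auto
qed

subsection \<open>The function G on the region\<close>

text \<open>The cosines of \<open>pi * q / 2\<close> and \<open>pi * q\<close> are
  \<open>(1 / Q + Q) / 2\<close> and \<open>(1 + Q ^ 4) / (2 * Q ^ 2)\<close>, which yields the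
  leading term. The hypotheses make \<open>Re q\<close> and \<open>Im q\<close> both negative, hence
  \<open>exp (pi * \<i> / 2 * q ^ 2)\<close> has modulus at most 1 and contributes only at order
  \<open>Q ^ 2\<close>.\<close>

lemma G_asymptotics:
  assumes "Im q \<le> - 2" "\<bar>Re q - Im q\<bar> \<le> 1"
  defines "Q \<equiv> exp (- (\<i> * of_real pi * q / 2))"
  obtains \<epsilon> where
    "G q = - (of_real (sqrt 2) * exp (of_real pi * \<i> / 8)) * Q * (1 + \<epsilon>)"
    "norm \<epsilon> \<le> 2 * norm Q" "norm Q \<le> 1 / 4"
proof -
  define w where "w = exp (of_real pi * \<i> / 8)"
  define E where "E = exp (of_real pi * \<i> / 2 * q ^ 2)"
  define f where "f q = (exp (of_real pi * \<i> / 2 * q ^ 2)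
        - of_real (sqrt 2) * exp (of_real pi * \<i> / 8) * cos (of_real pi * q / 2))
     / cos (of_real pi * q)" for q
  have w0: "w \<noteq> 0" "norm w = 1" by (simp_all add: w_def)
  have nQ: "norm Q = exp (pi * Im q / 2)" by (simp add: Q_def)
  have "exp (pi * Im q / 2) \<le> exp (- pi)"
    using mult_left_mono[OF assms(1), of "pi / 2"] by simp
  also have "\<dots> \<le> 1 / 4"
  proof -
    have "4 \<le> exp pi" using exp_ge_add_one_self[of pi] pi_gt3 by linarith
    then show ?thesis by (simp add: exp_minus field_simps)
  qed
  finally have Q4: "norm Q \<le> 1 / 4" by (simp add: nQ)
  have Q0: "Q \<noteq> 0" by (simp add: Q_def)
  have E1: "norm E \<le> 1"
  proof -
    have "0 \<le> Re q * Im q" using assms by (intro mult_nonpos_nonpos) auto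
    then have "0 \<le> pi * (Im q * Re q)" by (simp add: mult.commute)
    then show ?thesis by (simp add: E_def power2_eq_square)
  qed
  have Q4': "norm (Q ^ 4) \<le> 1 / 256"
    using power_mono[OF Q4, of 4] by (simp add: norm_power power_divide)
  have D_ge: "255 / 256 \<le> norm (1 + Q ^ 4)"
    using norm_triangle_ineq2[of 1 "- (Q ^ 4)"] Q4' by simp
  then have D0: "1 + Q ^ 4 \<noteq> 0" by auto
  have cosq: "cos (of_real pi * q / 2) = (1 / Q + Q) / 2"
    by (simp add: cos_exp_eq Q_def exp_minus field_simps)
  have "exp (\<i> * (of_real pi * q)) = (1 / Q) ^ 2" "exp (- (\<i> * (of_real pi * q))) = Q ^ 2"
    by (simp_all add: Q_def exp_minus power2_eq_square exp_add[symmetric] field_simps)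
  then have cos2q: "cos (of_real pi * q) = (1 + Q ^ 4) / (2 * Q ^ 2)"
    using Q0 by (simp add: cos_exp_eq field_simps power2_eq_square power4_eq_xxxx)
  define \<epsilon> where "\<epsilon> = (Q ^ 2 - Q ^ 4 - of_real (sqrt 2) / w * E * Q) / (1 + Q ^ 4)"
  have "f analytic_on {q}"
    unfolding f_def using D0 Q0 cos2q by (auto intro!: analytic_intros)
  then have "G q = f q" unfolding G_def f_def[abs_def] by (rule remove_sings_at_analytic)
  also have "\<dots> = (E - of_real (sqrt 2) * w * ((1 / Q + Q) / 2)) / ((1 + Q ^ 4) / (2 * Q ^ 2))"
    by (simp add: f_def cosq cos2q E_def w_def)
  also have "\<dots> = - (of_real (sqrt 2) * w) * Q * (1 + \<epsilon>)"
  proof -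
    have s2: "complex_of_real (sqrt 2) * of_real (sqrt 2) = 2"
      by (metis of_real_mult of_real_numeral real_sqrt_mult_self abs_numeral)
    \<comment> \<open>Proved for abstract \<open>r\<close> and \<open>D\<close>, so that
      \<open>r * r = 2\<close> is the sole fact about the square root.\<close>
    have "(E - r * w * ((1 / Q + Q) / 2)) / (D / (2 * Q ^ 2))
        = - (r * w) * Q * (1 + (Q ^ 2 - Q ^ 4 - r / w * E * Q) / D)"
      if "r * r = 2" "D = 1 + Q ^ 4" for r D :: complex
    proof -
      have D: "D \<noteq> 0" using that D0 by simp
      have "(E - r * w * ((1 / Q + Q) / 2)) / (D / (2 * Q ^ 2)) = (2 * E * Q ^ 2 - r * w * (Q + Q ^ 3)) / D"
      proof -
        have num: "E - r * w * ((1 / Q + Q) / 2) = (2 * E * Q ^ 2 - r * w * (Q + Q ^ 3)) / (2 * Q ^ 2)"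
          using Q0 by (simp add: divide_simps) (simp add: algebra_simps power2_eq_square power3_eq_cube)
        show ?thesis unfolding num using Q0 by simp
      qed
      also have "\<dots> = (- (r * w) * Q * (D + (Q ^ 2 - Q ^ 4 - r / w * E * Q))) / D"
      proof -
        have "r * w * Q * (r / w * E * Q) = 2 * E * Q ^ 2"
          using w0 that(1) by (simp add: power2_eq_square)
        then have "2 * E * Q ^ 2 - r * w * (Q + Q ^ 3) = - (r * w) * Q * (D + (Q ^ 2 - Q ^ 4 - r / w * E * Q))"
          unfolding that(2) by (simp add: algebra_simps power2_eq_square power3_eq_cube)
        then show ?thesis by simp
      qed
      also have "\<dots> = - (r * w) * Q * (1 + (Q ^ 2 - Q ^ 4 - r / w * E * Q) / D)"
        using D by (simp add: field_simps)
      finally show ?thesis by simp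
    qed
    from this[OF s2 refl] show ?thesis by (simp add: \<epsilon>_def)
  qed
  finally have G: "G q = - (of_real (sqrt 2) * w) * Q * (1 + \<epsilon>)" .
  have "norm (Q ^ 2 - Q ^ 4 - of_real (sqrt 2) / w * E * Q)
      \<le> norm (Q ^ 2) + norm (Q ^ 4) + norm (of_real (sqrt 2) / w * E * Q)"
    by (meson norm_triangle_ineq4 order_trans add_right_mono)
  also have "norm (Q ^ 2) \<le> 1 / 4 * norm Q"
    using mult_right_mono[OF Q4, of "norm Q"] by (simp add: power2_eq_square norm_mult)
  also have "norm (Q ^ 4) \<le> 1 / 64 * norm Q"
  proof -
    have "norm Q ^ 3 \<le> (1 / 4) ^ 3" using Q4 by (intro power_mono) auto
    from mult_right_mono[OF this, of "norm Q"]
    have "norm Q ^ 3 * norm Q \<le> 1 / 64 * norm Q" by (simp add: power_divide)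
    moreover have "norm (Q ^ 4) = norm Q ^ 3 * norm Q" by (simp add: norm_power flip: power_Suc2)
    ultimately show ?thesis by simp
  qed
  also have "norm (of_real (sqrt 2) / w * E * Q) \<le> 3 / 2 * norm Q"
  proof -
    have "sqrt 2 \<le> 3 / 2" by (rule real_le_lsqrt) (simp_all add: power2_eq_square)
    then have "sqrt 2 * norm E * norm Q \<le> 3 / 2 * 1 * norm Q"
      using E1 by (intro mult_mono) auto
    then show ?thesis by (simp add: norm_mult norm_divide w0)
  qed
  \<comment> \<open>113/64 is 1/4 + 1/64 + 3/2, which stays below 2 * 255/256.\<close>
  finally have "norm (Q ^ 2 - Q ^ 4 - of_real (sqrt 2) / w * E * Q) \<le> (113 / 64) * norm Q" by simp
  also have "\<dots> \<le> (2 * norm Q) * (255 / 256)" by simp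
  also have "\<dots> \<le> (2 * norm Q) * norm (1 + Q ^ 4)" using D_ge by (intro mult_left_mono) auto
  finally have "norm \<epsilon> \<le> 2 * norm Q"
    using D0 by (simp add: \<epsilon>_def norm_divide divide_le_eq)
  with G Q4 show ?thesis by (intro that) (simp_all add: w_def)
qed

text \<open>The floor in \<open>ell\<close> places \<open>Re q - Im q\<close> in
  \<open>[-1, 1)\<close>. Moreover \<open>Q\<close> is
  \<open>\<i> * (- 1) powi l * exp (- pi * \<i> * \<xi>)\<close>: its sign cancels the one in front,
  and its \<open>\<i>\<close> the one in \<open>2 * \<i>\<close>. The bound 1/2 permits division by
  \<open>1 + \<epsilon>\<close> later.\<close>

lemma main_term_eq_G:
  assumes im: "Im (xi s) \<le> - norm (xi s) / 2" and N: "2 \<le> norm (xi s)"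
  obtains \<epsilon> where
    "(- 1) powi (ell s) / (2 * \<i>) * xi s powr (- s) * exp (of_real pi * \<i> * xi s ^ 2) * G (qpar s)
       = main_term s (xi s) * (1 + \<epsilon>)"
    "norm \<epsilon> \<le> 2 / norm (xi s)" "norm \<epsilon> \<le> 1 / 2"
proof -
  define \<xi> l q where "\<xi> = xi s" and "l = ell s" and "q = qpar s"
  define Q where "Q = exp (- (\<i> * of_real pi * q / 2))"
  have q: "q = 2 * \<xi> - 2 * of_int l - 1" by (simp add: q_def qpar_def l_def \<xi>_def algebra_simps)
  have "of_int l \<le> Re \<xi> - Im \<xi>" "Re \<xi> - Im \<xi> < of_int l + 1"
    by (simp_all add: l_def ell_def \<xi>_def)
  then have "\<bar>Re q - Im q\<bar> \<le> 1" by (simp add: q abs_le_iff)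
  moreover have "Im q \<le> - 2" using im N by (simp add: q \<xi>_def)
  ultimately obtain \<epsilon> where \<epsilon>: "G q = - (of_real (sqrt 2) * exp (of_real pi * \<i> / 8)) * Q * (1 + \<epsilon>)"
    "norm \<epsilon> \<le> 2 * norm Q" "norm Q \<le> 1 / 4"
    using G_asymptotics[of q] unfolding Q_def by blast
  have powi: "exp (\<i> * of_real pi * of_int l) = (- 1) powi l"
    using exp_power_int[of "\<i> * of_real pi" l] by (simp add: mult.commute)
  have "Q = exp (- (of_real pi * \<i> * \<xi>)) * exp (\<i> * of_real pi * of_int l) * exp (\<i> * of_real (pi / 2))"
    unfolding Q_def exp_add[symmetric] q by (rule arg_cong[where f = exp]) (simp add: field_simps)
  also have "exp (\<i> * of_real (pi / 2)) = \<i>" by (metis cis_conv_exp cis_pi_half)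
  finally have Q: "Q = exp (- (of_real pi * \<i> * \<xi>)) * (- 1) powi l * \<i>" unfolding powi .
  have l2: "(- 1) powi l * (- 1) powi l = (1 :: complex)"
    by (simp add: power_int_mult_distrib[symmetric])
  have r2: "complex_of_real (sqrt 2) / 2 = 1 / of_real (sqrt 2)"
  proof -
    have "complex_of_real (sqrt 2) * of_real (sqrt 2) = 2"
      by (metis of_real_mult of_real_numeral real_sqrt_mult_self abs_numeral)
    then show ?thesis by (simp add: divide_simps)
  qed
  have eq: "(- 1) powi l / (2 * \<i>) * \<xi> powr (- s) * exp (of_real pi * \<i> * \<xi> ^ 2) * G q
       = main_term s \<xi> * (1 + \<epsilon>)"
  proof -
    have "(- 1) powi l / (2 * \<i>) * \<xi> powr (- s) * exp (of_real pi * \<i> * \<xi> ^ 2) * G q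
      = ((- 1) powi l * (- 1) powi l) * - (of_real (sqrt 2) / 2 * exp (of_real pi * \<i> / 8))
        * (\<xi> powr (- s) * (exp (of_real pi * \<i> * \<xi> ^ 2) * exp (- (of_real pi * \<i> * \<xi>)))) * (1 + \<epsilon>)"
      unfolding \<epsilon>(1) Q by (simp add: mult_ac)
    also have "\<dots> = main_term s \<xi> * (1 + \<epsilon>)"
      unfolding l2 r2 exp_add[symmetric] main_term_def by simp
    finally show ?thesis .
  qed
  have nQ: "norm Q \<le> 1 / norm \<xi>"
  proof -
    have "norm Q = exp (pi * Im \<xi>)" by (simp add: Q_def q)
    also have "pi * Im \<xi> \<le> - norm \<xi>"
    proof -
      have "pi * Im \<xi> \<le> pi * (- norm \<xi> / 2)" using im by (intro mult_left_mono) (auto simp: \<xi>_def)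
      moreover have "2 * norm \<xi> \<le> pi * norm \<xi>" using pi_ge_two by (intro mult_right_mono) auto
      ultimately show ?thesis by simp
    qed
    also have "exp (- norm \<xi>) \<le> 1 / norm \<xi>"
    proof -
      have "norm \<xi> \<le> exp (norm \<xi>)" using exp_ge_add_one_self[of "norm \<xi>"] by linarith
      then have "inverse (exp (norm \<xi>)) \<le> inverse (norm \<xi>)"
        using N by (intro le_imp_inverse_le) (auto simp: \<xi>_def)
      then show ?thesis by (simp add: exp_minus divide_inverse)
    qed
    finally show ?thesis by simp
  qed
  show ?thesis
  proof (rule that)
    show "norm \<epsilon> \<le> 2 / norm (xi s)" using \<epsilon>(2) nQ by (simp add: \<xi>_def)
    show "norm \<epsilon> \<le> 1 / 2" using \<epsilon>(2,3) by simp
  qed (use eq in \<open>simp add: \<xi>_def l_def q_def\<close>)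
qed

text \<open>\<open>N ^ 2 / ln N ^ 3\<close> outgrows \<open>pi * N\<close> and every logarithm of a
  power; below the threshold of the limit, compactness of an interval that avoids the zero 1 of
  \<open>ln\<close> suffices. The factor \<open>N ^ 3\<close> has room for a denominator of order
  \<open>1 / N ^ 2\<close> and a segment of length of order \<open>N\<close>.\<close>

lemma subexponential_correction_bound:
  assumes "\<kappa> > 0"
  obtains C where "C \<ge> 0" "\<And>N. exp 1 \<le> N \<Longrightarrow> N ^ 3 * exp (pi * N - \<kappa> * N ^ 2 / ln N ^ 3) \<le> C / N"
proof -
  define f where "f N = N ^ 4 * exp (pi * N - \<kappa> * N ^ 2 / ln N ^ 3)" for N :: real
  have "(f \<longlongrightarrow> 0) at_top" unfolding f_def using assms by real_asymp
  then have "\<forall>\<^sub>F N in at_top. f N < 1" by (rule order_tendstoD) simp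
  then obtain K where K: "\<And>N. N \<ge> K \<Longrightarrow> f N < 1" by (auto simp: eventually_at_top_linorder)
  have e1: "1 < exp (1::real)" by simp
  have "continuous_on {exp 1..K} f" unfolding f_def
  proof (intro continuous_intros ballI)
    fix x :: real assume "x \<in> {exp 1..K}"
    then have "1 < x" using e1 by (meson atLeastAtMost_iff less_le_trans)
    then show "x \<noteq> 0" "ln x ^ 3 \<noteq> 0" by auto
  qed
  then have "bounded (f ` {exp 1..K})" by (intro compact_imp_bounded compact_continuous_image) auto
  then obtain B where B: "\<And>N. N \<in> {exp 1..K} \<Longrightarrow> norm (f N) \<le> B"
    unfolding bounded_iff by blast
  show ?thesis
  proof (rule that[of "max 1 B"])
    fix N :: real assume N: "exp 1 \<le> N"
    have "f N \<le> max 1 B"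
    proof (cases "N \<le> K")
      case True
      then show ?thesis using B[of N] N by auto
    next
      case False
      then show ?thesis using K[of N] by auto
    qed
    moreover have "0 < N" using N e1 by linarith
    ultimately show "N ^ 3 * exp (pi * N - \<kappa> * N ^ 2 / ln N ^ 3) \<le> max 1 B / N"
      by (simp add: f_def field_simps power4_eq_xxxx power3_eq_cube)
  qed simp
qed

subsection \<open>The negligible parts of the contour\<close>

text \<open>\<open>\<beta>\<close> measures the deviation of \<open>\<xi>\<close> from the negative
  imaginary axis. The \<open>- 1 / 2\<close> beside \<open>ln N\<close> stems from
  \<open>pi * \<i> * \<xi> ^ 2 = s / 2\<close>.\<close>

lemma polar_saddle:
  fixes N \<beta> :: real
  assumes N: "N > 0" and \<beta>: "\<bar>\<beta>\<bar> < pi / 4"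
    and \<xi>: "\<xi> = rcis N (- pi / 2 - \<beta>)" and s: "s = 2 * of_real pi * \<i> * \<xi> ^ 2"
  shows "norm \<xi> = N" "Re \<xi> = - N * sin \<beta>" "Im \<xi> = - N * cos \<beta>" "Arg \<xi> = - pi / 2 - \<beta>"
    and "Re s = - (2 * pi * N ^ 2 * sin (2 * \<beta>))" "Im s = - (2 * pi * N ^ 2 * cos (2 * \<beta>))"
    and "norm (\<xi> powr (- s) * exp (of_real pi * \<i> * \<xi> ^ 2)) =
      exp (2 * pi * N ^ 2 * (sin (2 * \<beta>) * (ln N - 1 / 2) + cos (2 * \<beta>) * (pi / 2 + \<beta>)))"
    and "norm (main_term s \<xi>) =
      exp (2 * pi * N ^ 2 * (sin (2 * \<beta>) * (ln N - 1 / 2) + cos (2 * \<beta>) * (pi / 2 + \<beta>)) - pi * N * cos \<beta>) / sqrt 2"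
proof -
  show n: "norm \<xi> = N" using N by (simp add: \<xi>)
  have "cos (- pi / 2 - \<beta>) = - sin \<beta>" "sin (- pi / 2 - \<beta>) = - cos \<beta>"
    by (simp_all add: cos_diff sin_diff)
  then show re: "Re \<xi> = - N * sin \<beta>" and im: "Im \<xi> = - N * cos \<beta>" by (simp_all add: \<xi> rcis_def)
  show arg: "Arg \<xi> = - pi / 2 - \<beta>"
    unfolding \<xi> by (rule Arg_rcis[OF _ N]) (use \<beta> in auto)
  have res: "Re s = - 2 * pi * (2 * Re \<xi> * Im \<xi>) " and ims: "Im s = 2 * pi * (Re \<xi> ^ 2 - Im \<xi> ^ 2)"
    by (simp_all add: s power2_eq_square)
  show res': "Re s = - (2 * pi * N ^ 2 * sin (2 * \<beta>))"
    unfolding res re im sin_double by (simp add: power2_eq_square)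
  show ims': "Im s = - (2 * pi * N ^ 2 * cos (2 * \<beta>))"
    unfolding ims re im cos_double by (simp add: power_mult_distrib algebra_simps)
  have half: "norm (exp (of_real pi * \<i> * \<xi> ^ 2)) = exp (Re s / 2)"
    by (simp add: s)
  have p: "norm (\<xi> powr (- s)) = exp (- Re s * ln N + Im s * Arg \<xi>)"
  proof -
    have "norm (\<xi> powr (- s)) = N powr (- Re s) * exp (Im s * Arg \<xi>)"
      by (simp add: norm_powr_complex n)
    also have "N powr (- Re s) = exp (- Re s * ln N)" using N by (simp add: powr_def)
    finally show ?thesis by (simp add: exp_add[symmetric])
  qed
  show a: "norm (\<xi> powr (- s) * exp (of_real pi * \<i> * \<xi> ^ 2)) =
      exp (2 * pi * N ^ 2 * (sin (2 * \<beta>) * (ln N - 1 / 2) + cos (2 * \<beta>) * (pi / 2 + \<beta>)))"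
    unfolding norm_mult half p exp_add[symmetric] exp_inj_iff arg res' ims' by (simp add: algebra_simps)
  have "norm (main_term s \<xi>) = norm (\<xi> powr (- s) * exp (of_real pi * \<i> * \<xi> ^ 2)) * exp (pi * Im \<xi>) / sqrt 2"
  proof -
    have "main_term s \<xi> = - (exp (of_real pi * \<i> / 8) / of_real (sqrt 2))
        * ((\<xi> powr (- s) * exp (of_real pi * \<i> * \<xi> ^ 2)) * exp (- (of_real pi * \<i> * \<xi>)))"
      by (simp only: main_term_def diff_conv_add_uminus exp_add mult.assoc)
    moreover have "norm (exp (of_real pi * \<i> / 8)) = 1" "norm (exp (- (of_real pi * \<i> * \<xi>))) = exp (pi * Im \<xi>)"
      by simp_all
    ultimately show ?thesis by (simp only: norm_mult norm_divide norm_minus_cancel norm_of_real) simp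
  qed
  then show "norm (main_term s \<xi>) =
      exp (2 * pi * N ^ 2 * (sin (2 * \<beta>) * (ln N - 1 / 2) + cos (2 * \<beta>) * (pi / 2 + \<beta>)) - pi * N * cos \<beta>) / sqrt 2"
    unfolding a im by (simp add: exp_add[symmetric])
qed

text \<open>The bound holds even if the ray integral diverges, its junk value being 0.\<close>
lemma norm_ray_integral_le:
  assumes "norm u = 1" "integrable lborel B" "\<And>t. 0 \<le> B t"
    and "\<And>t. 0 \<le> t \<Longrightarrow> norm (f (z + of_real t * u)) \<le> B t"
  shows "norm (ray_integral f z u) \<le> (LINT t|lborel. B t)"
proof (cases "set_integrable lborel {0..} (\<lambda>t. f (z + of_real t * u) * u)")
  case True
  let ?g = "\<lambda>t. indicator {0..} t *\<^sub>R (f (z + of_real t * u) * u)"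
  have "integrable lborel (\<lambda>t. norm (?g t))"
    using True unfolding set_integrable_def by (rule integrable_norm)
  then have "(LINT t|lborel. norm (?g t)) \<le> (LINT t|lborel. B t)"
    by (rule Bochner_Integration.integral_mono)
       (use assms in \<open>auto simp: indicator_def norm_mult\<close>)
  then show ?thesis
    unfolding ray_integral_def set_lebesgue_integral_def by (rule order_trans[OF integral_norm_bound])
next
  case False
  then have "ray_integral f z u = 0"
    unfolding ray_integral_def set_lebesgue_integral_def set_integrable_def
    by (rule not_integrable_integral_eq)
  moreover have "0 \<le> (LINT t|lborel. B t)" using assms(3) by (intro integral_nonneg_AE) auto
  ultimately show ?thesis by simp
qed

lemma aux_kernel_segment_bound:
  assumes "Im a < 0" "Im b < 0" "0 \<le> B" "\<And>x. x \<in> closed_segment a b \<Longrightarrow> norm (aux_kernel s x) \<le> B"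
  shows "norm (contour_integral (linepath a b) (aux_kernel s)) \<le> B * norm (b - a)"
proof (rule contour_integral_bound_linepath[OF _ assms(3,4)])
  have sub: "closed_segment a b \<subseteq> {x. Im x < 0}"
    by (rule closed_segment_subset) (use assms in \<open>auto simp: convex_halfspace_Im_lt\<close>)
  show "aux_kernel s contour_integrable_on linepath a b"
  proof (intro contour_integrable_continuous_linepath holomorphic_on_imp_continuous_on aux_kernel_holomorphic)
    show "closed_segment a b \<inter> \<real>\<^sub>\<le>\<^sub>0 = {}" using sub by (auto simp: complex_nonpos_Reals_iff)
    fix x assume "x \<in> closed_segment a b"
    then have "Im x < 0" using sub by auto
    then show "sin_denom x \<noteq> 0"
      by (intro sin_denom_nonzero) auto
  qed
qed

lemma Arg_ge_neg_pi_fourth: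
  assumes "0 < Re x" "- Re x \<le> Im x"
  shows "- (pi / 4) \<le> Arg x"
proof -
  have "arctan (- 1) \<le> arctan (Im x / Re x)"
    unfolding arctan_le_iff using assms by (simp add: field_simps)
  then show ?thesis using assms by (simp add: arg_conv_arctan arctan_minus arctan_one)
qed

text \<open>From \<open>2 ln (u / N) \<le> (u / N)\<^sup>2 - 1\<close>; equality holds on the circle through the saddle.\<close>
lemma powr_gaussian_le:
  assumes "u > 0" "N > 0" "S \<ge> (0::real)"
  shows "u powr (2 * pi * N ^ 2 * S) * exp (- (pi * u ^ 2))
    \<le> exp (2 * pi * N ^ 2 * (S * (ln N - 1 / 2)) - pi * (1 - S) * u ^ 2)"
proof -
  have "ln ((u / N) ^ 2) \<le> (u / N) ^ 2 - 1" using assms by (intro ln_le_minus_one) auto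
  then have "2 * (ln u - ln N) \<le> u ^ 2 / N ^ 2 - 1"
    using assms by (simp add: ln_realpow ln_div power_divide)
  then have "(pi * N ^ 2 * S) * (2 * (ln u - ln N)) \<le> (pi * N ^ 2 * S) * (u ^ 2 / N ^ 2 - 1)"
    using assms by (intro mult_left_mono) auto
  also have "\<dots> = pi * S * u ^ 2 - pi * N ^ 2 * S" using assms by (simp add: field_simps)
  finally have le: "2 * pi * N ^ 2 * S * ln u - pi * u ^ 2
      \<le> 2 * pi * N ^ 2 * (S * (ln N - 1 / 2)) - pi * (1 - S) * u ^ 2"
    by (simp add: algebra_simps)
  have eq: "u powr (2 * pi * N ^ 2 * S) * exp (- (pi * u ^ 2)) = exp (2 * pi * N ^ 2 * S * ln u - pi * u ^ 2)"
  proof -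
    have "u powr (2 * pi * N ^ 2 * S) = exp (2 * pi * N ^ 2 * S * ln u)" using assms by (simp add: powr_def)
    then show ?thesis by (simp only: diff_conv_add_uminus exp_add)
  qed
  show ?thesis unfolding eq exp_le_cancel_iff by (rule le)
qed

text \<open>
  \<open>P\<close> lies in the strip free of poles, \<open>A\<close> on the steepest descent line through the saddle \<open>\<xi>\<close>, and both
  the part of the contour above \<open>P\<close> and the segment from \<open>P\<close> to \<open>A\<close> are negligible.
\<close>
definition connecting_path :: "complex \<Rightarrow> complex \<Rightarrow> real \<Rightarrow> real \<Rightarrow> complex \<Rightarrow> complex \<Rightarrow> bool" where
  "connecting_path s \<xi> \<eta> C P A \<longleftrightarrow>
     0 < Re P - Im P \<and> Re P - Im P < 1 \<and> Im P < 0 \<and>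
     (\<exists>\<rho>. A = \<xi> + of_real \<rho> * cis (pi / 4) \<and> norm \<xi> / 2 \<le> \<rho> \<and>
        - (sqrt 2) * norm \<xi> ^ 2 \<le> \<rho> * (Re \<xi> + Im \<xi>) \<and> Im A \<le> - \<eta> / norm \<xi> ^ 2) \<and>
     norm (contour_integral (linepath P A) (aux_kernel s)) \<le> C / norm \<xi> * norm (main_term s \<xi>) \<and>
     norm (ray_integral (aux_kernel s) P (cis (pi / 4))) \<le> C / norm \<xi> * norm (main_term s \<xi>)"

section \<open>The connecting path for \<open>Re s \<le> 0\<close>\<close>

text \<open>By \<open>powr_gaussian_le\<close> the modulus of \<open>x\<close> contributes no more
  than it does at the saddle, and \<open>1 - sin (2 * \<beta>)\<close> leaves a Gaussian for
  convergence. The gain over the main term is in the argument: \<open>Arg x \<ge> - pi / 4\<close>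
  puts \<open>pi / 4\<close> where the saddle has \<open>pi / 2 + \<beta>\<close>.\<close>

lemma upper_ray_bound_left:
  assumes N: "1 < N" and \<beta>: "0 \<le> \<beta>" "\<beta> < pi / 4"
    and \<xi>: "\<xi> = rcis N (- pi / 2 - \<beta>)" and s: "s = 2 * of_real pi * \<i> * \<xi> ^ 2"
    and \<kappa>: "0 < \<kappa>" "\<kappa> \<le> 1 - sin (2 * \<beta>)"
  shows "norm (ray_integral (aux_kernel s) (Complex (1 / 4) (- 1 / 4)) (cis (pi / 4)))
    \<le> 2 * exp (pi / 4) * exp (2 * pi * N ^ 2 * (sin (2 * \<beta>) * (ln N - 1 / 2) + cos (2 * \<beta>) * (pi / 4)))
        * (LINT t|lborel. exp (- (pi * \<kappa>) * (t - 0) ^ 2))"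
proof -
  have \<beta>': "\<bar>\<beta>\<bar> < pi / 4" and N0: "N > 0" using \<beta> N by auto
  note polar = polar_saddle[OF N0 \<beta>' \<xi> s]
  define S where "S = sin (2 * \<beta>)"
  define c where "c = cos (2 * \<beta>)"
  have S0: "0 \<le> S" unfolding S_def using \<beta> by (intro sin_ge_zero) auto
  have c0: "0 \<le> c" unfolding c_def using \<beta> by (intro cos_ge_zero) auto
  define K where "K = 2 * exp (pi / 4) * exp (2 * pi * N ^ 2 * (S * (ln N - 1 / 2) + c * (pi / 4)))"
  have "norm (ray_integral (aux_kernel s) (Complex (1 / 4) (- 1 / 4)) (cis (pi / 4)))
      \<le> (LINT t|lborel. K * exp (- (pi * \<kappa>) * (t - 0) ^ 2))"
  proof (rule norm_ray_integral_le)
    show "integrable lborel (\<lambda>t. K * exp (- (pi * \<kappa>) * (t - 0) ^ 2))"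
      using \<kappa> by (intro integrable_mult_right integrable_shifted_gaussian) auto
    fix t :: real
    show "0 \<le> K * exp (- (pi * \<kappa>) * (t - 0) ^ 2)" by (simp add: K_def)
    assume t: "0 \<le> t"
    define x where "x = Complex (1 / 4) (- 1 / 4) + of_real t * cis (pi / 4)"
    define w where "w = t * (sqrt 2 / 2)"
    have w: "0 \<le> w" "w ^ 2 = t ^ 2 / 2" using t by (simp_all add: w_def power_mult_distrib power_divide)
    have x: "Re x = 1 / 4 + w" "Im x = - 1 / 4 + w" by (simp_all add: x_def w_def cos_45 sin_45)
    \<comment> \<open>The starting point is orthogonal to \<open>cis (pi / 4)\<close>, so
      \<open>norm x ^ 2 = t ^ 2 + 1 / 8\<close>.\<close>
    have nx: "t ^ 2 \<le> norm x ^ 2"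
      unfolding cmod_power2 x using w by (simp add: power2_eq_square algebra_simps)
    have x0: "x \<noteq> 0" using x w by auto
    have "- (pi / 4) \<le> Arg x" by (rule Arg_ge_neg_pi_fourth) (use x w in auto)
    then have "2 * pi * N ^ 2 * c * (- Arg x) \<le> 2 * pi * N ^ 2 * c * (pi / 4)"
      using c0 by (intro mult_left_mono) auto
    then have e1: "exp (Im s * Arg x) \<le> exp (2 * pi * N ^ 2 * (c * (pi / 4)))"
      by (simp add: polar c_def mult.assoc)
    have d: "1 / 2 \<le> norm (sin_denom x)" by (rule norm_sin_denom_ge_strip) (simp_all add: x)
    have "norm (aux_kernel s x) = norm x powr (2 * pi * N ^ 2 * S) * exp (- (pi * norm x ^ 2))
        * exp (Im s * Arg x) * exp (pi / 4) / norm (sin_denom x)"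
    proof -
      have "Re x - Im x = 1 / 2" by (simp add: x)
      have "exp (pi * (Re x - Im x) ^ 2 - pi * norm x ^ 2) = exp (pi / 4) * exp (- (pi * norm x ^ 2))"
        unfolding \<open>Re x - Im x = 1 / 2\<close> by (simp add: exp_add[symmetric] power_divide)
      moreover have "- Re s = 2 * pi * N ^ 2 * S" by (simp add: polar S_def)
      ultimately show ?thesis unfolding norm_aux_kernel' by (simp only: mult_ac)
    qed
    also have "\<dots> \<le> exp (2 * pi * N ^ 2 * (S * (ln N - 1 / 2)) - pi * (1 - S) * norm x ^ 2)
        * exp (2 * pi * N ^ 2 * (c * (pi / 4))) * exp (pi / 4) / (1 / 2)"
      using x0 N S0 e1 d by (intro frac_le mult_mono powr_gaussian_le) auto
    also have "\<dots> = K * exp (- (pi * (1 - S)) * norm x ^ 2)"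
    proof -
      have "exp (2 * pi * N ^ 2 * (S * (ln N - 1 / 2)) - pi * (1 - S) * norm x ^ 2)
          * exp (2 * pi * N ^ 2 * (c * (pi / 4)))
        = exp (2 * pi * N ^ 2 * (S * (ln N - 1 / 2) + c * (pi / 4))) * exp (- (pi * (1 - S)) * norm x ^ 2)"
        unfolding exp_add[symmetric] exp_inj_iff by (simp add: algebra_simps)
      then show ?thesis by (simp add: K_def)
    qed
    also have "\<dots> \<le> K * exp (- (pi * \<kappa>) * (t - 0) ^ 2)"
    proof (rule mult_left_mono)
      have "pi * \<kappa> * t ^ 2 \<le> pi * (1 - S) * norm x ^ 2"
        using \<kappa> nx by (intro mult_mono) (auto simp: S_def)
      then show "exp (- (pi * (1 - S)) * norm x ^ 2) \<le> exp (- (pi * \<kappa>) * (t - 0) ^ 2)" by simp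
    qed (simp add: K_def)
    finally show "norm (aux_kernel s (Complex (1 / 4) (- 1 / 4) + of_real t * cis (pi / 4)))
        \<le> K * exp (- (pi * \<kappa>) * (t - 0) ^ 2)" by (simp only: x_def)
  qed simp
  also have "\<dots> = K * (LINT t|lborel. exp (- (pi * \<kappa>) * (t - 0) ^ 2))" by (rule integral_mult_right_zero)
  finally show ?thesis by (simp only: K_def S_def c_def)
qed

text \<open>On the ray of argument \<open>- pi / 4\<close>, the modulus of the kernel without its
  denominator increases with \<open>v\<close>, because \<open>- Re s = a \<ge> 0\<close>; so the
  outer end of the segment dominates. At \<open>A\<close> the saddle estimate gives the loss
  \<open>exp (- pi * N ^ 2 / 2)\<close>; at the other end the argument gives the gain, as on the
  upper ray.\<close>

lemma diagonal_segment_bound_left: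
  assumes N: "1 < N" "1 \<le> ln N" and \<beta>: "0 \<le> \<beta>" "\<beta> < pi / 4"
    and \<xi>: "\<xi> = rcis N (- pi / 2 - \<beta>)" and s: "s = 2 * of_real pi * \<i> * \<xi> ^ 2"
    and d: "0 < d" "d \<le> 1" "d \<le> cos \<beta> - sin \<beta>"
    and A: "A = Complex ((Re \<xi> - Im \<xi>) / 2) (- (Re \<xi> - Im \<xi>) / 2)"
    and x: "x \<in> closed_segment (Complex (1 / 4) (- 1 / 4)) A"
  shows "norm (aux_kernel s x) \<le> 1 / d *
     (exp (2 * pi * N ^ 2 * (sin (2 * \<beta>) * (ln N - 1 / 2) + cos (2 * \<beta>) * (pi / 2 + \<beta>)) - pi * N ^ 2 / 2)
      + exp (pi / 8) * exp (2 * pi * N ^ 2 * (sin (2 * \<beta>) * (ln N - 1 / 2) + cos (2 * \<beta>) * (pi / 4))))"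
proof -
  have \<beta>': "\<bar>\<beta>\<bar> < pi / 4" and N0: "N > 0" using \<beta> N by auto
  note polar = polar_saddle[OF N0 \<beta>' \<xi> s]
  define S where "S = sin (2 * \<beta>)"
  define c where "c = cos (2 * \<beta>)"
  define a where "a = 2 * pi * N ^ 2 * S"
  have S0: "0 \<le> S" unfolding S_def using \<beta> by (intro sin_ge_zero) auto
  have c0: "0 \<le> c" unfolding c_def using \<beta> by (intro cos_ge_zero) auto
  have a0: "0 \<le> a" using S0 by (simp add: a_def)
  define X where "X = Re \<xi> - Im \<xi>"
  have X: "X = N * (cos \<beta> - sin \<beta>)" by (simp add: X_def polar algebra_simps)
  have dX: "d \<le> X" using mult_mono[of 1 N d "cos \<beta> - sin \<beta>"] N d by (simp add: X)
  have cs1: "1 \<le> cos \<beta> + sin \<beta>"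
  proof -
    have "0 \<le> cos \<beta>" "0 \<le> sin \<beta>" using \<beta> by (auto intro!: cos_ge_zero sin_ge_zero)
    moreover have "1 ^ 2 \<le> (cos \<beta> + sin \<beta>) ^ 2"
      using calculation by (simp add: power2_sum)
    ultimately show ?thesis using power2_le_imp_le[of 1 "cos \<beta> + sin \<beta>"] by simp
  qed
  have kernel_diag: "norm (aux_kernel s (Complex v (- v))) * norm (sin_denom (Complex v (- v)))
      = (sqrt 2 * v) powr a * exp (2 * pi * N ^ 2 * (c * (pi / 4))) * exp (2 * pi * v ^ 2)" if "v > 0" for v
  proof -
    have "norm (Complex v (- v)) = sqrt 2 * v"
      using that by (simp add: complex_norm real_sqrt_mult flip: mult_2)
    moreover have "Arg (Complex v (- v)) = - (pi / 4)"
      using that by (simp add: arg_conv_arctan arctan_minus arctan_one)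
    moreover have "norm (sin_denom (Complex v (- v))) \<noteq> 0"
      using that sin_denom_nonzero[of "Complex v (- v)"] by simp
    ultimately show ?thesis
      unfolding norm_aux_kernel by (simp add: polar a_def S_def c_def power2_eq_square mult_ac)
  qed
  obtain w where w: "0 \<le> w" "w \<le> 1" "x = (1 - w) *\<^sub>R Complex (1 / 4) (- 1 / 4) + w *\<^sub>R A"
    using x by (auto simp: closed_segment_def)
  define v where "v = (1 - w) * (1 / 4) + w * (X / 2)"
  have xv: "x = Complex v (- v)" by (simp add: w(3) v_def A X_def complex_eq_iff field_simps)
  have v_ge: "d / 4 \<le> v"
  proof -
    have "(1 - w) * (d / 4) + w * (d / 4) \<le> (1 - w) * (1 / 4) + w * (X / 2)"
      using w d dX by (intro add_mono mult_left_mono) auto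
    moreover have "(1 - w) * (d / 4) + w * (d / 4) = d / 4" by (simp add: field_simps)
    ultimately show ?thesis by (simp only: v_def)
  qed
  then have v0: "v > 0" using d by linarith
  \<comment> \<open>For small \<open>d\<close> and moderate \<open>N\<close> the point
    \<open>A\<close> may be closer to 0 than the start of the segment, so either end can be the
    outer one.\<close>
  have vmax: "v \<le> X / 2 \<or> v \<le> 1 / 4"
  proof (cases "X / 2 \<le> 1 / 4")
    case True
    then have "w * (X / 2) \<le> w * (1 / 4)" using w by (intro mult_left_mono) auto
    then have "v \<le> (1 - w) * (1 / 4) + w * (1 / 4)" by (simp only: v_def add_left_mono)
    then show ?thesis by (simp add: field_simps)
  next
    case False
    then have "(1 - w) * (1 / 4) \<le> (1 - w) * (X / 2)" using w by (intro mult_left_mono) auto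
    then have "v \<le> (1 - w) * (X / 2) + w * (X / 2)" by (simp only: v_def add_right_mono)
    then show ?thesis by (simp add: field_simps)
  qed
  have denom: "d \<le> norm (sin_denom x)"
  proof -
    have "d \<le> 4 * v" using v_ge by simp
    also have "\<dots> \<le> 2 * pi * v" using v0 pi_ge_two by (intro mult_right_mono) auto
    finally show ?thesis using norm_sin_denom_ge_Im[of x] v0 by (simp add: xv)
  qed
  define E1 where "E1 = exp (2 * pi * N ^ 2 * (S * (ln N - 1 / 2) + c * (pi / 2 + \<beta>)) - pi * N ^ 2 / 2)"
  define E2 where "E2 = exp (pi / 8) * exp (2 * pi * N ^ 2 * (S * (ln N - 1 / 2) + c * (pi / 4)))"
  have "norm (aux_kernel s x) * norm (sin_denom x) \<le> E1 + E2"
    using vmax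
  proof
    assume v: "v \<le> X / 2"
    \<comment> \<open>Distance from \<open>\<xi>\<close> to \<open>A\<close>, the foot of the
      perpendicular from 0 to the line through \<open>\<xi>\<close>.\<close>
    define \<rho> where "\<rho> = N * (cos \<beta> + sin \<beta>) / sqrt 2"
    have X0: "X / 2 > 0" using dX d by simp
    have A\<rho>: "A = \<xi> + of_real \<rho> * cis (pi / 4)"
      by (simp add: complex_eq_iff A polar \<rho>_def cos_45 sin_45 field_simps)
    have A_eq: "A = Complex (X / 2) (- (X / 2))" by (simp add: A X_def field_simps)
    have A0: "A \<noteq> 0" using X0 by (auto simp: A X_def complex_eq_iff)
    have \<xi>0: "\<xi> \<noteq> 0" using polar(1) N0 by auto
    have "(sqrt 2 * v) powr a * exp (2 * pi * N ^ 2 * (c * (pi / 4))) * exp (2 * pi * v ^ 2)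
      \<le> (sqrt 2 * (X / 2)) powr a * exp (2 * pi * N ^ 2 * (c * (pi / 4))) * exp (2 * pi * (X / 2) ^ 2)"
    proof (intro mult_mono)
      show "(sqrt 2 * v) powr a \<le> (sqrt 2 * (X / 2)) powr a"
        using v v0 a0 by (intro powr_mono2) auto
      have "v ^ 2 \<le> (X / 2) ^ 2" using v v0 by (intro power_mono) auto
      then show "exp (2 * pi * v ^ 2) \<le> exp (2 * pi * (X / 2) ^ 2)" by simp
    qed auto
    also have "\<dots> = norm (aux_kernel s A) * norm (sin_denom A)"
      unfolding A_eq kernel_diag[OF X0] ..
    also have "\<dots> = norm (\<xi> powr (- s) * exp (of_real pi * \<i> * \<xi> ^ 2)) * norm (exp (saddle_phase \<xi> A))"
    proof -
      have "sin_denom A \<noteq> 0"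
        using X0 by (intro sin_denom_nonzero) (auto simp: A X_def)
      then show ?thesis
        unfolding aux_kernel_eq_saddle_phase[OF A0 \<xi>0 s] by (simp add: norm_mult norm_divide)
    qed
    also have "\<dots> = exp (2 * pi * N ^ 2 * (S * (ln N - 1 / 2) + c * (pi / 2 + \<beta>))) * exp (Re (saddle_phase \<xi> A))"
      unfolding polar(7) by (simp add: S_def c_def)
    also have "\<dots> \<le> exp (2 * pi * N ^ 2 * (S * (ln N - 1 / 2) + c * (pi / 2 + \<beta>))) * exp (- (pi * N ^ 2 / 2))"
    proof -
      have "Re (saddle_phase \<xi> A) \<le> - (pi * \<rho> ^ 2)"
        unfolding A\<rho>
      proof (rule Re_saddle_phase_le)
        show "Im \<xi> < 0" using \<beta> N0 by (simp add: polar cos_gt_zero_pi)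
        show "Im (\<xi> + of_real \<rho> * cis (pi / 4)) < 0"
          unfolding A\<rho>[symmetric] using X0 by (simp add: A X_def)
        have "(cos \<beta> + sin \<beta>) ^ 2 \<le> 2"
        proof -
          have "2 * sin \<beta> * cos \<beta> \<le> 1" using sin_le_one[of "2 * \<beta>"] unfolding sin_double .
          moreover have "(cos \<beta> + sin \<beta>) ^ 2 = 1 + 2 * sin \<beta> * cos \<beta>" by (simp add: power2_sum)
          ultimately show ?thesis by linarith
        qed
        then have "N ^ 2 / sqrt 2 * (cos \<beta> + sin \<beta>) ^ 2 \<le> N ^ 2 / sqrt 2 * 2"
          by (intro mult_left_mono) auto
        moreover have "\<rho> * (Re \<xi> + Im \<xi>) = - (N ^ 2 / sqrt 2 * (cos \<beta> + sin \<beta>) ^ 2)"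
          by (simp add: \<rho>_def polar power2_eq_square algebra_simps add_divide_distrib)
        moreover have "N ^ 2 / sqrt 2 * 2 = sqrt 2 * N ^ 2" by (simp add: field_simps)
        ultimately show "- sqrt 2 * norm \<xi> ^ 2 \<le> \<rho> * (Re \<xi> + Im \<xi>)" by (simp add: polar)
      qed
      moreover have "N ^ 2 / 2 \<le> \<rho> ^ 2"
      proof -
        have "N ^ 2 * 1 ^ 2 \<le> N ^ 2 * (cos \<beta> + sin \<beta>) ^ 2"
          using cs1 by (intro mult_left_mono power_mono) auto
        then show ?thesis by (simp add: \<rho>_def power_mult_distrib power_divide)
      qed
      then have "pi * (N ^ 2 / 2) \<le> pi * \<rho> ^ 2" by (intro mult_left_mono) auto
      ultimately have "Re (saddle_phase \<xi> A) \<le> - (pi * N ^ 2 / 2)" by linarith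
      then show ?thesis by simp
    qed
    also have "\<dots> = E1" by (simp add: E1_def exp_add[symmetric])
    also have "\<dots> \<le> E1 + E2" by (simp add: E2_def)
    finally show ?thesis unfolding xv kernel_diag[OF v0] .
  next
    assume v: "v \<le> 1 / 4"
    have "sqrt 2 * v \<le> 2 * (1 / 4)"
      using v v0 by (intro mult_mono) (auto intro!: real_le_lsqrt)
    then have p: "(sqrt 2 * v) powr a \<le> 1" using v0 a0 by (intro powr_le1) auto
    have "v ^ 2 \<le> (1 / 4) ^ 2" using v v0 by (intro power_mono) auto
    then have "pi * v ^ 2 \<le> pi * (1 / 4) ^ 2" by (intro mult_left_mono) auto
    then have q: "exp (2 * pi * v ^ 2) \<le> exp (pi / 8)" by (simp add: power_divide)
    have "0 \<le> S * (ln N - 1 / 2)" using S0 N by simp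
    then have "2 * pi * N ^ 2 * (c * (pi / 4)) \<le> 2 * pi * N ^ 2 * (S * (ln N - 1 / 2) + c * (pi / 4))"
      by (intro mult_left_mono) auto
    then have "(sqrt 2 * v) powr a * exp (2 * pi * N ^ 2 * (c * (pi / 4))) * exp (2 * pi * v ^ 2)
      \<le> 1 * exp (2 * pi * N ^ 2 * (S * (ln N - 1 / 2) + c * (pi / 4))) * exp (pi / 8)"
      using p q by (intro mult_mono) auto
    also have "\<dots> = E2" by (simp add: E2_def)
    also have "\<dots> \<le> E1 + E2" by (simp add: E1_def)
    finally show ?thesis unfolding xv kernel_diag[OF v0] .
  qed
  then have "norm (aux_kernel s x) * d \<le> E1 + E2"
    using mult_left_mono[OF denom, of "norm (aux_kernel s x)"] by simp
  then show ?thesis using d by (simp add: E1_def E2_def S_def c_def field_simps)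
qed

lemma norm_Complex_le: "norm (Complex a b) \<le> \<bar>a\<bar> + \<bar>b\<bar>"
  using cmod_le[of "Complex a b"] by simp

lemma exp_1_ge_2: "2 \<le> exp (1::real)"
  using exp_ge_add_one_self[of "1::real"] by simp

text \<open>Weakens a quadratic gain to the form of \<open>subexponential_correction_bound\<close>,
  so that one correction bound serves both signs of \<open>\<beta>\<close>.\<close>

lemma inverse_cube_ln_le:
  assumes "1 \<le> L" "0 \<le> \<kappa>'" "\<kappa>' \<le> \<kappa>"
  shows "\<kappa>' * (N::real) ^ 2 / L ^ 3 \<le> \<kappa> * N ^ 2"
proof -
  have "\<kappa>' * N ^ 2 / L ^ 3 \<le> \<kappa>' * N ^ 2 / 1"
    using assms by (intro divide_left_mono) auto
  also have "\<dots> \<le> \<kappa> * N ^ 2" using assms by (simp add: mult_right_mono)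
  finally show ?thesis .
qed

text \<open>The difference is \<open>sqrt 2 * cos (\<beta> + pi / 4)\<close>, smallest at the
  largest \<open>\<beta>\<close>. Times \<open>N\<close> it is \<open>Re \<xi> - Im \<xi>\<close>,
  which measures how far the line through \<open>\<xi>\<close> stays from 0.\<close>

lemma cos_minus_sin_ge:
  assumes "0 < \<theta>" "\<theta> < pi" "- (pi / 4) \<le> \<beta>" "\<beta> \<le> pi / 4 - \<theta> / 2"
  shows "sin (\<theta> / 2) \<le> cos \<beta> - sin \<beta>"
proof -
  have "cos (pi / 2 - \<theta> / 2) \<le> cos (\<beta> + pi / 4)"
    using assms by (intro cos_monotone_0_pi_le) auto
  also have "cos (\<beta> + pi / 4) = (sqrt 2 / 2) * (cos \<beta> - sin \<beta>)"
    by (simp add: cos_add cos_45 sin_45 algebra_simps)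
  finally have le: "sin (\<theta> / 2) \<le> (sqrt 2 / 2) * (cos \<beta> - sin \<beta>)" by (simp add: cos_diff)
  have "0 < sin (\<theta> / 2)" using assms by (intro sin_gt_zero) auto
  then have "0 < (sqrt 2 / 2) * (cos \<beta> - sin \<beta>)" using le by linarith
  then have "0 < cos \<beta> - sin \<beta>" by (simp add: zero_less_mult_iff)
  then have "(sqrt 2 / 2) * (cos \<beta> - sin \<beta>) \<le> 1 * (cos \<beta> - sin \<beta>)"
    using real_le_lsqrt[of 2 2] by (intro mult_right_mono) auto
  with le show ?thesis by simp
qed

lemma connecting_path_left:
  assumes \<theta>: "0 < \<theta>" "\<theta> < pi / 2" and \<eta>: "0 < \<eta>" "\<eta> \<le> sin (\<theta> / 2) / 2"
  obtains C where "C \<ge> 0"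
    "\<And>N \<beta> \<xi> s. exp 1 \<le> N \<Longrightarrow> 0 \<le> \<beta> \<Longrightarrow> \<beta> \<le> pi / 4 - \<theta> / 2 \<Longrightarrow> \<xi> = rcis N (- pi / 2 - \<beta>) \<Longrightarrow>
       s = 2 * of_real pi * \<i> * \<xi> ^ 2 \<Longrightarrow>
       connecting_path s \<xi> \<eta> C (Complex (1 / 4) (- 1 / 4))
         (Complex ((Re \<xi> - Im \<xi>) / 2) (- (Re \<xi> - Im \<xi>) / 2))"
proof -
  define d where "d = sin (\<theta> / 2)"
  have d: "0 < d" "d \<le> 1" using \<theta> by (auto simp: d_def intro!: sin_gt_zero)
  define \<kappa>1 where "\<kappa>1 = 1 - cos \<theta>"
  have \<kappa>1: "0 < \<kappa>1" using \<theta> cos_monotone_0_pi[of 0 \<theta>] by (simp add: \<kappa>1_def)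
  define I where "I = (LINT t|lborel. exp (- (pi * \<kappa>1) * (t - 0) ^ 2))"
  have I0: "0 \<le> I" unfolding I_def by (rule integral_nonneg_AE) auto
  \<comment> \<open>The first entry is the gain in the argument,
    \<open>2 * pi * cos (2 * \<beta>) * (pi / 4 + \<beta>)\<close>, with
    \<open>cos (2 * \<beta>) \<ge> sin \<theta>\<close>; the second is the drop from the saddle to
    \<open>A\<close>.\<close>
  define \<kappa> where "\<kappa> = min (pi ^ 2 * sin \<theta> / 2) (pi / 2)"
  have \<kappa>: "0 < \<kappa>" "\<kappa> \<le> pi ^ 2 * sin \<theta> / 2" "\<kappa> \<le> pi / 2"
  proof -
    have "0 < sin \<theta>" using \<theta> by (intro sin_gt_zero) auto
    then have "0 < pi ^ 2 * sin \<theta>" by (intro mult_pos_pos) auto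
    then show "0 < \<kappa>" by (simp add: \<kappa>_def)
  qed (simp_all add: \<kappa>_def)
  obtain C0 where C0: "C0 \<ge> 0"
    "\<And>N. exp 1 \<le> N \<Longrightarrow> N ^ 3 * exp (pi * N - \<kappa> * N ^ 2 / ln N ^ 3) \<le> C0 / N"
    using subexponential_correction_bound[OF \<kappa>(1)] by blast
  define K1 where "K1 = 1 / d * (2 + 2 * exp (pi / 8)) * 2"
  define K2 where "K2 = 4 * exp (pi / 4) * I"
  have K: "0 \<le> K1" "0 \<le> K2" using d I0 by (simp_all add: K1_def K2_def)
  show ?thesis
  proof (rule that[of "(K1 + K2) * C0"])
    show "(K1 + K2) * C0 \<ge> 0" using K C0 by simp
    fix N \<beta> :: real and \<xi> s :: complex
    assume N: "exp 1 \<le> N" and \<beta>: "0 \<le> \<beta>" "\<beta> \<le> pi / 4 - \<theta> / 2" and \<xi>: "\<xi> = rcis N (- pi / 2 - \<beta>)"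
      and s: "s = 2 * of_real pi * \<i> * \<xi> ^ 2"
    define A where "A = Complex ((Re \<xi> - Im \<xi>) / 2) (- (Re \<xi> - Im \<xi>) / 2)"
    have N2: "2 \<le> N" using N exp_1_ge_2 by linarith
    then have N0: "N > 0" "1 < N" by auto
    have L: "1 \<le> ln N" using ln_ge_iff[OF N0(1), of 1] N by simp
    have \<beta>4: "\<beta> < pi / 4" "\<bar>\<beta>\<bar> < pi / 4" using \<beta> \<theta> by auto
    note polar = polar_saddle[OF N0(1) \<beta>4(2) \<xi> s]
    have cs: "0 \<le> cos \<beta>" "0 \<le> sin \<beta>" using \<beta> \<beta>4 by (auto intro!: cos_ge_zero sin_ge_zero)
    have d\<beta>: "d \<le> cos \<beta> - sin \<beta>" unfolding d_def using \<beta> \<theta> by (intro cos_minus_sin_ge) auto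
    define S where "S = sin (2 * \<beta>)"
    define c where "c = cos (2 * \<beta>)"
    define E where "E = exp (pi * N - \<kappa> * N ^ 2 / ln N ^ 3)"
    have "S \<le> sin (pi / 2 - \<theta>)" unfolding S_def using \<beta> \<theta> by (intro sin_monotone_2pi_le) auto
    then have S: "\<kappa>1 \<le> 1 - S" by (simp add: \<kappa>1_def sin_diff)
    have "cos (pi / 2 - \<theta>) \<le> c" unfolding c_def using \<beta> \<theta> by (intro cos_monotone_0_pi_le) auto
    then have c: "sin \<theta> \<le> c" by (simp add: cos_diff)
    have "0 < sin \<theta>" using \<theta> by (intro sin_gt_zero) auto
    then have c0: "0 < c" using c by linarith
    define T where "T = norm (main_term s \<xi>)"
    have T0: "0 \<le> T" by (simp add: T_def)
    \<comment> \<open>Undoing the factor \<open>exp (- pi * N * cos \<beta>)\<close> of the main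
      term costs \<open>exp (pi * N)\<close>, which is the linear term in \<open>E\<close>.\<close>
    have T: "exp (2 * pi * N ^ 2 * (S * (ln N - 1 / 2) + c * (pi / 2 + \<beta>))) \<le> 2 * T * exp (pi * N)"
    proof -
      have "exp (2 * pi * N ^ 2 * (S * (ln N - 1 / 2) + c * (pi / 2 + \<beta>))) = sqrt 2 * T * exp (pi * N * cos \<beta>)"
        unfolding T_def polar(8) by (simp add: S_def c_def exp_add[symmetric])
      also have "\<dots> \<le> 2 * T * exp (pi * N)"
      proof (intro mult_mono)
        show "sqrt 2 \<le> 2" using real_le_lsqrt[of 2 2] by simp
        have "pi * N * cos \<beta> \<le> pi * N * 1" using N0 by (intro mult_left_mono) auto
        then show "exp (pi * N * cos \<beta>) \<le> exp (pi * N)" by simp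
      qed (use T0 in auto)
      finally show ?thesis .
    qed
    have rel: "exp (2 * pi * N ^ 2 * (S * (ln N - 1 / 2) + c * (pi / 2 + \<beta>)) - y) \<le> 2 * T * E"
      if "\<kappa> * N ^ 2 / ln N ^ 3 \<le> y" for y
    proof -
      have "exp (2 * pi * N ^ 2 * (S * (ln N - 1 / 2) + c * (pi / 2 + \<beta>)) - y)
          = exp (2 * pi * N ^ 2 * (S * (ln N - 1 / 2) + c * (pi / 2 + \<beta>))) * exp (- y)"
        by (simp add: exp_add[symmetric])
      also have "\<dots> \<le> (2 * T * exp (pi * N)) * exp (- (\<kappa> * N ^ 2 / ln N ^ 3))"
        using T that T0 by (intro mult_mono) auto
      also have "\<dots> = 2 * T * E" by (simp add: E_def exp_add[symmetric])
      finally show ?thesis .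
    qed
    have rel1: "exp (2 * pi * N ^ 2 * (S * (ln N - 1 / 2) + c * (pi / 2 + \<beta>)) - pi * N ^ 2 / 2) \<le> 2 * T * E"
      using inverse_cube_ln_le[OF L less_imp_le[OF \<kappa>(1)] \<kappa>(3), of N] by (intro rel) simp
    have rel2: "exp (2 * pi * N ^ 2 * (S * (ln N - 1 / 2) + c * (pi / 4))) \<le> 2 * T * E"
    proof -
      have "pi ^ 2 * sin \<theta> / 2 * N ^ 2 = 2 * pi * N ^ 2 * (sin \<theta> * (pi / 4))"
        by (simp add: power2_eq_square)
      also have "\<dots> \<le> 2 * pi * N ^ 2 * (c * (pi / 4 + \<beta>))"
        using c c0 \<beta> by (intro mult_left_mono mult_mono) auto
      finally have "\<kappa> * N ^ 2 / ln N ^ 3 \<le> 2 * pi * N ^ 2 * (c * (pi / 4 + \<beta>))"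
        using inverse_cube_ln_le[OF L less_imp_le[OF \<kappa>(1)] \<kappa>(2), of N] by linarith
      from rel[OF this] show ?thesis by (simp add: algebra_simps)
    qed
    have E0: "0 \<le> E" by (simp add: E_def)
    have E: "N ^ 3 * E \<le> C0 / N" unfolding E_def by (rule C0(2)[OF N])
    have X: "Re \<xi> - Im \<xi> = N * (cos \<beta> - sin \<beta>)" by (simp add: polar algebra_simps)
    have X_ge: "d * N \<le> Re \<xi> - Im \<xi>" using d\<beta> N0 unfolding X by (simp add: mult.commute)
    have X_le: "Re \<xi> - Im \<xi> \<le> N"
    proof -
      have "cos \<beta> - sin \<beta> \<le> 1" using cos_le_one[of \<beta>] cs by linarith
      then have "N * (cos \<beta> - sin \<beta>) \<le> N * 1" using N0 by (intro mult_left_mono) auto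
      then show ?thesis by (simp add: X)
    qed
    have dN: "d \<le> d * N" using d N0 by simp
    have X0: "0 < Re \<xi> - Im \<xi>" using X_ge dN d by linarith
    have imA: "Im A < 0" using X0 by (simp add: A_def)
    define \<rho> where "\<rho> = N * (cos \<beta> + sin \<beta>) / sqrt 2"
    have A\<rho>: "A = \<xi> + of_real \<rho> * cis (pi / 4)"
      by (simp add: complex_eq_iff A_def polar \<rho>_def cos_45 sin_45 field_simps)
    have cs1: "1 \<le> cos \<beta> + sin \<beta>"
    proof -
      have "1 ^ 2 \<le> (cos \<beta> + sin \<beta>) ^ 2" using cs by (simp add: power2_sum)
      then show ?thesis using power2_le_imp_le[of 1 "cos \<beta> + sin \<beta>"] cs by simp
    qed
    have \<rho>1: "norm \<xi> / 2 \<le> \<rho>"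
    proof -
      have "sqrt 2 \<le> 2" using real_le_lsqrt[of 2 2] by simp
      then have "N / 2 \<le> N / sqrt 2" using N0 by (intro divide_left_mono) auto
      then have "N / 2 \<le> N * 1 / sqrt 2" by simp
      also have "\<dots> \<le> \<rho>" unfolding \<rho>_def using cs1 N0 by (intro divide_right_mono mult_left_mono) auto
      finally show ?thesis by (simp add: polar)
    qed
    have \<rho>2: "- (sqrt 2) * norm \<xi> ^ 2 \<le> \<rho> * (Re \<xi> + Im \<xi>)"
    proof -
      have "(cos \<beta> + sin \<beta>) ^ 2 \<le> 2"
      proof -
        have "2 * sin \<beta> * cos \<beta> \<le> 1" using sin_le_one[of "2 * \<beta>"] unfolding sin_double .
        moreover have "(cos \<beta> + sin \<beta>) ^ 2 = 1 + 2 * sin \<beta> * cos \<beta>" by (simp add: power2_sum)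
        ultimately show ?thesis by linarith
      qed
      then have "N ^ 2 / sqrt 2 * (cos \<beta> + sin \<beta>) ^ 2 \<le> N ^ 2 / sqrt 2 * 2"
        by (intro mult_left_mono) auto
      moreover have "\<rho> * (Re \<xi> + Im \<xi>) = - (N ^ 2 / sqrt 2 * (cos \<beta> + sin \<beta>) ^ 2)"
        by (simp add: \<rho>_def polar power2_eq_square algebra_simps add_divide_distrib)
      moreover have "N ^ 2 / sqrt 2 * 2 = sqrt 2 * N ^ 2" by (simp add: field_simps)
      ultimately show ?thesis by (simp add: polar)
    qed
    have imA2: "Im A \<le> - \<eta> / norm \<xi> ^ 2"
    proof -
      have "\<eta> / N ^ 2 \<le> \<eta> / 1" using \<eta> N0 by (intro divide_left_mono) auto
      also have "\<eta> / 1 \<le> d / 2" using \<eta> by (simp add: d_def)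
      also have "\<dots> \<le> (Re \<xi> - Im \<xi>) / 2" using X_ge dN by simp
      finally show ?thesis by (simp add: A_def polar)
    qed
    have ray: "norm (ray_integral (aux_kernel s) (Complex (1 / 4) (- 1 / 4)) (cis (pi / 4)))
        \<le> K2 * C0 / N * T"
    proof -
      have "norm (ray_integral (aux_kernel s) (Complex (1 / 4) (- 1 / 4)) (cis (pi / 4)))
          \<le> 2 * exp (pi / 4) * exp (2 * pi * N ^ 2 * (S * (ln N - 1 / 2) + c * (pi / 4))) * I"
        unfolding I_def S_def c_def
        by (rule upper_ray_bound_left[OF N0(2) \<beta>(1) \<beta>4(1) \<xi> s \<kappa>1]) (use S in \<open>simp add: S_def\<close>)
      also have "\<dots> \<le> 2 * exp (pi / 4) * (2 * T * E) * I"
        using rel2 I0 by (intro mult_right_mono mult_left_mono) auto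
      also have "\<dots> = K2 * T * (1 * E)" by (simp add: K2_def)
      also have "\<dots> \<le> K2 * T * (N ^ 3 * E)"
        using K T0 N0 E0 by (intro mult_left_mono mult_right_mono) auto
      also have "\<dots> \<le> K2 * T * (C0 / N)" using K T0 E by (intro mult_left_mono) auto
      finally show ?thesis by (simp add: mult_ac)
    qed
    have seg: "norm (contour_integral (linepath (Complex (1 / 4) (- 1 / 4)) A) (aux_kernel s)) \<le> K1 * C0 / N * T"
    proof -
      have nAP: "norm (A - Complex (1 / 4) (- 1 / 4)) \<le> 2 * N"
      proof -
        have "norm A \<le> N" using norm_Complex_le[of "(Re \<xi> - Im \<xi>) / 2" "- (Re \<xi> - Im \<xi>) / 2"] X_le X0
          by (simp add: A_def)
        moreover have "norm (Complex (1 / 4) (- 1 / 4)) \<le> 1 / 2" using norm_Complex_le[of "1 / 4" "- 1 / 4"] by simp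
        ultimately show ?thesis using N2 norm_triangle_ineq4[of A "Complex (1 / 4) (- 1 / 4)"] by linarith
      qed
      define B where "B = 1 / d * (2 * T * E + exp (pi / 8) * (2 * T * E))"
      have B0: "0 \<le> B" using d T0 E0 by (simp add: B_def)
      have "norm (contour_integral (linepath (Complex (1 / 4) (- 1 / 4)) A) (aux_kernel s))
          \<le> B * norm (A - Complex (1 / 4) (- 1 / 4))"
      proof (rule aux_kernel_segment_bound[OF _ imA B0])
        fix x assume x: "x \<in> closed_segment (Complex (1 / 4) (- 1 / 4)) A"
        have "norm (aux_kernel s x) \<le> 1 / d *
           (exp (2 * pi * N ^ 2 * (S * (ln N - 1 / 2) + c * (pi / 2 + \<beta>)) - pi * N ^ 2 / 2)
            + exp (pi / 8) * exp (2 * pi * N ^ 2 * (S * (ln N - 1 / 2) + c * (pi / 4))))"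
          unfolding S_def c_def
          by (rule diagonal_segment_bound_left[OF N0(2) L \<beta>(1) \<beta>4(1) \<xi> s d d\<beta> A_def x])
        also have "\<dots> \<le> B"
          unfolding B_def using rel1 rel2 d by (intro mult_left_mono add_mono) auto
        finally show "norm (aux_kernel s x) \<le> B" .
      qed simp
      also have "\<dots> \<le> B * (2 * N)" using nAP B0 by (rule mult_left_mono)
      also have "\<dots> = K1 * T * (N ^ 1 * E)" by (simp add: B_def K1_def algebra_simps)
      also have "\<dots> \<le> K1 * T * (N ^ 3 * E)"
        using K T0 N0 E0 by (intro mult_left_mono mult_right_mono power_increasing) auto
      also have "\<dots> \<le> K1 * T * (C0 / N)" using K T0 E by (intro mult_left_mono) auto
      finally show ?thesis by (simp add: mult_ac)
    qed
    have mono: "K1 * C0 / N * T \<le> (K1 + K2) * C0 / N * T" "K2 * C0 / N * T \<le> (K1 + K2) * C0 / N * T"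
      using K C0(1) N0 T0 by (auto intro!: mult_right_mono divide_right_mono)
    show "connecting_path s \<xi> \<eta> ((K1 + K2) * C0) (Complex (1 / 4) (- 1 / 4))
         (Complex ((Re \<xi> - Im \<xi>) / 2) (- (Re \<xi> - Im \<xi>) / 2))"
      unfolding connecting_path_def A_def[symmetric]
      using A\<rho> \<rho>1 \<rho>2 imA2 order_trans[OF seg mono(1)] order_trans[OF ray mono(2)]
      by (auto simp: T_def polar(1))
  qed
qed

section \<open>The connecting path for \<open>Re s > 0\<close>\<close>

text \<open>The rewriting as \<open>E\<close> isolates the slack of \<open>le\<close>. For
  \<open>b \<le> 1 / (2 * L)\<close> this slack is already at least 1/4; for larger \<open>b\<close>
  the cubic bound gives \<open>b ^ 3 / 12 \<ge> 1 / (96 * L ^ 3)\<close>.\<close>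

lemma saddle_exponent_lower_bound:
  fixes b L :: real
  assumes b: "0 < b" "b \<le> pi / 2" and L: "1 \<le> L" and le: "sin b * L \<le> cos b * (pi / 2)"
  shows "1 / (96 * L ^ 3) \<le> - sin b * (L - 1 / 2) + cos b * (pi / 2 - b / 2)"
proof -
  define E where "E = (sin b - b * cos b) / 2 + (cos b * (pi / 2) - sin b * L)"
  have eq: "- sin b * (L - 1 / 2) + cos b * (pi / 2 - b / 2) = E" by (simp add: E_def field_simps)
  have cube: "b ^ 3 / 6 \<le> sin b - b * cos b" using b by (intro sin_minus_mult_cos_ge_cube) auto
  have L3: "1 \<le> L ^ 3" using L by simp
  show ?thesis
  proof (cases "b \<le> 1 / (2 * L)")
    case True
    then have bL: "b * L \<le> 1 / 2" using L by (simp add: field_simps)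
    have "b * 1 \<le> b * L" using b L by (intro mult_left_mono) auto
    then have "b \<le> pi / 3" using bL pi_gt3 by linarith
    then have "cos (pi / 3) \<le> cos b" using b by (intro cos_monotone_0_pi_le) auto
    then have c: "1 / 2 \<le> cos b" by (simp add: cos_60)
    have "sin b * L \<le> b * L" using b L sin_x_le_x[of b] by (intro mult_right_mono) auto
    moreover have "1 / 2 * (3 / 2) \<le> cos b * (pi / 2)" using c pi_gt3 by (intro mult_mono) auto
    moreover have "0 \<le> b ^ 3" using b by simp
    then have "0 \<le> sin b - b * cos b" using cube by linarith
    moreover have "1 / 4 \<le> D / 2 + (Q - R)" if "R \<le> r" "1 / 2 * (3 / 2) \<le> Q" "0 \<le> D" "r \<le> 1 / 2" for D Q R r :: real
      using that by simp
    ultimately have "1 / 4 \<le> E" using bL unfolding E_def by blast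
    moreover have "1 / (96 * L ^ 3) \<le> 1 / 4" using L3 by (intro frac_le) auto
    ultimately show ?thesis unfolding eq by linarith
  next
    case False
    then have "(1 / (2 * L)) ^ 3 \<le> b ^ 3" using L by (intro power_mono) auto
    then have "1 / (8 * L ^ 3) \<le> b ^ 3" by (simp add: power_divide power_mult_distrib)
    moreover have "1 / (96 * L ^ 3) = 1 / (8 * L ^ 3) / 12" by simp
    ultimately have "1 / (96 * L ^ 3) \<le> b ^ 3 / 12" by linarith
    moreover have "x \<le> D / 2 + (Q - R)" if "x \<le> c / 12" "c / 6 \<le> D" "R \<le> Q" for x c D Q R :: real
      using that by simp
    ultimately show ?thesis unfolding eq E_def using cube le by blast
  qed
qed

text \<open>Here \<open>ln (norm x) \<ge> - 4 * \<delta>\<close> and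
  \<open>Arg x \<ge> - 2 * \<delta>\<close>, while both parts of \<open>s\<close> are at most
  \<open>1 / \<delta>\<close> in absolute value; the exponents 4 and 2 add up to 6.\<close>

lemma unit_corner_powr_bound:
  assumes \<delta>: "0 < \<delta>" "\<delta> \<le> 1 / 4" and x: "1 - 2 * \<delta> \<le> Re x" "- \<delta> \<le> Im x"
    and s: "0 \<le> Re s" "Re s \<le> 1 / \<delta>" "Im s \<le> 0" "- Im s \<le> 1 / \<delta>"
  shows "norm x powr (- Re s) * exp (Im s * Arg x) \<le> exp 6"
proof -
  have re: "1 / 2 \<le> Re x" using x \<delta> by linarith
  have nx: "1 - 2 * \<delta> \<le> norm x" using x abs_Re_le_cmod[of x] by linarith
  then have nx0: "0 < norm x" using \<delta> by linarith
  have "- 4 * \<delta> \<le> ln (norm x)"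
  proof -
    have "ln (1 / (1 - 2 * \<delta>)) \<le> 1 / (1 - 2 * \<delta>) - 1" using \<delta> by (intro ln_le_minus_one) auto
    also have "\<dots> \<le> 4 * \<delta>" using \<delta> by (simp add: field_simps)
    finally have "- 4 * \<delta> \<le> ln (1 - 2 * \<delta>)" using \<delta> by (simp add: ln_div)
    also have "\<dots> \<le> ln (norm x)" using nx \<delta> by (intro ln_mono) auto
    finally show ?thesis .
  qed
  then have "Re s * (- 4 * \<delta>) \<le> Re s * ln (norm x)" using s by (intro mult_left_mono) auto
  moreover have "Re s * \<delta> \<le> 1" using s \<delta> by (simp add: field_simps)
  ultimately have "- Re s * ln (norm x) \<le> 4" by (simp add: mult_ac)
  then have p: "norm x powr (- Re s) \<le> exp 4" using nx0 by (simp add: powr_def)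
  have arg: "- (2 * \<delta>) \<le> Arg x"
  proof (cases "Im x \<ge> 0")
    case True
    then have "0 \<le> Arg x" by (simp add: Arg_less_0)
    then show ?thesis using \<delta> by linarith
  next
    case False
    have "arctan (- Im x / Re x) \<le> - Im x / Re x" using False re by (intro arctan_le_self divide_nonneg_pos) auto
    also have "\<dots> \<le> \<delta> / (1 / 2)" using x re \<delta> by (intro frac_le) auto
    finally have "arctan (- (Im x / Re x)) \<le> 2 * \<delta>" by simp
    then show ?thesis using re by (simp add: arg_conv_arctan arctan_minus)
  qed
  have "(- Im s) * (- Arg x) \<le> (- Im s) * (2 * \<delta>)" using arg s by (intro mult_left_mono) auto
  moreover have "(- Im s) * \<delta> \<le> 1" using s(4) \<delta> by (simp add: field_simps)
  ultimately have "Im s * Arg x \<le> 2" by simp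
  then have "norm x powr (- Re s) * exp (Im s * Arg x) \<le> exp 4 * exp 2"
    using p by (intro mult_mono) auto
  also have "\<dots> = exp 6" by (simp add: exp_add[symmetric])
  finally show ?thesis .
qed

text \<open>The offset \<open>1 / (2 * pi * N ^ 2)\<close> is \<open>1 / norm s\<close>: small
  enough for \<open>x powr (- s)\<close> to stay bounded, while the denominator costs only a power
  of \<open>N\<close>. The growth of the main term, though subexponential in \<open>N ^ 2\<close>,
  absorbs such powers.\<close>

lemma connecting_path_right:
  assumes \<eta>: "0 < \<eta>" "\<eta> \<le> 1 / (2 * pi)"
  obtains C where "C \<ge> 0"
    "\<And>N \<beta> \<xi> s. exp 1 \<le> N \<Longrightarrow> - (pi / 4) < \<beta> \<Longrightarrow> \<beta> < 0 \<Longrightarrow>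
       - sin (2 * \<beta>) * ln N \<le> cos (2 * \<beta>) * (pi / 2) \<Longrightarrow> \<xi> = rcis N (- pi / 2 - \<beta>) \<Longrightarrow>
       s = 2 * of_real pi * \<i> * \<xi> ^ 2 \<Longrightarrow>
       connecting_path s \<xi> \<eta> C (Complex (1 - 2 * (1 / (2 * pi * N ^ 2))) (- (1 / (2 * pi * N ^ 2))))
         (Complex (Re \<xi> - Im \<xi> - 1 / (2 * pi * N ^ 2)) (- (1 / (2 * pi * N ^ 2))))"
proof -
  \<comment> \<open>The factor 96 comes from \<open>saddle_exponent_lower_bound\<close>, and
    \<open>2 * pi\<close> from the exponent of the main term.\<close>
  define \<kappa> where "\<kappa> = 2 * pi / 96"
  have \<kappa>: "0 < \<kappa>" by (simp add: \<kappa>_def)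
  obtain C0 where C0: "C0 \<ge> 0"
    "\<And>N. exp 1 \<le> N \<Longrightarrow> N ^ 3 * exp (pi * N - \<kappa> * N ^ 2 / ln N ^ 3) \<le> C0 / N"
    using subexponential_correction_bound[OF \<kappa>(1)] by blast
  define I where "I = (LINT t|lborel. exp (- (pi / 2) * ((t::real) - 0) ^ 2))"
  have I0: "0 \<le> I" unfolding I_def by (rule integral_nonneg_AE) auto
  define K1 where "K1 = 2 * (2 * pi) * exp 7 * 3"
  define K2 where "K2 = 2 * (2 * pi) * exp (6 + pi) * I"
  have K: "0 \<le> K1" "0 \<le> K2" using I0 by (simp_all add: K1_def K2_def)
  show ?thesis
  proof (rule that[of "(K1 + K2) * C0"])
    show "(K1 + K2) * C0 \<ge> 0" using K C0 by simp
    fix N \<beta> :: real and \<xi> s :: complex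
    assume N: "exp 1 \<le> N" and \<beta>: "- (pi / 4) < \<beta>" "\<beta> < 0"
      and tan: "- sin (2 * \<beta>) * ln N \<le> cos (2 * \<beta>) * (pi / 2)"
      and \<xi>: "\<xi> = rcis N (- pi / 2 - \<beta>)" and s: "s = 2 * of_real pi * \<i> * \<xi> ^ 2"
    define \<delta> where "\<delta> = 1 / (2 * pi * N ^ 2)"
    \<comment> \<open>\<open>Re P - Im P = 1 - \<delta>\<close>, so the ray from \<open>P\<close>
      keeps a margin \<open>\<delta>\<close> inside the pole-free strip. \<open>A\<close> has the
      same imaginary part, so the segment is horizontal and passes below the poles.\<close>
    define P where "P = Complex (1 - 2 * \<delta>) (- \<delta>)"
    define A where "A = Complex (Re \<xi> - Im \<xi> - \<delta>) (- \<delta>)"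
    have N2: "2 \<le> N" using N exp_1_ge_2 by linarith
    then have N0: "N > 0" "1 < N" by auto
    have L: "1 \<le> ln N" using ln_ge_iff[OF N0(1), of 1] N by simp
    have \<beta>4: "\<bar>\<beta>\<bar> < pi / 4" using \<beta> by auto
    note polar = polar_saddle[OF N0(1) \<beta>4 \<xi> s]
    have \<delta>0: "0 < \<delta>" using N0 by (simp add: \<delta>_def)
    have "4 * 1 \<le> 2 * pi * N ^ 2"
    proof -
      have "1 \<le> N ^ 2" using N2 by simp
      moreover have "4 \<le> 2 * pi" using pi_ge_two by simp
      ultimately show ?thesis by (intro mult_mono) auto
    qed
    then have \<delta>1: "\<delta> \<le> 1 / 4" unfolding \<delta>_def by (intro divide_left_mono) auto
    have cb: "sqrt 2 / 2 \<le> cos \<beta>"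
    proof -
      have "cos (pi / 4) \<le> cos \<bar>\<beta>\<bar>" using \<beta>4 by (intro cos_monotone_0_pi_le) auto
      then show ?thesis by (simp add: cos_45)
    qed
    then have cb0: "0 \<le> cos \<beta>" by (rule order_trans[rotated]) simp
    have sb: "sin \<beta> \<le> 0" using \<beta> sin_ge_zero[of "- \<beta>"] by simp
    have sb2: "- cos \<beta> \<le> sin \<beta>"
    proof -
      have "cos (\<beta> - pi / 4) \<ge> 0" using \<beta> by (intro cos_ge_zero) auto
      then have "0 \<le> (sqrt 2 / 2) * (cos \<beta> + sin \<beta>)"
        by (simp add: cos_diff cos_45 sin_45 algebra_simps)
      then show ?thesis by (simp add: zero_le_mult_iff)
    qed
    have S0: "sin (2 * \<beta>) \<le> 0" using \<beta> sin_ge_zero[of "- (2 * \<beta>)"] by simp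
    have c0: "0 \<le> cos (2 * \<beta>)" using \<beta> by (intro cos_ge_zero) auto
    have res: "0 \<le> Re s" "Re s \<le> 1 / \<delta>" "Im s \<le> 0" "- Im s \<le> 1 / \<delta>"
    proof -
      have "0 \<le> (2 * pi * N ^ 2) * - sin (2 * \<beta>)" "0 \<le> (2 * pi * N ^ 2) * cos (2 * \<beta>)"
        using S0 c0 by (intro mult_nonneg_nonneg; simp)+
      moreover have "(2 * pi * N ^ 2) * - sin (2 * \<beta>) \<le> (2 * pi * N ^ 2) * 1"
        "(2 * pi * N ^ 2) * cos (2 * \<beta>) \<le> (2 * pi * N ^ 2) * 1"
        using sin_ge_minus_one[of "2 * \<beta>"] by (intro mult_left_mono; simp)+
      ultimately show "0 \<le> Re s" "Re s \<le> 1 / \<delta>" "Im s \<le> 0" "- Im s \<le> 1 / \<delta>"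
        by (simp_all add: polar \<delta>_def)
    qed
    define E where "E = exp (pi * N - \<kappa> * N ^ 2 / ln N ^ 3)"
    define T where "T = norm (main_term s \<xi>)"
    have T0: "0 \<le> T" by (simp add: T_def)
    have E0: "0 \<le> E" by (simp add: E_def)
    have E: "N ^ 3 * E \<le> C0 / N" unfolding E_def by (rule C0(2)[OF N])
    \<comment> \<open>The other pieces are bounded by powers of \<open>N\<close> alone, so the main
      term has to be compared with 1.\<close>
    have rel: "1 \<le> 2 * T * E"
    proof -
      define e where "e = sin (2 * \<beta>) * (ln N - 1 / 2) + cos (2 * \<beta>) * (pi / 2 + \<beta>)"
      have "1 / (96 * ln N ^ 3) \<le> - sin (- 2 * \<beta>) * (ln N - 1 / 2) + cos (- 2 * \<beta>) * (pi / 2 - (- 2 * \<beta>) / 2)"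
        by (rule saddle_exponent_lower_bound) (use \<beta> L tan in auto)
      then have "1 / (96 * ln N ^ 3) \<le> e" by (simp add: e_def)
      then have "2 * pi * N ^ 2 * (1 / (96 * ln N ^ 3)) \<le> 2 * pi * N ^ 2 * e" by (intro mult_left_mono) auto
      then have "\<kappa> * N ^ 2 / ln N ^ 3 \<le> 2 * pi * N ^ 2 * e" by (simp add: \<kappa>_def)
      moreover have "pi * N * cos \<beta> \<le> pi * N * 1" using N0 by (intro mult_left_mono) auto
      ultimately have "\<kappa> * N ^ 2 / ln N ^ 3 - pi * N \<le> 2 * pi * N ^ 2 * e - pi * N * cos \<beta>" by linarith
      then have "exp (\<kappa> * N ^ 2 / ln N ^ 3 - pi * N) \<le> exp (2 * pi * N ^ 2 * e - pi * N * cos \<beta>)"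
        by simp
      also have "\<dots> = sqrt 2 * T" unfolding T_def polar(8) e_def by simp
      also have "\<dots> \<le> 2 * T" using T0 real_le_lsqrt[of 2 2] by (intro mult_right_mono) auto
      finally have "exp (\<kappa> * N ^ 2 / ln N ^ 3 - pi * N) * E \<le> 2 * T * E" using E0 by (rule mult_right_mono)
      moreover have "exp (\<kappa> * N ^ 2 / ln N ^ 3 - pi * N) * E = 1" by (simp add: E_def exp_add[symmetric])
      ultimately show ?thesis by simp
    qed
    have X: "Re \<xi> - Im \<xi> = N * (cos \<beta> - sin \<beta>)" by (simp add: polar algebra_simps)
    have X_ge: "1 \<le> Re \<xi> - Im \<xi>"
    proof -
      have "1 \<le> cos \<beta> - sin \<beta>"
      proof -
        have "1 ^ 2 \<le> (cos \<beta> - sin \<beta>) ^ 2"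
          using mult_nonneg_nonpos[OF cb0 sb] by (simp add: power2_diff)
        moreover have "0 \<le> cos \<beta> - sin \<beta>" using cb0 sb by linarith
        ultimately show ?thesis using power2_le_imp_le[of 1 "cos \<beta> - sin \<beta>"] by simp
      qed
      then have "1 * 1 \<le> N * (cos \<beta> - sin \<beta>)" using N0 by (intro mult_mono) auto
      then show ?thesis by (simp add: X)
    qed
    have X_le: "Re \<xi> - Im \<xi> \<le> 2 * N"
    proof -
      have "cos \<beta> - sin \<beta> \<le> 2" using cos_le_one[of \<beta>] sin_ge_minus_one[of \<beta>] by linarith
      then have "N * (cos \<beta> - sin \<beta>) \<le> N * 2" using N0 by (intro mult_left_mono) auto
      then show ?thesis by (simp add: X)
    qed
    \<comment> \<open>The rise from \<open>Im \<xi> = - N * cos \<beta>\<close> to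
      \<open>- \<delta>\<close>, times \<open>sqrt 2\<close> for slope 1.\<close>
    define \<rho> where "\<rho> = sqrt 2 * (N * cos \<beta> - \<delta>)"
    have A\<rho>: "A = \<xi> + of_real \<rho> * cis (pi / 4)"
      by (simp add: complex_eq_iff A_def polar \<rho>_def cos_45 sin_45 field_simps)
    have \<rho>1: "norm \<xi> / 2 \<le> \<rho>"
    proof -
      have "N * (sqrt 2 / 2) \<le> N * cos \<beta>" using cb N0 by (intro mult_left_mono) auto
      then have "sqrt 2 * (N * (sqrt 2 / 2) - 1 / 4) \<le> sqrt 2 * (N * cos \<beta> - \<delta>)"
        using \<delta>1 by (intro mult_left_mono) auto
      moreover have "sqrt 2 * (N * (sqrt 2 / 2) - 1 / 4) = N - sqrt 2 / 4" by (simp add: algebra_simps)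
      moreover have "sqrt 2 \<le> 2" using real_le_lsqrt[of 2 2] by simp
      ultimately have "N / 2 \<le> sqrt 2 * (N * cos \<beta> - \<delta>)" using N2 by linarith
      then show ?thesis by (simp only: \<rho>_def polar)
    qed
    have \<rho>2: "- (sqrt 2) * norm \<xi> ^ 2 \<le> \<rho> * (Re \<xi> + Im \<xi>)"
    proof -
      have "N * cos \<beta> \<le> N * 1" using N0 by (intro mult_left_mono) auto
      then have "N * cos \<beta> - \<delta> \<le> N" "cos \<beta> + sin \<beta> \<le> 1" "0 \<le> cos \<beta> + sin \<beta>"
        using \<delta>0 sb sb2 cos_le_one[of \<beta>] by linarith+
      then have "(N * cos \<beta> - \<delta>) * (cos \<beta> + sin \<beta>) \<le> N * 1"
        using N0 by (intro mult_mono) auto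
      then have "sqrt 2 * N * ((N * cos \<beta> - \<delta>) * (cos \<beta> + sin \<beta>)) \<le> sqrt 2 * N * (N * 1)"
        using N0 by (intro mult_left_mono) auto
      then show ?thesis by (simp add: \<rho>_def polar power2_eq_square algebra_simps)
    qed
    have imA2: "Im A \<le> - \<eta> / norm \<xi> ^ 2"
    proof -
      have "\<eta> / N ^ 2 \<le> (1 / (2 * pi)) / N ^ 2" using \<eta> by (intro divide_right_mono) auto
      also have "\<dots> = \<delta>" by (simp add: \<delta>_def)
      finally show ?thesis by (simp add: A_def polar)
    qed
    have inv\<delta>: "1 / \<delta> = 2 * pi * N ^ 2" by (simp add: \<delta>_def)
    have ray: "norm (ray_integral (aux_kernel s) P (cis (pi / 4))) \<le> K2 * C0 / N * T"
    proof -
      have "norm (ray_integral (aux_kernel s) P (cis (pi / 4)))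
          \<le> (LINT t|lborel. exp (6 + pi) / \<delta> * exp (- (pi / 2) * (t - 0) ^ 2))"
      proof (rule norm_ray_integral_le)
        show "integrable lborel (\<lambda>t. exp (6 + pi) / \<delta> * exp (- (pi / 2) * (t - 0) ^ 2))"
          by (intro integrable_mult_right integrable_shifted_gaussian) auto
        fix t :: real
        show "0 \<le> exp (6 + pi) / \<delta> * exp (- (pi / 2) * (t - 0) ^ 2)" using \<delta>0 by simp
        assume t: "0 \<le> t"
        define x where "x = P + of_real t * cis (pi / 4)"
        define w where "w = t * (sqrt 2 / 2)"
        have w: "0 \<le> w" "w ^ 2 = t ^ 2 / 2" using t by (simp_all add: w_def power_mult_distrib power_divide)
        have x: "Re x = 1 - 2 * \<delta> + w" "Im x = - \<delta> + w" by (simp_all add: x_def P_def w_def cos_45 sin_45)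
        have "w ^ 2 \<le> Re x ^ 2" using w \<delta>1 by (intro power_mono) (auto simp: x)
        then have nx: "t ^ 2 / 2 \<le> norm x ^ 2"
          unfolding cmod_power2 w(2)[symmetric] by (simp add: add_increasing2)
        have b: "norm x powr (- Re s) * exp (Im s * Arg x) \<le> exp 6"
          by (rule unit_corner_powr_bound[OF \<delta>0 \<delta>1 _ _ res]) (use w in \<open>auto simp: x\<close>)
        have d: "\<delta> \<le> norm (sin_denom x)"
          by (rule norm_sin_denom_ge_strip) (use \<delta>0 \<delta>1 in \<open>auto simp: x\<close>)
        have "Re x - Im x = 1 - \<delta>" by (simp add: x)
        then have "(Re x - Im x) ^ 2 \<le> 1 ^ 2" using \<delta>0 \<delta>1 by (intro power_mono) auto
        then have "pi * (Re x - Im x) ^ 2 \<le> pi * 1 ^ 2" by (intro mult_left_mono) auto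
        moreover have "pi * (t ^ 2 / 2) \<le> pi * norm x ^ 2" using nx by (intro mult_left_mono) auto
        moreover have "pi * 1 ^ 2 = pi" "- (pi / 2) * (t - 0) ^ 2 = - (pi * (t ^ 2 / 2))" by simp_all
        ultimately have "pi * (Re x - Im x) ^ 2 - pi * norm x ^ 2 \<le> pi + - (pi / 2) * (t - 0) ^ 2" by linarith
        then have g: "exp (pi * (Re x - Im x) ^ 2 - pi * norm x ^ 2) \<le> exp pi * exp (- (pi / 2) * (t - 0) ^ 2)"
          unfolding exp_add[symmetric] exp_le_cancel_iff .
        have "norm (aux_kernel s x) \<le> exp 6 * (exp pi * exp (- (pi / 2) * (t - 0) ^ 2)) / \<delta>"
          unfolding norm_aux_kernel' using b g d \<delta>0 by (intro frac_le mult_mono) auto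
        also have "\<dots> = exp (6 + pi) / \<delta> * exp (- (pi / 2) * (t - 0) ^ 2)" by (simp add: exp_add)
        finally show "norm (aux_kernel s (P + of_real t * cis (pi / 4)))
            \<le> exp (6 + pi) / \<delta> * exp (- (pi / 2) * (t - 0) ^ 2)" by (simp only: x_def)
      qed simp
      also have "\<dots> = exp (6 + pi) / \<delta> * I" unfolding I_def by (rule integral_mult_right_zero)
      also have "\<dots> = 2 * pi * exp (6 + pi) * I * (N ^ 2 * 1)"
        unfolding divide_inverse using inv\<delta> by (simp add: divide_inverse)
      also have "\<dots> \<le> 2 * pi * exp (6 + pi) * I * (N ^ 3 * (2 * T * E))"
        using rel I0 N0 by (intro mult_left_mono mult_mono power_increasing) auto
      also have "\<dots> = K2 * T * (N ^ 3 * E)" by (simp add: K2_def)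
      also have "\<dots> \<le> K2 * T * (C0 / N)" using K T0 E by (intro mult_left_mono) auto
      finally show ?thesis by (simp add: mult_ac)
    qed
    have seg: "norm (contour_integral (linepath P A) (aux_kernel s)) \<le> K1 * C0 / N * T"
    proof -
      have B0: "0 \<le> exp 7 / \<delta>" using \<delta>0 by simp
      have "norm (contour_integral (linepath P A) (aux_kernel s)) \<le> exp 7 / \<delta> * norm (A - P)"
      proof (rule aux_kernel_segment_bound[OF _ _ B0])
        show "Im P < 0" "Im A < 0" using \<delta>0 by (simp_all add: P_def A_def)
        fix x assume "x \<in> closed_segment P A"
        then obtain w where w: "0 \<le> w" "w \<le> 1" "x = (1 - w) *\<^sub>R P + w *\<^sub>R A"
          by (auto simp: closed_segment_def)
        have im: "Im x = - \<delta>" by (simp add: w(3) P_def A_def algebra_simps)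
        have re: "Re x = (1 - w) * (1 - 2 * \<delta>) + w * (Re \<xi> - Im \<xi> - \<delta>)" by (simp add: w(3) P_def A_def)
        have "(1 - w) * (1 - 2 * \<delta>) + w * (1 - 2 * \<delta>) \<le> (1 - w) * (1 - 2 * \<delta>) + w * (Re \<xi> - Im \<xi> - \<delta>)"
          using w X_ge \<delta>0 by (intro add_left_mono mult_left_mono) auto
        then have re_ge: "1 - 2 * \<delta> \<le> Re x" unfolding re by (simp add: algebra_simps)
        have "(1 - w) * (1 - 2 * \<delta>) + w * (Re \<xi> - Im \<xi> - \<delta>) \<le> (1 - w) * (2 * N) + w * (2 * N)"
          using w X_le N2 \<delta>0 by (intro add_mono mult_left_mono) auto
        then have re_le: "Re x \<le> 2 * N" unfolding re by (simp add: algebra_simps)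
        have b: "norm x powr (- Re s) * exp (Im s * Arg x) \<le> exp 6"
          by (rule unit_corner_powr_bound[OF \<delta>0 \<delta>1 re_ge _ res]) (simp add: im)
        \<comment> \<open>At depth \<open>\<delta>\<close> the factor
          \<open>exp (pi * \<i> * x ^ 2)\<close> grows along the whole segment by at most
          \<open>exp (2 / N)\<close>.\<close>
        have "2 * pi * \<delta> * Re x \<le> 2 * pi * \<delta> * (2 * N)" using re_le \<delta>0 by (intro mult_left_mono) auto
        also have "\<dots> = 2 / N" using N0 by (simp add: \<delta>_def power2_eq_square)
        also have "\<dots> \<le> 1" using N2 by simp
        finally have g: "exp (- 2 * pi * Re x * Im x) \<le> exp 1" by (simp add: im mult_ac)
        have "\<delta> = 1 * \<delta>" by simp
        also have "\<dots> \<le> 2 * pi * \<delta>" using \<delta>0 pi_ge_two by (intro mult_right_mono) auto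
        also have "\<dots> \<le> norm (sin_denom x)" using norm_sin_denom_ge_Im[of x] \<delta>0 by (simp add: im)
        finally have d: "\<delta> \<le> norm (sin_denom x)" .
        have "norm (aux_kernel s x) \<le> exp 6 * exp 1 / \<delta>"
          unfolding norm_aux_kernel using b g d \<delta>0 by (intro frac_le mult_mono) auto
        then show "norm (aux_kernel s x) \<le> exp 7 / \<delta>" by (simp add: exp_add[symmetric])
      qed
      also have "\<dots> \<le> exp 7 / \<delta> * (3 * N)"
      proof (rule mult_left_mono[OF _ B0])
        have "norm (A - P) \<le> \<bar>Re \<xi> - Im \<xi> - \<delta> - (1 - 2 * \<delta>)\<bar>"
          using norm_Complex_le[of "Re \<xi> - Im \<xi> - \<delta> - (1 - 2 * \<delta>)" 0]
          by (simp add: A_def P_def complex_diff)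
        also have "\<dots> \<le> 3 * N" using X_le X_ge N2 \<delta>0 \<delta>1 by linarith
        finally show "norm (A - P) \<le> 3 * N" .
      qed
      also have "\<dots> = 2 * pi * exp 7 * 3 * (N ^ 3 * 1)"
        unfolding divide_inverse using inv\<delta> by (simp add: divide_inverse power3_eq_cube power2_eq_square)
      also have "\<dots> \<le> 2 * pi * exp 7 * 3 * (N ^ 3 * (2 * T * E))"
        using rel N0 by (intro mult_left_mono) auto
      also have "\<dots> = K1 * T * (N ^ 3 * E)" by (simp add: K1_def)
      also have "\<dots> \<le> K1 * T * (C0 / N)" using K T0 E by (intro mult_left_mono) auto
      finally show ?thesis by (simp add: mult_ac)
    qed
    have mono: "K1 * C0 / N * T \<le> (K1 + K2) * C0 / N * T" "K2 * C0 / N * T \<le> (K1 + K2) * C0 / N * T"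
      using K C0(1) N0 T0 by (auto intro!: mult_right_mono divide_right_mono)
    have "connecting_path s \<xi> \<eta> ((K1 + K2) * C0) P A"
      unfolding connecting_path_def
      using A\<rho> \<rho>1 \<rho>2 imA2 order_trans[OF seg mono(1)] order_trans[OF ray mono(2)] \<delta>0 \<delta>1
      by (auto simp: T_def polar(1) P_def)
    then show "connecting_path s \<xi> \<eta> ((K1 + K2) * C0)
         (Complex (1 - 2 * (1 / (2 * pi * N ^ 2))) (- (1 / (2 * pi * N ^ 2))))
         (Complex (Re \<xi> - Im \<xi> - 1 / (2 * pi * N ^ 2)) (- (1 / (2 * pi * N ^ 2))))"
      unfolding P_def A_def \<delta>_def .
  qed
qed

subsection \<open>The asymptotic formula\<close>

text \<open>The bound on \<open>norm s\<close> means \<open>N > exp 1\<close>, whence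
  \<open>ln N \<ge> 1\<close>. For \<open>b = - 2 * \<beta> > 0\<close> the upper bound on the
  argument reads \<open>tan b < pi / (2 * ln N)\<close>; cleared of denominators it is the
  hypothesis of \<open>saddle_exponent_lower_bound\<close>.\<close>

lemma M_polar:
  assumes \<theta>: "0 < \<theta>" "\<theta> < pi / 2" and s: "s \<in> M \<theta>"
  obtains N \<beta> where "exp 1 \<le> N" "norm (xi s) = N" "xi s = rcis N (- pi / 2 - \<beta>)"
    "s = 2 * of_real pi * \<i> * xi s ^ 2" "- (pi / 4) < \<beta>" "\<beta> \<le> pi / 4 - \<theta> / 2"
    "\<beta> < 0 \<Longrightarrow> - sin (2 * \<beta>) * ln N \<le> cos (2 * \<beta>) * (pi / 2)"
proof -
  define N where "N = norm (xi s)"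
  define \<beta> where "\<beta> = - (pi / 4) - Arg s / 2"
  have ns: "2 * pi * exp 1 ^ 2 < norm s" and arg: "- pi + \<theta> < Arg s"
    "Arg s < - pi / 2 + arctan (pi / (2 * ln N))"
    using s by (simp_all add: M_def N_def)
  have "0 < 2 * pi * exp (1::real) ^ 2" by simp
  then have "0 < norm s" using ns by (rule less_trans)
  then have s0: "s \<noteq> 0" by simp
  have arg0: "Arg s < 0" using arg arctan_ubound[of "pi / (2 * ln N)"] by linarith
  then have arg_pi: "Arg s < pi" by (rule less_trans) simp
  note xi = xi_eq[OF s0 arg_pi]
  have N_sqrt: "N = sqrt (norm s / (2 * pi))" by (simp add: N_def xi)
  have "exp 1 ^ 2 \<le> norm s / (2 * pi)" using ns by (simp add: field_simps)
  then have N: "exp 1 \<le> N" unfolding N_sqrt by (rule real_le_rsqrt)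
  have L: "1 \<le> ln N" using N ln_ge_iff[of N 1] less_le_trans[OF exp_gt_zero N] by simp
  show ?thesis
  proof (rule that[OF N])
    show "norm (xi s) = N" by (simp add: N_def)
    have "Arg s / 2 - pi / 4 = - pi / 2 - \<beta>" by (simp add: \<beta>_def)
    then show "xi s = rcis N (- pi / 2 - \<beta>)" unfolding xi(1) N_sqrt by simp
    show "s = 2 * of_real pi * \<i> * xi s ^ 2" by (simp add: xi(3))
    show "- (pi / 4) < \<beta>" "\<beta> \<le> pi / 4 - \<theta> / 2" using arg arg0 by (simp_all add: \<beta>_def)
    assume "\<beta> < 0"
    define b where "b = - 2 * \<beta>"
    have b: "0 < b" "b < pi / 2" using \<open>\<beta> < 0\<close> arg0 by (simp_all add: b_def \<beta>_def)
    have "b < arctan (pi / (2 * ln N))" using arg by (simp add: b_def \<beta>_def)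
    then have "tan b < tan (arctan (pi / (2 * ln N)))"
      using b arctan_ubound by (intro tan_monotone) auto
    then have "sin b / cos b < pi / (2 * ln N)" unfolding tan_arctan unfolding tan_def .
    moreover have "0 < cos b" using b by (intro cos_gt_zero_pi) auto
    ultimately have "sin b * ln N \<le> cos b * (pi / 2)" using L by (simp add: field_simps)
    then show "- sin (2 * \<beta>) * ln N \<le> cos (2 * \<beta>) * (pi / 2)" by (simp add: b_def)
  qed
qed

lemma riemann_aux_main_term:
  assumes \<theta>: "0 < \<theta>" "\<theta> < pi / 2"
  obtains C where "C \<ge> 0"
    "\<And>c s. 0 < c \<Longrightarrow> c < 1 \<Longrightarrow> s \<in> M \<theta> \<Longrightarrow>
       norm (riemann_aux c s - main_term s (xi s)) \<le> C / norm (xi s) * norm (main_term s (xi s))"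
proof -
  define d where "d = sin (\<theta> / 2)"
  \<comment> \<open>The depth of \<open>A\<close> below the real axis is at least
    \<open>d / 2\<close> for \<open>\<beta> \<ge> 0\<close> and equals
    \<open>1 / (2 * pi * N ^ 2)\<close> for \<open>\<beta> < 0\<close>;
    \<open>\<eta> / N ^ 2\<close> is below both.\<close>
  define \<eta> where "\<eta> = min (d / 2) (1 / (2 * pi))"
  have d: "0 < d" using \<theta> by (auto simp: d_def intro!: sin_gt_zero)
  then have \<eta>: "0 < \<eta>" "\<eta> \<le> sin (\<theta> / 2) / 2" "\<eta> \<le> 1 / (2 * pi)"
    by (simp_all add: \<eta>_def d_def)
  obtain C1 where C1: "C1 \<ge> 0"
    "\<And>N \<beta> \<xi> s. exp 1 \<le> N \<Longrightarrow> 0 \<le> \<beta> \<Longrightarrow> \<beta> \<le> pi / 4 - \<theta> / 2 \<Longrightarrow> \<xi> = rcis N (- pi / 2 - \<beta>) \<Longrightarrow>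
       s = 2 * of_real pi * \<i> * \<xi> ^ 2 \<Longrightarrow>
       connecting_path s \<xi> \<eta> C1 (Complex (1 / 4) (- 1 / 4))
         (Complex ((Re \<xi> - Im \<xi>) / 2) (- (Re \<xi> - Im \<xi>) / 2))"
    using connecting_path_left[OF \<theta> \<eta>(1,2)] by blast
  obtain C2 where C2: "C2 \<ge> 0"
    "\<And>N \<beta> \<xi> s. exp 1 \<le> N \<Longrightarrow> - (pi / 4) < \<beta> \<Longrightarrow> \<beta> < 0 \<Longrightarrow>
       - sin (2 * \<beta>) * ln N \<le> cos (2 * \<beta>) * (pi / 2) \<Longrightarrow> \<xi> = rcis N (- pi / 2 - \<beta>) \<Longrightarrow>
       s = 2 * of_real pi * \<i> * \<xi> ^ 2 \<Longrightarrow>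
       connecting_path s \<xi> \<eta> C2 (Complex (1 - 2 * (1 / (2 * pi * N ^ 2))) (- (1 / (2 * pi * N ^ 2))))
         (Complex (Re \<xi> - Im \<xi> - 1 / (2 * pi * N ^ 2)) (- (1 / (2 * pi * N ^ 2))))"
    using connecting_path_right[OF \<eta>(1,3)] by blast
  obtain C3 where C3: "C3 \<ge> 0"
    "\<And>\<xi> s \<rho>. 1 \<le> norm \<xi> \<Longrightarrow> s = 2 * of_real pi * \<i> * \<xi> ^ 2 \<Longrightarrow>
      Im \<xi> \<le> - norm \<xi> / 2 \<Longrightarrow> Re \<xi> + Im \<xi> \<le> 0 \<Longrightarrow> d * norm \<xi> \<le> Re \<xi> - Im \<xi> \<Longrightarrow>
      norm \<xi> / 2 \<le> \<rho> \<Longrightarrow> - (sqrt 2) * norm \<xi> ^ 2 \<le> \<rho> * (Re \<xi> + Im \<xi>) \<Longrightarrow>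
      Im (\<xi> + of_real \<rho> * cis (pi / 4)) \<le> - \<eta> / norm \<xi> ^ 2 \<Longrightarrow>
      norm (ray_integral (aux_kernel s) (\<xi> + of_real \<rho> * cis (pi / 4)) (- cis (pi / 4)) - main_term s \<xi>)
        \<le> C3 / norm \<xi> * norm (main_term s \<xi>)"
    using saddle_ray_asymptotics[OF d \<eta>(1)] by blast
  show ?thesis
  proof (rule that[of "C3 + 2 * (C1 + C2)"])
    show "C3 + 2 * (C1 + C2) \<ge> 0" using C1(1) C2(1) C3(1) by simp
    fix c :: real and s :: complex
    assume c: "0 < c" "c < 1" and sM: "s \<in> M \<theta>"
    define \<xi> where "\<xi> = xi s"
    obtain N \<beta> where N: "exp 1 \<le> N" "norm \<xi> = N" and \<xi>: "\<xi> = rcis N (- pi / 2 - \<beta>)"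
      and s: "s = 2 * of_real pi * \<i> * \<xi> ^ 2" and \<beta>: "- (pi / 4) < \<beta>" "\<beta> \<le> pi / 4 - \<theta> / 2"
      and tan: "\<beta> < 0 \<Longrightarrow> - sin (2 * \<beta>) * ln N \<le> cos (2 * \<beta>) * (pi / 2)"
      using M_polar[OF \<theta> sM] unfolding \<xi>_def by blast
    have N2: "2 \<le> N" using N exp_1_ge_2 by linarith
    have \<beta>4: "\<bar>\<beta>\<bar> < pi / 4" using \<beta> \<theta> by auto
    note polar = polar_saddle[OF _ \<beta>4 \<xi> s]
    have cb: "sqrt 2 / 2 \<le> cos \<beta>"
    proof -
      have "cos (pi / 4) \<le> cos \<bar>\<beta>\<bar>" using \<beta>4 by (intro cos_monotone_0_pi_le) auto
      then show ?thesis by (simp add: cos_45)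
    qed
    have "1 \<le> sqrt 2" by simp
    then have "1 / 2 \<le> cos \<beta>" using cb by linarith
    then have "N * (1 / 2) \<le> N * cos \<beta>" using N2 by (intro mult_left_mono) auto
    then have im: "Im \<xi> \<le> - norm \<xi> / 2" using N2 by (simp add: polar)
    have "0 \<le> cos (\<beta> - pi / 4)" using \<beta>4 by (intro cos_ge_zero) auto
    then have "0 \<le> (sqrt 2 / 2) * (cos \<beta> + sin \<beta>)"
      by (simp add: cos_diff cos_45 sin_45 algebra_simps)
    then have "0 \<le> N * (cos \<beta> + sin \<beta>)" using N2 by (simp add: zero_le_mult_iff)
    then have ReIm: "Re \<xi> + Im \<xi> \<le> 0" using N2 by (simp add: polar algebra_simps)
    have "d \<le> cos \<beta> - sin \<beta>" unfolding d_def using \<beta> \<theta> by (intro cos_minus_sin_ge) auto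
    then have "N * d \<le> N * (cos \<beta> - sin \<beta>)" using N2 by (intro mult_left_mono) auto
    then have X: "d * norm \<xi> \<le> Re \<xi> - Im \<xi>" using N2 by (simp add: polar algebra_simps)
    define T where "T = norm (main_term s \<xi>)"
    have T0: "0 \<le> T" by (simp add: T_def)
    have "\<exists>P A. connecting_path s \<xi> \<eta> (C1 + C2) P A"
    proof -
      have mono: "connecting_path s \<xi> \<eta> (C1 + C2) P A" if "connecting_path s \<xi> \<eta> C P A" "C \<le> C1 + C2" for C P A
      proof -
        have "C / norm \<xi> * norm (main_term s \<xi>) \<le> (C1 + C2) / norm \<xi> * norm (main_term s \<xi>)"
          using that(2) by (intro mult_right_mono divide_right_mono) auto
        from order_trans[OF _ this] show ?thesis using that(1) unfolding connecting_path_def by blast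
      qed
      show ?thesis
      proof (cases "\<beta> < 0")
        case True
        show ?thesis
          using mono[OF C2(2)[OF N(1) \<beta>(1) True tan[OF True] \<xi> s]] C1(1) by auto
      next
        case False
        then have "0 \<le> \<beta>" by simp
        show ?thesis
          using mono[OF C1(2)[OF N(1) \<open>0 \<le> \<beta>\<close> \<beta>(2) \<xi> s]] C2(1) by auto
      qed
    qed
    then obtain P A \<rho> where P: "0 < Re P - Im P" "Re P - Im P < 1" "Im P < 0"
      and A: "A = \<xi> + of_real \<rho> * cis (pi / 4)" and \<rho>: "norm \<xi> / 2 \<le> \<rho>"
        "- (sqrt 2) * norm \<xi> ^ 2 \<le> \<rho> * (Re \<xi> + Im \<xi>)" and imA: "Im A \<le> - \<eta> / norm \<xi> ^ 2"
      and seg: "norm (contour_integral (linepath P A) (aux_kernel s)) \<le> (C1 + C2) / norm \<xi> * T"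
      and ray: "norm (ray_integral (aux_kernel s) P (cis (pi / 4))) \<le> (C1 + C2) / norm \<xi> * T"
      unfolding connecting_path_def T_def by blast
    have "0 < \<eta> / norm \<xi> ^ 2" using \<eta>(1) N N2 by simp
    then have imA0: "Im A < 0" using imA by simp
    have main: "norm (ray_integral (aux_kernel s) A (- cis (pi / 4)) - main_term s \<xi>) \<le> C3 / norm \<xi> * T"
      unfolding A T_def
      by (rule C3(2)[OF _ s im ReIm X \<rho> imA[unfolded A]]) (use N N2 in simp)
    have "norm (riemann_aux c s - main_term s \<xi>) =
        norm ((ray_integral (aux_kernel s) A (- cis (pi / 4)) - main_term s \<xi>)
          + contour_integral (linepath P A) (aux_kernel s) - ray_integral (aux_kernel s) P (cis (pi / 4)))"
      unfolding riemann_aux_decomposition[OF c P imA0] by (simp add: algebra_simps)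
    also have "\<dots> \<le> C3 / norm \<xi> * T + (C1 + C2) / norm \<xi> * T + (C1 + C2) / norm \<xi> * T"
      using main seg ray norm_triangle_ineq4 norm_triangle_ineq
      by (smt (verit))
    also have "\<dots> = (C3 + 2 * (C1 + C2)) / norm \<xi> * T"
      by (simp add: algebra_simps add_divide_distrib)
    finally show "norm (riemann_aux c s - main_term s (xi s))
        \<le> (C3 + 2 * (C1 + C2)) / norm (xi s) * norm (main_term s (xi s))"
      by (simp add: T_def \<xi>_def)
  qed
qed

theorem theorem16:
  fixes \<theta> :: real
  assumes "0 < \<theta>" "\<theta> < pi / 2"
  shows "\<exists>C::real. \<forall>c\<in>{0<..<1::real}. \<forall>s\<in>M \<theta>. \<exists>\<epsilon>::complex.
           norm \<epsilon> \<le> C * inverse (norm (xi s)) \<and>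
           riemann_aux c s =
             (- 1) powi (ell s) / (2 * \<i>) * xi s powr (- s) * exp (of_real pi * \<i> * xi s ^ 2)
               * G (qpar s) * (1 + \<epsilon>)"
proof -
  obtain C where C: "C \<ge> 0"
    "\<And>c s. 0 < c \<Longrightarrow> c < 1 \<Longrightarrow> s \<in> M \<theta> \<Longrightarrow>
       norm (riemann_aux c s - main_term s (xi s)) \<le> C / norm (xi s) * norm (main_term s (xi s))"
    using riemann_aux_main_term[OF assms] by blast
  show ?thesis
  proof (intro exI[of _ "2 * (C + 2)"] ballI)
    fix c s assume c: "c \<in> {0<..<1::real}" and s: "s \<in> M \<theta>"
    define T where "T = main_term s (xi s)"
    obtain N \<beta> where N: "exp 1 \<le> N" "norm (xi s) = N" and \<xi>: "xi s = rcis N (- pi / 2 - \<beta>)"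
      and s\<xi>: "s = 2 * of_real pi * \<i> * xi s ^ 2" and \<beta>: "- (pi / 4) < \<beta>" "\<beta> \<le> pi / 4 - \<theta> / 2"
      using M_polar[OF assms s] by blast
    have N2: "2 \<le> N" using N exp_1_ge_2 by linarith
    have \<beta>4: "\<bar>\<beta>\<bar> < pi / 4" using \<beta> assms by auto
    have "cos (pi / 3) \<le> cos \<bar>\<beta>\<bar>" using \<beta>4 by (intro cos_monotone_0_pi_le) auto
    then have "N * (1 / 2) \<le> N * cos \<beta>" using N2 by (intro mult_left_mono) (auto simp: cos_60)
    then have im: "Im (xi s) \<le> - norm (xi s) / 2"
      using N2 by (simp add: polar_saddle(1,3)[OF _ \<beta>4 \<xi> s\<xi>])
    obtain \<delta> where \<delta>:
      "(- 1) powi (ell s) / (2 * \<i>) * xi s powr (- s) * exp (of_real pi * \<i> * xi s ^ 2) * G (qpar s)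
         = T * (1 + \<delta>)" "norm \<delta> \<le> 2 / norm (xi s)" "norm \<delta> \<le> 1 / 2"
      using main_term_eq_G[OF im] N N2 unfolding T_def by blast
    have "xi s \<noteq> 0" using N N2 by auto
    then have T0: "T \<noteq> 0" by (simp add: T_def main_term_def)
    have d: "1 / 2 \<le> norm (1 + \<delta>)" using norm_triangle_ineq2[of 1 "- \<delta>"] \<delta>(3) by simp
    then have d0: "1 + \<delta> \<noteq> 0" by auto
    define r where "r = (riemann_aux c s - T) / T"
    have r: "norm r \<le> C / norm (xi s)"
      using C(2)[of c s] c s T0 by (simp add: r_def norm_divide T_def divide_le_eq)
    have R: "riemann_aux c s = T * (1 + r)" using T0 by (simp add: r_def distrib_left[of T 1])
    \<comment> \<open>The witness solves \<open>(1 + \<delta>) * (1 + \<epsilon>) = 1 + r\<close>;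
      dividing by \<open>1 + \<delta>\<close>, of modulus at least 1/2, doubles the
      constant.\<close>
    show "\<exists>\<epsilon>. norm \<epsilon> \<le> 2 * (C + 2) * inverse (norm (xi s)) \<and>
           riemann_aux c s =
             (- 1) powi (ell s) / (2 * \<i>) * xi s powr (- s) * exp (of_real pi * \<i> * xi s ^ 2)
               * G (qpar s) * (1 + \<epsilon>)"
    proof (intro exI[of _ "(r - \<delta>) / (1 + \<delta>)"] conjI)
      have "norm (r - \<delta>) / norm (1 + \<delta>) \<le> (C / norm (xi s) + 2 / norm (xi s)) / (1 / 2)"
        using d r \<delta>(2) norm_triangle_ineq4[of r \<delta>] C(1) by (intro frac_le) auto
      also have "\<dots> = 2 * (C + 2) * inverse (norm (xi s))"
        using \<open>xi s \<noteq> 0\<close> by (simp add: field_simps)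
      finally show "norm ((r - \<delta>) / (1 + \<delta>)) \<le> 2 * (C + 2) * inverse (norm (xi s))"
        unfolding norm_divide .
      have "(1 + \<delta>) * (1 + (r - \<delta>) / (1 + \<delta>)) = 1 + r" using d0 by (simp add: distrib_left[of "1 + \<delta>" 1])
      then show "riemann_aux c s = (- 1) powi (ell s) / (2 * \<i>) * xi s powr (- s) * exp (of_real pi * \<i> * xi s ^ 2)
               * G (qpar s) * (1 + (r - \<delta>) / (1 + \<delta>))"
        unfolding \<delta>(1) R by (simp add: mult.assoc)
    qed
  qed
qed

end
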